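(* Let $G$ be a graph. Then $\operatorname{pqn}(G)=1$ if and only if $G$ does not contain any of $\mathcal{F}_1,\dots,\mathcal{F}_8$ as a minor.
   Context: All graphs are finite, simple and undirected; a minor of $G$ is a graph obtained from $G$ by edge contractions, edge deletions and vertex deletions. The graphs $\mathcal{F}_1,\dots,\mathcal{F}_8$ are: $\mathcal{F}_1=K_4$. $\mathcal{F}_2$: two triangles $abc$ and $cde$ sharing exactly the vertex $c$ (edges $ab,bc,ca,cd,de,ec$). $\mathcal{F}_3$: vertices $a,b,c,d,e$ with edges $ab,bc,cd,de,ea,be$. $\mathcal{F}_4$: a triangle $abc$ together with edges $ad,de,af,fg$ ($d,e,f,g$ new vertices). $\mathcal{F}_5$: a triangle $abc$ together with edges $ad,de,bf,cg$ ($d,e,f,g$ new vertices). $\mathcal{F}_6$: vertices $a,b,c,d,e$ with edges $ab,bc,cd,da,ac,de$. $\mathcal{F}_7$: vertices $a,b,c,d,e$ with edges $ab,bc,cd,da,ac,ae$. $\mathcal{F}_8$: a $4$-cycle $abcd$ (edges $ab,bc,cd,da$) together with edges $ae,df,fg$ ($e,f,g$ new vertices). An edge-weighted graph $\langle G,w\rangle$ is a graph $G=(V,E)$ with $w\colon E\to\mathbb{R}$. A PQ-layout of $\langle G,w\rangle$ with $k$ priority queues consists of a linear ordering $\prec$ of $V$ and a partition of $E$ into $k$ sets $\mathcal{P}_1,\dots,\mathcal{P}_k$ such that there is no $i$ and no two edges $e=uv$, $e'=u'v'$ in $\mathcal{P}_i$ with $w(e)>w(e')$ and $u\prec v$, $u'\prec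 v$, $v\prec v'$. $\operatorname{pqn}(G,w)$ is the minimum $k\ge0$ such that $\langle G,w\rangle$ has a PQ-layout with $k$ priority queues, and $\operatorname{pqn}(G)$ is the minimum $k\ge0$ such that $\operatorname{pqn}(G,w)\le k$ for every $w\colon E\to\mathbb{R}$.
   Formalization: The graph G is assumed to have at least one edge: an edgeless graph has pqn(G) = 0 (the minimum is over k ≥ 0) yet contains none of F_1,…,F_8 as a minor, so the equivalence fails exactly for edgeless graphs. *)

theory Defs
  imports Complex_Main "HOL-Library.Disjoint_Sets"
begin

section \<open>Finite simple graphs and minors\<close>

type_synonym 'a graph = "'a set \<times> 'a set set"

abbreviation verts :: "'a graph \<Rightarrow> 'a set" where
  "verts \<equiv> fst"

abbreviation edges :: "'a graph \<Rightarrow> 'a set set" where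
  "edges \<equiv> snd"

definition simple_graph :: "'a graph \<Rightarrow> bool" where
  "simple_graph G \<longleftrightarrow> finite (verts G) \<and> (\<forall>e \<in> edges G. e \<subseteq> verts G \<and> card e = 2)"

definition graph_iso :: "'a graph \<Rightarrow> 'b graph \<Rightarrow> bool" where
  "graph_iso G H \<longleftrightarrow>
     (\<exists>f. bij_betw f (verts G) (verts H) \<and> edges H = (\<lambda>e. f ` e) ` edges G)"

definition delete_vertex :: "'a \<Rightarrow> 'a graph \<Rightarrow> 'a graph" where
  "delete_vertex v G = (verts G - {v}, {e \<in> edges G. v \<notin> e})"

definition delete_edge :: "'a set \<Rightarrow> 'a graph \<Rightarrow> 'a graph" where
  "delete_edge e G = (verts G, edges G - {e})"

text \<open>Contracting the edge \<open>uv\<close> merges \<open>v\<close> into \<open>u\<close>. The resulting loop is dropped by the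
  cardinality condition, and parallel edges coincide as sets.\<close>

definition contract_edge :: "'a \<Rightarrow> 'a \<Rightarrow> 'a graph \<Rightarrow> 'a graph" where
  "contract_edge u v G =
     (verts G - {v},
      {e \<in> (\<lambda>e. (\<lambda>x. if x = v then u else x) ` e) ` edges G. card e = 2})"

inductive minor_step :: "'a graph \<Rightarrow> 'a graph \<Rightarrow> bool" where
  vertex_deletion: "v \<in> verts G \<Longrightarrow> minor_step G (delete_vertex v G)"
| edge_deletion: "e \<in> edges G \<Longrightarrow> minor_step G (delete_edge e G)"
| edge_contraction: "{u, v} \<in> edges G \<Longrightarrow> u \<noteq> v \<Longrightarrow> minor_step G (contract_edge u v G)"

definition has_minor :: "'a graph \<Rightarrow> 'b graph \<Rightarrow> bool" where
  "has_minor G F \<longleftrightarrow> (\<exists>H. minor_step\<^sup>*\<^sup>* G H \<and> graph_iso H F)"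

section \<open>The graphs F1, ..., F8\<close>

text \<open>The vertices \<open>a, b, c, d, e, f, g\<close> are written \<open>0, 1, 2, 3, 4, 5, 6\<close>.\<close>

definition F1 :: "nat graph" where
  "F1 = ({0, 1, 2, 3}, {{0, 1}, {0, 2}, {0, 3}, {1, 2}, {1, 3}, {2, 3}})"

definition F2 :: "nat graph" where
  "F2 = ({0, 1, 2, 3, 4}, {{0, 1}, {1, 2}, {2, 0}, {2, 3}, {3, 4}, {4, 2}})"

definition F3 :: "nat graph" where
  "F3 = ({0, 1, 2, 3, 4}, {{0, 1}, {1, 2}, {2, 3}, {3, 4}, {4, 0}, {1, 4}})"

definition F4 :: "nat graph" where
  "F4 = ({0, 1, 2, 3, 4, 5, 6},
         {{0, 1}, {1, 2}, {2, 0}, {0, 3}, {3, 4}, {0, 5}, {5, 6}})"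

definition F5 :: "nat graph" where
  "F5 = ({0, 1, 2, 3, 4, 5, 6},
         {{0, 1}, {1, 2}, {2, 0}, {0, 3}, {3, 4}, {1, 5}, {2, 6}})"

definition F6 :: "nat graph" where
  "F6 = ({0, 1, 2, 3, 4}, {{0, 1}, {1, 2}, {2, 3}, {3, 0}, {0, 2}, {3, 4}})"

definition F7 :: "nat graph" where
  "F7 = ({0, 1, 2, 3, 4}, {{0, 1}, {1, 2}, {2, 3}, {3, 0}, {0, 2}, {0, 4}})"

definition F8 :: "nat graph" where
  "F8 = ({0, 1, 2, 3, 4, 5, 6},
         {{0, 1}, {1, 2}, {2, 3}, {3, 0}, {0, 4}, {3, 5}, {5, 6}})"

section \<open>Priority queue layouts\<close>

text \<open>The pair \<open>(u, v) \<in> r\<close> means that \<open>u\<close> strictly precedes \<open>v\<close>. An edge is an unordered pair,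
  so both namings of its two endpoints are covered by the quantifiers below. The classes
  \<open>P 0, ..., P (k - 1)\<close> may be empty, which does not affect the minimum number of classes.
  Only the values of \<open>w\<close> on the edges of the graph matter.\<close>

definition pq_layout ::
  "'a graph \<Rightarrow> ('a set \<Rightarrow> real) \<Rightarrow> nat \<Rightarrow> ('a \<times> 'a) set \<Rightarrow> (nat \<Rightarrow> 'a set set) \<Rightarrow> bool" where
  "pq_layout G w k r P \<longleftrightarrow>
     strict_linear_order_on (verts G) r \<and>
     disjoint_family_on P {..<k} \<and>
     (\<Union>i<k. P i) = edges G \<and>
     \<not> (\<exists>i<k. \<exists>u v u' v'. {u, v} \<in> P i \<and> {u', v'} \<in> P i \<and> w {u, v} > w {u', v'} \<and>
          (u, v) \<in> r \<and> (u', v) \<in> r \<and> (v, v') \<in> r)"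

text \<open>The minima are attained for a finite simple graph, as each edge can be given a priority queue
  of its own.\<close>

definition pqn_weighted :: "'a graph \<Rightarrow> ('a set \<Rightarrow> real) \<Rightarrow> nat" where
  "pqn_weighted G w = (LEAST k. \<exists>r P. pq_layout G w k r P)"

definition pqn :: "'a graph \<Rightarrow> nat" where
  "pqn G = (LEAST k. \<forall>w. pqn_weighted G w \<le> k)"

end

theory Submission
  imports Defs
begin

text \<open>A graph \<open>F\<close> is a minor of \<open>G\<close> iff \<open>G\<close> contains disjoint connected branch sets, one for each
  vertex of \<open>F\<close>, that are joined by edges as prescribed by \<open>F\<close>.

  If \<open>F\<close> is one of the forbidden graphs, give the edges between branch sets suitable weights of the
  corresponding edges of \<open>F\<close>, and make the edges inside branch sets lighter than all others. When an
  edge ends at a vertex \<open>v\<close>, no lighter edge spans \<open>v\<close>, so any set that avoids \<open>v\<close> and is connected by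
  lighter edges lies on one side of \<open>v\<close>. For the chosen weights, these constraints on the first and
  last positions of the branch sets are contradictory. Only \<open>F7\<close> needs the branch set of its vertex
  of degree four to be a singleton; a branch set that cannot be shrunk yields \<open>F3\<close> or \<open>F6\<close> instead.

  Conversely, let \<open>G\<close> contain no forbidden minor. Two cycles in a component give a model of \<open>F2\<close> or of
  \<open>K\<^sub>4\<close> minus an edge, and splitting the branch sets of the latter shows that the component is
  \<open>K\<^sub>4\<close> minus an edge or \<open>K\<^sub>2\<^sub>,\<^sub>3\<close>, which are laid out by hand. Trees are laid out in the order of Prim's
  algorithm. In a component with a single cycle, let \<open>m\<close> be the largest weight on the cycle. It
  suffices to visit the cycle such that at its last vertex every open edge that does not start or end
  there has weight at least \<open>m\<close>; the rest of the component is a forest attached to it, and Prim's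
  algorithm finishes the layout. By \<open>F4\<close>, a tree hanging off the cycle can be laid out so that its
  root comes last, and \<open>F5\<close> and \<open>F8\<close> limit which vertices of the cycle carry such trees.\<close>

section \<open>Connected sets\<close>

text \<open>A tree is harmless because a single edge ends at each new vertex, and it can be the
  lightest one available. A cycle breaks this once: both cycle edges at its last vertex end there,
  so all other edges open at that moment must be at least as heavy as both. With \<open>m\<close>
  bounding both, bridges of weight at least \<open>m\<close> may stay open, whereas lighter bridges
  at cycle vertices visited earlier should be closed by then. This is why a tree of light bridges is
  placed ahead of the cycle vertex that carries it, with that vertex as its last point.

  Whether one queue suffices is not obviously inherited under contraction, so neither direction
  passes to a minor: weights and orders are always constructed on \<open>G\<close> itself, from
  branch sets. Connectivity is expressed by cuts because nearly every step asks for an edge that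
  leaves a given set. Ties between weights are allowed throughout; only a strict inequality can
  violate the queue condition.\<close>

definition adjacent :: "'a set set \<Rightarrow> 'a set \<Rightarrow> 'a set \<Rightarrow> bool" where
  "adjacent E X Y \<longleftrightarrow> (\<exists>x\<in>X. \<exists>y\<in>Y. {x, y} \<in> E)"

text \<open>Cuts replace paths. The edge that crosses a cut has both ends in \<open>X\<close>, so
  this is connectivity of the subgraph induced by \<open>X\<close>.\<close>

definition conn :: "'a set set \<Rightarrow> 'a set \<Rightarrow> bool" where
  "conn E X \<longleftrightarrow> X \<noteq> {} \<and>
     (\<forall>A B. A \<union> B = X \<and> A \<inter> B = {} \<and> A \<noteq> {} \<and> B \<noteq> {} \<longrightarrow> adjacent E A B)"

lemma adjacentI: "{x, y} \<in> E \<Longrightarrow> x \<in> X \<Longrightarrow> y \<in> Y \<Longrightarrow> adjacent E X Y"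
  unfolding adjacent_def by blast

lemma adjacentE:
  assumes "adjacent E X Y"
  obtains x y where "x \<in> X" "y \<in> Y" "{x, y} \<in> E"
  using assms unfolding adjacent_def by blast

lemma adjacent_sym: "adjacent E X Y \<longleftrightarrow> adjacent E Y X"
  unfolding adjacent_def by (metis insert_commute)

lemma adjacent_mono:
  "adjacent E X Y \<Longrightarrow> E \<subseteq> E' \<Longrightarrow> X \<subseteq> X' \<Longrightarrow> Y \<subseteq> Y' \<Longrightarrow> adjacent E' X' Y'"
  unfolding adjacent_def by blast

lemma adjacent_Un1: "adjacent E (X \<union> Y) Z \<longleftrightarrow> adjacent E X Z \<or> adjacent E Y Z"
  and adjacent_Un2: "adjacent E Z (X \<union> Y) \<longleftrightarrow> adjacent E Z X \<or> adjacent E Z Y"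
  unfolding adjacent_def by blast+

lemma conn_ne: "conn E X \<Longrightarrow> X \<noteq> {}"
  unfolding conn_def by blast

lemma conn_mono: "conn E X \<Longrightarrow> E \<subseteq> E' \<Longrightarrow> conn E' X"
  unfolding conn_def using adjacent_mono[OF _ _ order_refl order_refl] by metis

lemma conn_cut:
  assumes "conn E X" "A \<subseteq> X" "A \<noteq> {}" "X - A \<noteq> {}"
  shows "adjacent E A (X - A)"
proof -
  have "A \<union> (X - A) = X \<and> A \<inter> (X - A) = {} \<and> A \<noteq> {} \<and> X - A \<noteq> {}" using assms by auto
  then show ?thesis using assms(1) unfolding conn_def by metis
qed

lemma connI:
  assumes "X \<noteq> {}" "\<And>A. A \<subseteq> X \<Longrightarrow> A \<noteq> {} \<Longrightarrow> X - A \<noteq> {} \<Longrightarrow> adjacent E A (X - A)"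
  shows "conn E X"
  unfolding conn_def
proof (intro conjI allI impI)
  fix A B assume AB: "A \<union> B = X \<and> A \<inter> B = {} \<and> A \<noteq> {} \<and> B \<noteq> {}"
  then have "A \<subseteq> X" "B = X - A" by auto
  then show "adjacent E A B" using assms(2)[of A] AB by simp
qed (rule assms(1))

lemma conn_single [simp]: "conn E {x}"
  by (rule connI) (auto simp: subset_singleton_iff)

lemma conn_Un_meet:
  assumes X: "conn E X" and Y: "conn E Y" and "X \<inter> Y \<noteq> {}"
  shows "conn E (X \<union> Y)"
  unfolding conn_def
proof (intro conjI allI impI)
  show "X \<union> Y \<noteq> {}" using conn_ne[OF X] by blast
next
  fix A B assume AB: "A \<union> B = X \<union> Y \<and> A \<inter> B = {} \<and> A \<noteq> {} \<and> B \<noteq> {}"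
  show "adjacent E A B"
  proof (cases "A \<inter> X \<noteq> {} \<and> B \<inter> X \<noteq> {}")
    case True
    then have "adjacent E (A \<inter> X) (X - A \<inter> X)" using AB by (intro conn_cut[OF X]) auto
    then show ?thesis using AB by (elim adjacent_mono) auto
  next
    case False
    have "A \<inter> Y \<noteq> {}" "B \<inter> Y \<noteq> {}" using False AB assms(3) by blast+
    then have "adjacent E (A \<inter> Y) (Y - A \<inter> Y)" using AB by (intro conn_cut[OF Y]) auto
    then show ?thesis using AB by (elim adjacent_mono) auto
  qed
qed

lemma conn_edge:
  assumes "{x, y} \<in> E"
  shows "conn E {x, y}"
proof (rule connI)
  fix A assume A: "A \<subseteq> {x, y}" "A \<noteq> {}" "{x, y} - A \<noteq> {}"
  show "adjacent E A ({x, y} - A)"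
  proof (cases "x \<in> A")
    case True
    then have "y \<in> {x, y} - A" using A by auto
    then show ?thesis using True assms by (intro adjacentI)
  next
    case False
    then have "y \<in> A" using A by auto
    then show ?thesis using False assms by (intro adjacentI[of y x]) (auto simp: insert_commute)
  qed
qed simp

lemma conn_Un:
  assumes X: "conn E X" and Y: "conn E Y" and "adjacent E X Y"
  shows "conn E (X \<union> Y)"
proof -
  obtain x y where xy: "x \<in> X" "y \<in> Y" "{x, y} \<in> E" using assms(3) by (rule adjacentE)
  have "conn E (X \<union> {x, y})" using xy by (intro conn_Un_meet[OF X conn_edge]) auto
  then have "conn E (X \<union> {x, y} \<union> Y)" using xy by (intro conn_Un_meet[OF _ Y]) auto
  also have "X \<union> {x, y} \<union> Y = X \<union> Y" using xy by auto
  finally show ?thesis .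
qed

lemma conn_insert: "conn E X \<Longrightarrow> x \<in> X \<Longrightarrow> {x, y} \<in> E \<Longrightarrow> conn E (insert y X)"
  using conn_Un[of E X "{y}"] by (auto simp: adjacent_def)

section \<open>Minor models\<close>

definition model :: "'a graph \<Rightarrow> nat graph \<Rightarrow> (nat \<Rightarrow> 'a set) \<Rightarrow> bool" where
  "model G F B \<longleftrightarrow>
     (\<forall>i\<in>verts F. conn (edges G) (B i) \<and> B i \<subseteq> verts G) \<and>
     disjoint_family_on B (verts F) \<and>
     (\<forall>i j. {i, j} \<in> edges F \<longrightarrow> adjacent (edges G) (B i) (B j))"

lemma contract_edgeE:
  assumes G: "simple_graph G" and e: "{x, y} \<in> edges (contract_edge u v G)"
  obtains x' y' where "{x', y'} \<in> edges G"
    "(if x' = v then u else x') = x" "(if y' = v then u else y') = y"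
proof -
  define f where "f = (\<lambda>x. if x = v then u else x)"
  obtain d where d: "d \<in> edges G" "f ` d = {x, y}" and c: "card {x, y} = 2"
    using e unfolding contract_edge_def f_def by auto
  obtain x' y' where xy: "x' \<in> d" "y' \<in> d" "f x' = x" "f y' = y"
    using d(2) by (metis imageE insertI1 insertI2)
  have "x' \<noteq> y'" using c xy by auto
  moreover have "card d = 2" "finite d"
    using G d(1) unfolding simple_graph_def by (auto intro: card_ge_0_finite)
  ultimately have "d = {x', y'}" using xy by (intro card_seteq[symmetric]) auto
  then show ?thesis using that d(1) xy unfolding f_def by auto
qed

lemma simple_graph_step:
  assumes "simple_graph G" "minor_step G H"
  shows "simple_graph H"
  using assms(2)
proof cases
  case (edge_contraction u v)
  have "u \<in> verts G" using assms(1) edge_contraction unfolding simple_graph_def by auto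
  then show ?thesis
    using assms(1) edge_contraction unfolding simple_graph_def contract_edge_def by fastforce
qed (use assms(1) in \<open>auto simp: simple_graph_def delete_vertex_def delete_edge_def\<close>)

text \<open>The vertex \<open>v\<close> rejoins the branch set that holds \<open>u\<close>. A cut of
  that set either separates \<open>u\<close> from \<open>v\<close>, and then the contracted edge
  crosses it, or keeps them together, and then dropping \<open>v\<close> leaves a cut of the old
  branch set.\<close>

lemma model_lift_contract:
  assumes G: "simple_graph G" and uv: "{u, v} \<in> edges G" "u \<noteq> v"
    and B: "model (contract_edge u v G) F B"
  shows "model G F (\<lambda>i. if u \<in> B i then insert v (B i) else B i)"
proof -
  let ?H = "contract_edge u v G"
  let ?B = "\<lambda>i. if u \<in> B i then insert v (B i) else B i"
  have vG: "v \<in> verts G" using G uv unfolding simple_graph_def by auto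
  have sub: "B i \<subseteq> verts G - {v}" if "i \<in> verts F" for i
    using B that unfolding model_def contract_edge_def by auto
  have lift: "adjacent (edges G) X' Y'"
    if "adjacent (edges ?H) X Y" "X \<subseteq> X'" "Y \<subseteq> Y'" "u \<in> X \<Longrightarrow> v \<in> X'" "u \<in> Y \<Longrightarrow> v \<in> Y'"
    for X Y X' Y'
  proof -
    obtain x y where xy: "x \<in> X" "y \<in> Y" "{x, y} \<in> edges ?H"
      using \<open>adjacent (edges ?H) X Y\<close> by (rule adjacentE)
    obtain x' y' where "{x', y'} \<in> edges G"
      "(if x' = v then u else x') = x" "(if y' = v then u else y') = y"
      using contract_edgeE[OF G xy(3)] by blast
    moreover from this xy that have "x' \<in> X'" "y' \<in> Y'" by (auto split: if_splits)
    ultimately show ?thesis by (auto intro: adjacentI)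
  qed
  have conn': "conn (edges G) (?B i)" if i: "i \<in> verts F" for i
    unfolding conn_def
  proof (intro conjI allI impI)
    show "?B i \<noteq> {}" using B i conn_ne[of "edges ?H" "B i"] unfolding model_def by auto
  next
    fix P Q assume PQ: "P \<union> Q = ?B i \<and> P \<inter> Q = {} \<and> P \<noteq> {} \<and> Q \<noteq> {}"
    have vB: "v \<notin> B i" using sub[OF i] by blast
    have c: "conn (edges ?H) (B i)" using B i unfolding model_def by blast
    show "adjacent (edges G) P Q"
    proof (cases "u \<in> B i")
      case False
      then have "P \<subseteq> B i" "Q = B i - P" using PQ by auto
      then have "adjacent (edges ?H) P Q" using conn_cut[OF c, of P] PQ by auto
      then show ?thesis by (rule lift) (use False PQ in auto)
    next
      case True
      show ?thesis
      proof (cases "u \<in> P \<longleftrightarrow> v \<in> P")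
        case True
        have PQ': "P \<union> Q = insert v (B i)" "P \<inter> Q = {}" "P \<noteq> {}" "Q \<noteq> {}"
          using PQ \<open>u \<in> B i\<close> by auto
        have "P - {v} \<subseteq> B i" "Q - {v} = B i - (P - {v})" "P - {v} \<noteq> {}" "Q - {v} \<noteq> {}"
          using True PQ' \<open>u \<in> B i\<close> uv(2) vB by blast+
        then have "adjacent (edges ?H) (P - {v}) (Q - {v})"
          using conn_cut[OF c, of "P - {v}"] by auto
        then show ?thesis by (rule lift) (use True PQ \<open>u \<in> B i\<close> in auto)
      next
        case F: False
        then have "u \<in> P \<and> v \<in> Q \<or> v \<in> P \<and> u \<in> Q" using PQ True by auto
        then show ?thesis using uv(1) by (metis adjacentI insert_commute)
      qed
    qed
  qed
  show ?thesis unfolding model_def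
  proof (intro conjI ballI allI impI)
    fix i assume i: "i \<in> verts F"
    show "conn (edges G) (?B i)" by (rule conn'[OF i])
    show "?B i \<subseteq> verts G" using sub[OF i] vG by auto
  next
    show "disjoint_family_on ?B (verts F)"
      unfolding disjoint_family_on_def
    proof (intro ballI impI)
      fix i j assume "i \<in> verts F" "j \<in> verts F" "i \<noteq> j"
      moreover from this have "B i \<inter> B j = {}" using B unfolding model_def disjoint_family_on_def by blast
      ultimately show "?B i \<inter> ?B j = {}" using sub[of i] sub[of j] by auto
    qed
  next
    fix i j assume "{i, j} \<in> edges F"
    then have "adjacent (edges ?H) (B i) (B j)" using B unfolding model_def by blast
    then show "adjacent (edges G) (?B i) (?B j)" by (rule lift) auto
  qed
qed

lemma model_lift:
  assumes "simple_graph G" "minor_step G H" "model H F B"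
  shows "\<exists>B. model G F B"
  using assms(2)
proof cases
  case (vertex_deletion v)
  have "edges H \<subseteq> edges G" "verts H \<subseteq> verts G" unfolding vertex_deletion delete_vertex_def by auto
  then show ?thesis using assms(3) unfolding model_def by (blast intro: conn_mono adjacent_mono)
next
  case (edge_deletion e)
  have "edges H \<subseteq> edges G" "verts H \<subseteq> verts G" unfolding edge_deletion delete_edge_def by auto
  then show ?thesis using assms(3) unfolding model_def by (blast intro: conn_mono adjacent_mono)
next
  case (edge_contraction u v)
  then show ?thesis using model_lift_contract[of G u v F B] assms(1,3) by blast
qed

lemma has_minor_imp_model:
  assumes "simple_graph G" "has_minor G F"
  shows "\<exists>B. model G F B"
proof -
  obtain H where H: "minor_step\<^sup>*\<^sup>* G H" "graph_iso H F" using assms(2) unfolding has_minor_def by blast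
  obtain f where f: "bij_betw f (verts H) (verts F)" "edges F = (\<lambda>e. f ` e) ` edges H"
    using H(2) unfolding graph_iso_def by blast
  have "simple_graph G' \<and> ((\<exists>B. model G' F B) \<longrightarrow> (\<exists>B. model G F B))" if "minor_step\<^sup>*\<^sup>* G G'" for G'
    using that
  proof induction
    case base
    then show ?case using assms(1) by blast
  next
    case (step y z)
    then show ?case using simple_graph_step model_lift by blast
  qed
  then have sH: "simple_graph H" and *: "(\<exists>B. model H F B) \<Longrightarrow> \<exists>B. model G F B" using H(1) by blast+
  define g where "g = inv_into (verts H) f"
  have g: "g i \<in> verts H" "f (g i) = i" if "i \<in> verts F" for i
    using f(1) that unfolding g_def bij_betw_def by (auto simp: inv_into_into f_inv_into_f)
  have gf: "g (f x) = x" if "x \<in> verts H" for x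
    using f(1) that unfolding g_def bij_betw_def by auto
  have "model H F (\<lambda>i. {g i})"
    unfolding model_def
  proof (intro conjI ballI allI impI)
    show "disjoint_family_on (\<lambda>i. {g i}) (verts F)"
      unfolding disjoint_family_on_def by (auto; metis g(2))
  next
    fix i j assume "{i, j} \<in> edges F"
    then obtain e where e: "e \<in> edges H" "{i, j} = f ` e" using f(2) by auto
    have "e \<subseteq> verts H" using sH e unfolding simple_graph_def by blast
    then have "g ` f ` e = e" using gf by (force simp: image_iff)
    then have "{g i, g j} = e" unfolding e(2)[symmetric] by simp
    then show "adjacent (edges H) {g i} {g j}" using e(1) by (auto simp: adjacent_def)
  qed (use g in auto)
  then show ?thesis using * by blast
qed

text \<open>Surplus edges go first. The surplus vertices are isolated by then, so deleting them
  removes no further edge.\<close>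

lemma minor_step_delete:
  assumes "finite V" "finite E" "V' \<subseteq> V" "E' \<subseteq> E" "\<forall>e\<in>E'. e \<subseteq> V'"
  shows "minor_step\<^sup>*\<^sup>* (V, E) (V', E')"
proof -
  have *: "minor_step\<^sup>*\<^sup>* (V, E' \<union> D) (V, E')" if "finite D" "D \<inter> E' = {}" for D
    using that
  proof (induction D)
    case (insert e D)
    have "minor_step (V, E' \<union> insert e D) (delete_edge e (V, E' \<union> insert e D))"
      by (rule edge_deletion) auto
    moreover have "delete_edge e (V, E' \<union> insert e D) = (V, E' \<union> D)"
      using insert unfolding delete_edge_def by auto
    ultimately show ?case using insert by (simp add: converse_rtranclp_into_rtranclp)
  qed auto
  have **: "minor_step\<^sup>*\<^sup>* (V' \<union> D, E') (V', E')" if "finite D" "D \<inter> V' = {}" for D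
    using that
  proof (induction D)
    case (insert x D)
    have "minor_step (V' \<union> insert x D, E') (delete_vertex x (V' \<union> insert x D, E'))"
      by (rule vertex_deletion) auto
    moreover have "delete_vertex x (V' \<union> insert x D, E') = (V' \<union> D, E')"
      using insert assms(5) unfolding delete_vertex_def by auto
    ultimately show ?case using insert by (simp add: converse_rtranclp_into_rtranclp)
  qed auto
  have "minor_step\<^sup>*\<^sup>* (V, E) (V, E')" using *[of "E - E'"] assms by (auto simp: Un_absorb1)
  also have "minor_step\<^sup>*\<^sup>* (V, E') (V', E')" using **[of "V - V'"] assms by (auto simp: Un_absorb1)
  finally show ?thesis .
qed

text \<open>Induction on the number of vertices: a branch set with two vertices contains an edge,
  and contracting it shrinks the set. Once all branch sets are singletons, deletions
  suffice.\<close>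

lemma model_imp_has_minor:
  assumes "simple_graph G" "simple_graph F" "model G F B"
  shows "has_minor G F"
  using assms(1,3)
proof (induction "card (verts G)" arbitrary: G B rule: less_induct)
  case less
  note G = less.prems(1) and B = less.prems(2)
  have dj: "disjoint_family_on B (verts F)" using B unfolding model_def by blast
  have fin: "finite (verts G)" "finite (edges G)"
    using G unfolding simple_graph_def by (auto intro: finite_subset[of "edges G" "Pow (verts G)"])
  show ?case
  proof (cases "\<exists>i\<in>verts F. \<exists>u\<in>B i. B i \<noteq> {u}")
    case True
    then obtain i u where i: "i \<in> verts F" and u: "u \<in> B i" "B i \<noteq> {u}" by blast
    have "conn (edges G) (B i)" using B i unfolding model_def by blast
    then have "adjacent (edges G) {u} (B i - {u})" using u by (intro conn_cut) auto
    then obtain v where v: "v \<in> B i" "u \<noteq> v" "{u, v} \<in> edges G" by (auto simp: adjacent_def)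
    let ?H = "contract_edge u v G" and ?B = "\<lambda>i. B i - {v}"
    have step: "minor_step G ?H" using v by (auto intro: edge_contraction)
    have push: "adjacent (edges ?H) (X - {v}) (Y - {v})"
      if "adjacent (edges G) X Y" "X \<inter> Y = {}" "v \<in> X \<Longrightarrow> u \<in> X" "v \<in> Y \<Longrightarrow> u \<in> Y" for X Y
    proof -
      obtain x y where xy: "x \<in> X" "y \<in> Y" "{x, y} \<in> edges G" using \<open>adjacent (edges G) X Y\<close> by (rule adjacentE)
      let ?f = "\<lambda>x. if x = v then u else x"
      have f: "?f x \<in> X - {v}" "?f y \<in> Y - {v}" using xy that v(2) by auto
      then have "?f x \<noteq> ?f y" using that(2) by (metis Diff_iff disjoint_iff)
      then have "card {?f x, ?f y} = 2" by (metis card_2_iff)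
      moreover have "?f ` {x, y} \<in> (\<lambda>e. ?f ` e) ` edges G" using xy(3) by (rule imageI)
      then have "{?f x, ?f y} \<in> (\<lambda>e. ?f ` e) ` edges G" by (simp only: image_insert image_empty)
      ultimately have "{?f x, ?f y} \<in> edges ?H" unfolding contract_edge_def by (simp only: snd_conv mem_Collect_eq)
      then show ?thesis using f by (rule adjacentI)
    qed
    have other: "v \<notin> B j" "u \<notin> B j" if "j \<in> verts F" "j \<noteq> i" for j
      using dj i that u v unfolding disjoint_family_on_def by blast+
    have "model ?H F ?B" unfolding model_def
    proof (intro conjI ballI allI impI)
      fix j assume j: "j \<in> verts F"
      have c: "conn (edges G) (B j)" using B j unfolding model_def by blast
      show "?B j \<subseteq> verts ?H" using B j unfolding model_def contract_edge_def by auto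
      show "conn (edges ?H) (?B j)" unfolding conn_def
      proof (intro conjI allI impI)
        show "?B j \<noteq> {}"
          using conn_ne[OF c] other[OF j] u v by (cases "j = i") auto
      next
        fix P Q assume PQ: "P \<union> Q = ?B j \<and> P \<inter> Q = {} \<and> P \<noteq> {} \<and> Q \<noteq> {}"
        \<comment> \<open>The vertex \<open>v\<close> returns to the side of \<open>u\<close>, which
          turns a cut after the contraction into a cut of the original branch set.\<close>
        define P' Q' where "P' = (if u \<in> P then insert v P else P)" and "Q' = (if u \<in> Q then insert v Q else Q)"
        have v: "v \<notin> P" "v \<notin> Q" using PQ by auto
        have vB: "v \<in> B j \<longleftrightarrow> u \<in> B j" using other[OF j] u \<open>v \<in> B i\<close> by (cases "j = i") auto
        have uPQ: "u \<in> B j \<Longrightarrow> u \<in> P \<longleftrightarrow> u \<notin> Q" "u \<notin> B j \<Longrightarrow> u \<notin> P \<and> u \<notin> Q"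
          using PQ \<open>u \<noteq> v\<close> by auto
        have PQ': "P \<union> Q = B j - {v}" "P \<inter> Q = {}" "P \<noteq> {}" "Q \<noteq> {}" using PQ by auto
        have *: "P' \<subseteq> B j" "Q' = B j - P'" "P' \<noteq> {}" "Q' \<noteq> {}" "P' - {v} = P" "Q' - {v} = Q"
          "v \<in> P' \<Longrightarrow> u \<in> P'" "v \<in> Q' \<Longrightarrow> u \<in> Q'"
          using PQ' v vB uPQ unfolding P'_def Q'_def by (cases "u \<in> B j"; cases "u \<in> P"; simp; blast)+
        have "adjacent (edges G) P' Q'" using conn_cut[OF c, of P'] * by auto
        then have "adjacent (edges ?H) (P' - {v}) (Q' - {v})" by (rule push) (use * in auto)
        then show "adjacent (edges ?H) P Q" using * by simp
      qed
    next
      show "disjoint_family_on ?B (verts F)" using dj unfolding disjoint_family_on_def by blast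
    next
      fix j k assume jk: "{j, k} \<in> edges F"
      then have V: "j \<in> verts F" "k \<in> verts F" "j \<noteq> k"
        using assms(2) unfolding simple_graph_def by fastforce+
      have "adjacent (edges G) (B j) (B k)" using B jk unfolding model_def by blast
      moreover have "B j \<inter> B k = {}" using dj V unfolding disjoint_family_on_def by blast
      moreover have "v \<in> B j \<Longrightarrow> u \<in> B j" "v \<in> B k \<Longrightarrow> u \<in> B k" using other V u by metis+
      ultimately show "adjacent (edges ?H) (?B j) (?B k)" by (rule push)
    qed
    moreover have "v \<in> verts G" using B i v unfolding model_def by blast
    then have "card (verts ?H) < card (verts G)"
      using card_Diff1_less[OF fin(1)] unfolding contract_edge_def by simp
    ultimately have "has_minor ?H F" using less.hyps simple_graph_step[OF G step] by blast
    then show ?thesis using step unfolding has_minor_def by (meson converse_rtranclp_into_rtranclp)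
  next
    case False
    define b where "b i = (THE x. x \<in> B i)" for i
    have b: "B i = {b i}" if "i \<in> verts F" for i
    proof -
      have "B i \<noteq> {}" using B that conn_ne[of "edges G" "B i"] unfolding model_def by auto
      then obtain x where "x \<in> B i" by blast
      then have "B i = {x}" using False that by blast
      then show ?thesis unfolding b_def by simp
    qed
    have inj: "inj_on b (verts F)"
    proof (rule inj_onI)
      fix i j assume "i \<in> verts F" "j \<in> verts F" "b i = b j"
      then show "i = j" using dj b[of i] b[of j] unfolding disjoint_family_on_def by (metis insert_disjoint(1) inf.idem insert_not_empty)
    qed
    define H where "H = (b ` verts F, (\<lambda>e. b ` e) ` edges F)"
    have sF: "e \<subseteq> verts F" "card e = 2" if "e \<in> edges F" for e
      using assms(2) that unfolding simple_graph_def by auto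
    have "b ` e \<in> edges G" if e: "e \<in> edges F" for e
    proof -
      obtain i j where ij: "e = {i, j}" using sF(2)[OF e] by (auto simp: card_2_iff)
      then have "adjacent (edges G) (B i) (B j)" using B e unfolding model_def by blast
      then show ?thesis using b[of i] b[of j] sF(1)[OF e] ij by (auto simp: adjacent_def)
    qed
    moreover have "b i \<in> verts G" if "i \<in> verts F" for i
      using B b[OF that] that unfolding model_def by fastforce
    ultimately have "minor_step\<^sup>*\<^sup>* (verts G, edges G) H"
      unfolding H_def using fin image_mono[OF sF(1), of _ b] by (intro minor_step_delete) auto
    moreover have "graph_iso H F"
      unfolding graph_iso_def
    proof (intro exI conjI)
      show "bij_betw (inv_into (verts F) b) (verts H) (verts F)"
        unfolding H_def using inj by (simp add: bij_betw_inv_into inj_on_imp_bij_betw)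
      have "inv_into (verts F) b ` b ` e = e" if "e \<in> edges F" for e
        using inv_into_image_cancel[OF inj sF(1)[OF that]] .
      then show "edges F = (\<lambda>e. inv_into (verts F) b ` e) ` edges H"
        unfolding H_def by (force simp: image_image)
    qed
    ultimately show ?thesis unfolding has_minor_def prod.collapse by blast
  qed
qed

lemma has_minor_iff_model:
  "simple_graph G \<Longrightarrow> simple_graph F \<Longrightarrow> has_minor G F \<longleftrightarrow> (\<exists>B. model G F B)"
  using has_minor_imp_model model_imp_has_minor by blast

section \<open>Layouts with a single queue\<close>

definition layout1 :: "'a graph \<Rightarrow> ('a set \<Rightarrow> real) \<Rightarrow> ('a \<times> 'a) set \<Rightarrow> bool" where
  "layout1 G w r \<longleftrightarrow> strict_linear_order_on (verts G) r \<and>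
     \<not> (\<exists>u v u' v'. {u, v} \<in> edges G \<and> {u', v'} \<in> edges G \<and> w {u, v} > w {u', v'} \<and>
          (u, v) \<in> r \<and> (u', v) \<in> r \<and> (v, v') \<in> r)"

lemma simple_graph_finite:
  assumes "simple_graph G"
  shows "finite (verts G)" "finite (edges G)"
  using assms unfolding simple_graph_def by (auto intro: finite_subset[of "edges G" "Pow (verts G)"])

lemma pq_layout_1_iff: "pq_layout G w 1 r P \<longleftrightarrow> layout1 G w r \<and> P 0 = edges G"
proof -
  have [simp]: "{..<Suc 0} = {0}" by auto
  have "\<And>Q. (\<exists>i<Suc 0. Q i) \<longleftrightarrow> Q 0" by blast
  then show ?thesis unfolding pq_layout_def layout1_def
    by (cases "P 0 = edges G") (simp_all add: disjoint_family_on_def)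
qed

lemma ex_pq_layout:
  assumes "simple_graph G"
  shows "\<exists>r P. pq_layout G w (card (edges G)) r P"
proof -
  note fin = simple_graph_finite[OF assms]
  obtain f :: "'a \<Rightarrow> nat" where f: "inj_on f (verts G)"
    using finite_imp_inj_to_nat_seg[OF fin(1)] by blast
  define r where "r = {(x, y). f x < f y}"
  have r: "strict_linear_order_on (verts G) r"
    using inj_onD[OF f] unfolding r_def strict_linear_order_on_def trans_def irrefl_def total_on_def
    by (auto simp: neq_iff) (metis linorder_neq_iff)
  obtain h where h: "bij_betw h {0..<card (edges G)} (edges G)"
    using ex_bij_betw_nat_finite[OF fin(2)] by blast
  have "pq_layout G w (card (edges G)) r (\<lambda>i. {h i})"
    unfolding pq_layout_def
  proof (intro conjI r)
    show "disjoint_family_on (\<lambda>i. {h i}) {..<card (edges G)}"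
      using h unfolding disjoint_family_on_def bij_betw_def inj_on_def by auto
    show "(\<Union>i<card (edges G). {h i}) = edges G"
      using h unfolding bij_betw_def by (auto simp: atLeast0LessThan)
  qed auto
  then show ?thesis by blast
qed

text \<open>An edge rules out zero queues for every weighting. The bound
  \<open>card (edges G)\<close> is uniform in \<open>w\<close>, so the outer minimum is attained as
  well as the inner one.\<close>

lemma pqn_eq_1_iff:
  assumes G: "simple_graph G" and ne: "edges G \<noteq> {}"
  shows "pqn G = 1 \<longleftrightarrow> (\<forall>w. \<exists>r. layout1 G w r)"
proof -
  have weighted: "\<exists>r P. pq_layout G w (pqn_weighted G w) r P" for w
    unfolding pqn_weighted_def by (rule LeastI_ex) (use ex_pq_layout[OF G] in blast)
  have pos: "pqn_weighted G w \<noteq> 0" for w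
    using weighted[of w] ne unfolding pq_layout_def by (metis UN_empty lessThan_0)
  have "pqn_weighted G w \<le> card (edges G)" for w
    unfolding pqn_weighted_def by (rule Least_le) (rule ex_pq_layout[OF G])
  then have "\<forall>w. pqn_weighted G w \<le> pqn G"
    unfolding pqn_def by (intro LeastI_ex[where P = "\<lambda>k. \<forall>w. pqn_weighted G w \<le> k"]) blast
  show ?thesis
  proof
    assume 1: "pqn G = 1"
    show "\<forall>w. \<exists>r. layout1 G w r"
    proof
      fix w
      have "pqn_weighted G w \<le> 1" using \<open>\<forall>w. pqn_weighted G w \<le> pqn G\<close> 1 by metis
      then have "pqn_weighted G w = 1" using pos[of w] by linarith
      then show "\<exists>r. layout1 G w r" using weighted[of w] pq_layout_1_iff by metis
    qed
  next
    assume l: "\<forall>w. \<exists>r. layout1 G w r"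
    have "pqn_weighted G w \<le> 1" for w
    proof -
      obtain r where "layout1 G w r" using l by blast
      then have "pq_layout G w 1 r (\<lambda>_. edges G)" by (simp add: pq_layout_1_iff[unfolded One_nat_def])
      then show ?thesis unfolding pqn_weighted_def by (intro Least_le) blast
    qed
    then have "pqn G \<le> 1" unfolding pqn_def by (intro Least_le) blast
    moreover have "pqn G \<noteq> 0" using \<open>\<forall>w. pqn_weighted G w \<le> pqn G\<close> pos by (metis le_zero_eq)
    ultimately show "pqn G = 1" by linarith
  qed
qed

section \<open>Graphs without a layout\<close>

text \<open>Counting predecessors turns the order into real positions, which makes the later
  contradictions linear arithmetic. Only predecessors in \<open>verts G\<close> count, since
  \<open>r\<close> may relate other elements too.\<close>

lemma layout1_position:
  assumes "simple_graph G" "layout1 G w r"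
  obtains p :: "'a \<Rightarrow> real" where "inj_on p (verts G)"
    "\<And>u v u' v'. {u, v} \<in> edges G \<Longrightarrow> {u', v'} \<in> edges G \<Longrightarrow> p u < p v \<Longrightarrow> p u' < p v \<Longrightarrow> p v < p v' \<Longrightarrow>
       w {u, v} \<le> w {u', v'}"
proof -
  let ?V = "verts G"
  have fin: "finite ?V" using simple_graph_finite[OF assms(1)] by blast
  have r: "trans r" "irrefl r" "total_on ?V r"
    using assms(2) unfolding layout1_def strict_linear_order_on_def by auto
  define p where "p x = real (card {y\<in>?V. (y, x) \<in> r})" for x
  have less: "p x < p y" if "x \<in> ?V" "(x, y) \<in> r" for x y
  proof -
    have "{z\<in>?V. (z, x) \<in> r} \<subset> {z\<in>?V. (z, y) \<in> r}"
      using that r(1,2) by (auto elim: transE simp: irrefl_def)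
    then show ?thesis unfolding p_def using fin by (simp add: psubset_card_mono)
  qed
  have iff: "p x < p y \<longleftrightarrow> (x, y) \<in> r" if "x \<in> ?V" "y \<in> ?V" for x y
    using less[of x y] less[of y x] that r(3) unfolding total_on_def by (metis less_irrefl less_asym)
  show ?thesis
  proof
    show "inj_on p ?V"
      using r(3) iff unfolding inj_on_def total_on_def by (metis less_irrefl)
  next
    fix u v u' v' assume e: "{u, v} \<in> edges G" "{u', v'} \<in> edges G"
      and "p u < p v" "p u' < p v" "p v < p v'"
    moreover have "u \<in> ?V" "v \<in> ?V" "u' \<in> ?V" "v' \<in> ?V"
      using assms(1) e unfolding simple_graph_def by auto
    ultimately show "w {u, v} \<le> w {u', v'}"
      using assms(2) iff unfolding layout1_def by (meson not_le)
  qed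
qed

text \<open>When an edge \<open>{i, j}\<close> is closed at the position \<open>t\<close> of a vertex of the branch set of \<open>j\<close>, no
  lighter edge spans \<open>t\<close>. Here \<open>lo\<close> and \<open>hi\<close> are the first and last positions of branch sets, and
  branch sets are held together by edges lighter than all others.\<close>

definition closes ::
  "nat set \<Rightarrow> (nat \<times> nat \<times> real) list \<Rightarrow> (nat \<Rightarrow> real) \<Rightarrow> (nat \<Rightarrow> real) \<Rightarrow> real \<Rightarrow> nat \<Rightarrow> nat \<Rightarrow> real \<Rightarrow> bool" where
  "closes V ps lo hi c i j t \<longleftrightarrow> lo j \<le> t \<and> t \<le> hi j \<and> hi i < t \<and>
     (\<forall>l\<in>V. l \<noteq> j \<longrightarrow> hi l < t \<or> t < lo l) \<and>
     (\<forall>(k, l, d)\<in>set ps. d < c \<longrightarrow> k \<noteq> j \<longrightarrow> l \<noteq> j \<longrightarrow> (hi k < t \<longleftrightarrow> hi l < t))"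

text \<open>A layout of \<open>G\<close> under weights copied from \<open>ps\<close> is boiled down
  to finitely many inequalities between \<open>lo\<close>, \<open>hi\<close> and one closing
  position per listed edge, ready for an automatic refutation. Listed weights are nonnegative so
  that \<open>-1\<close> is free for the edges inside branch sets. The clause on singletons serves
  \<open>F7\<close>.\<close>

lemma layout_tokens:
  assumes G: "simple_graph G" and m: "model G F B"
    and F: "finite (verts F)" "edges F = (\<lambda>(i, j, c). {i, j}) ` set ps"
    and ps: "\<forall>(i, j, c)\<in>set ps. i \<in> verts F \<and> j \<in> verts F \<and> i \<noteq> j \<and> c \<ge> 0"
    and uniq: "\<forall>(i, j, c)\<in>set ps. \<forall>(k, l, d)\<in>set ps. {i, j} = {k, l} \<longrightarrow> c = d"
    and lay: "\<forall>w. \<exists>r. layout1 G w r"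
  obtains lo hi where "\<forall>i\<in>verts F. lo i \<le> hi i \<and> (card (B i) = 1 \<longrightarrow> lo i = hi i)"
    "\<forall>(i, j, c)\<in>set ps. \<exists>t. closes (verts F) ps lo hi c i j t \<or> closes (verts F) ps lo hi c j i t"
proof -
  let ?E = "edges G" and ?V = "verts F"
  have conn: "conn ?E (B i)" and BV: "B i \<subseteq> verts G" if "i \<in> ?V" for i
    using m that unfolding model_def by auto
  have dj: "B i \<inter> B j = {}" if "i \<in> ?V" "j \<in> ?V" "i \<noteq> j" for i j
    using m that unfolding model_def disjoint_family_on_def by blast
  define cls where "cls x = (THE i. i \<in> ?V \<and> x \<in> B i)" for x
  have cls: "cls x = i" if "i \<in> ?V" "x \<in> B i" for x i
    unfolding cls_def by (rule the_equality) (use that dj in blast)+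
  define wF where "wF e = (THE c. \<exists>i j. (i, j, c) \<in> set ps \<and> e = {i, j})" for e
  have wF: "wF {i, j} = c" if "(i, j, c) \<in> set ps" for i j c
    unfolding wF_def by (rule the_equality) (use that uniq in fastforce)+
  \<comment> \<open>Only edges inside a branch set and edges realizing an edge of \<open>F\<close>
    need a definite weight. Any other edge may get an arbitrary one, as it can only restrict the
    layout further.\<close>
  define w where "w e = (if card (cls ` e) = 1 then -1 else wF (cls ` e))" for e
  have w_in: "w {x, y} = -1" if "i \<in> ?V" "x \<in> B i" "y \<in> B i" for i x y
    unfolding w_def using that by (simp add: cls)
  have w_out: "w {x, y} = c" if "(i, j, c) \<in> set ps" "x \<in> B i" "y \<in> B j" for i j c x y
  proof -
    have "cls x = i" "cls y = j" "i \<noteq> j" using that ps cls by fastforce+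
    then show ?thesis unfolding w_def using wF[OF that(1)] by simp
  qed
  obtain r where "layout1 G w r" using lay by blast
  then obtain p :: "'a \<Rightarrow> real" where inj: "inj_on p (verts G)" and
    p: "\<And>u v u' v'. {u, v} \<in> ?E \<Longrightarrow> {u', v'} \<in> ?E \<Longrightarrow> p u < p v \<Longrightarrow> p u' < p v \<Longrightarrow> p v < p v' \<Longrightarrow>
       w {u, v} \<le> w {u', v'}"
    using layout1_position[OF G] by metis
  define lo hi where "lo i = Min (p ` B i)" and "hi i = Max (p ` B i)" for i
  have fin: "finite (p ` B i)" "p ` B i \<noteq> {}" if "i \<in> ?V" for i
    using BV[OF that] conn_ne[OF conn[OF that]] simple_graph_finite[OF G] by (auto intro: finite_subset)
  have lohi: "lo i \<le> p x" "p x \<le> hi i" if "i \<in> ?V" "x \<in> B i" for i x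
    using fin[OF that(1)] that(2) unfolding lo_def hi_def by auto
  have hi_less: "hi i < t \<longleftrightarrow> (\<forall>x\<in>B i. p x < t)" and lo_gr: "t < lo i \<longleftrightarrow> (\<forall>x\<in>B i. t < p x)"
    if "i \<in> ?V" for i t
    using fin[OF that] unfolding lo_def hi_def by auto
  have side: "(\<forall>x\<in>S. p x < p v) \<or> (\<forall>x\<in>S. p v < p x)"
    if e: "{u, v} \<in> ?E" "p u < p v" and S: "conn {f\<in>?E. w f < w {u, v}} S" "v \<notin> S" "S \<subseteq> verts G" for u v S
  proof (rule ccontr)
    assume n: "\<not> ?thesis"
    have vV: "v \<in> verts G" using G e unfolding simple_graph_def by auto
    have ne: "p x \<noteq> p v" if "x \<in> S" for x
      using inj that S(2,3) vV unfolding inj_on_def by blast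
    let ?A = "{x\<in>S. p x < p v}"
    have "?A \<noteq> {}" "S - ?A \<noteq> {}" using n ne by fastforce+
    then have "adjacent {f\<in>?E. w f < w {u, v}} ?A (S - ?A)" using S(1) by (intro conn_cut) auto
    then obtain x y where xy: "x \<in> S" "p x < p v" "y \<in> S" "\<not> p y < p v" "{x, y} \<in> ?E" "w {x, y} < w {u, v}"
      by (auto elim!: adjacentE)
    then have "p v < p y" using ne[of y] by linarith
    then show False using p[OF e(1) xy(5) e(2) xy(2)] xy(6) by linarith
  qed
  have light: "conn {f\<in>?E. w f < c} (B i)" if i: "i \<in> ?V" and c: "c \<ge> 0" for i c
  proof (rule connI)
    show "B i \<noteq> {}" using conn_ne[OF conn[OF i]] .
    fix A assume A: "A \<subseteq> B i" "A \<noteq> {}" "B i - A \<noteq> {}"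
    obtain x y where xy: "x \<in> A" "y \<in> B i - A" "{x, y} \<in> ?E"
      using conn_cut[OF conn[OF i] A] by (rule adjacentE)
    then have "w {x, y} = -1" using A w_in[OF i, of x y] by auto
    then show "adjacent {f\<in>?E. w f < c} A (B i - A)" using xy c by (intro adjacentI[of x y]) auto
  qed
  have closes: "closes ?V ps lo hi c i j (p v)"
    if ij: "(i, j, c) \<in> set ps \<or> (j, i, c) \<in> set ps" and uv: "u \<in> B i" "v \<in> B j" "{u, v} \<in> ?E" "p u < p v" for i j c u v
  proof -
    have V: "i \<in> ?V" "j \<in> ?V" "i \<noteq> j" "c \<ge> 0" using ij ps by fastforce+
    have wuv: "w {u, v} = c" using ij w_out[of i j c u v] w_out[of j i c v u] uv by (auto simp: insert_commute)
    have one: "hi l < p v \<or> p v < lo l" if l: "l \<in> ?V" "l \<noteq> j" for l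
    proof -
      have "v \<notin> B l" using dj[OF l(1) V(2) l(2)] uv by blast
      then show ?thesis
        using side[OF uv(3,4), of "B l"] light[OF l(1) V(4)] BV[OF l(1)] unfolding wuv hi_less[OF l(1)] lo_gr[OF l(1)] by auto
    qed
    have two: "hi k < p v \<longleftrightarrow> hi l < p v"
      if kl: "(k, l, d) \<in> set ps" "d < c" "k \<noteq> j" "l \<noteq> j" for k l d
    proof -
      have K: "k \<in> ?V" "l \<in> ?V" "k \<noteq> l" using kl ps by fastforce+
      have "{k, l} \<in> edges F" unfolding F(2) using kl(1) by force
      then have "adjacent ?E (B k) (B l)" using m unfolding model_def by blast
      then obtain x y where xy: "x \<in> B k" "y \<in> B l" "{x, y} \<in> ?E" by (rule adjacentE)
      have "adjacent {f\<in>?E. w f < c} (B k) (B l)"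
        using xy w_out[OF kl(1) xy(1,2)] kl(2) by (intro adjacentI[of x y]) auto
      then have "conn {f\<in>?E. w f < c} (B k \<union> B l)" by (intro conn_Un light K V)
      moreover have "v \<notin> B k \<union> B l" using dj[OF K(1) V(2) kl(3)] dj[OF K(2) V(2) kl(4)] uv by blast
      ultimately have "(\<forall>z\<in>B k \<union> B l. p z < p v) \<or> (\<forall>z\<in>B k \<union> B l. p v < p z)"
        using BV[OF K(1)] BV[OF K(2)] wuv by (intro side[OF uv(3,4)]) auto
      then show ?thesis unfolding hi_less[OF K(1)] hi_less[OF K(2)] using xy(1,2) by (meson UnI1 UnI2 less_asym)
    qed
    have "hi i < p v"
      using one[OF V(1) V(3)] lohi(1)[OF V(1) uv(1)] uv(4) by linarith
    then show ?thesis unfolding closes_def using one two lohi[OF V(2) uv(2)] by auto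
  qed
  show ?thesis
  proof
    show "\<forall>i\<in>?V. lo i \<le> hi i \<and> (card (B i) = 1 \<longrightarrow> lo i = hi i)"
    proof
      fix i assume i: "i \<in> ?V"
      obtain x where "x \<in> B i" using conn_ne[OF conn[OF i]] by blast
      then have "lo i \<le> hi i" using lohi[OF i, of x] by linarith
      moreover have "card (B i) = 1 \<longrightarrow> lo i = hi i" unfolding lo_def hi_def by (auto simp: card_1_singleton_iff)
      ultimately show "lo i \<le> hi i \<and> (card (B i) = 1 \<longrightarrow> lo i = hi i)" ..
    qed
    show "\<forall>(i, j, c)\<in>set ps. \<exists>t. closes ?V ps lo hi c i j t \<or> closes ?V ps lo hi c j i t"
    proof (clarify)
      fix i j c assume ij: "(i, j, c) \<in> set ps"
      then have V: "i \<in> ?V" "j \<in> ?V" "i \<noteq> j" using ps by fastforce+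
      have "{i, j} \<in> edges F" unfolding F(2) using ij by force
      then have "adjacent ?E (B i) (B j)" using m unfolding model_def by blast
      then obtain u v where uv: "u \<in> B i" "v \<in> B j" "{u, v} \<in> ?E" by (rule adjacentE)
      have "u \<noteq> v" using uv dj V by blast
      then have "p u \<noteq> p v" using inj BV V uv unfolding inj_on_def by blast
      then consider "p u < p v" | "p v < p u" by linarith
      then show "\<exists>t. closes ?V ps lo hi c i j t \<or> closes ?V ps lo hi c j i t"
      proof cases
        case 1
        then show ?thesis using closes[of i j c u v] ij uv by blast
      next
        case 2
        moreover have "{v, u} \<in> ?E" using uv by (simp add: insert_commute)
        ultimately show ?thesis using closes[of j i c v u] ij uv by blast
      qed
    qed
  qed
qed

section \<open>Weightings that defeat the eight forbidden graphs\<close>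

lemma no_layout_F1:
  assumes "simple_graph G" "model G F1 B"
  shows "\<not> (\<forall>w. \<exists>r. layout1 G w r)"
proof
  assume lay: "\<forall>w. \<exists>r. layout1 G w r"
  \<comment> \<open>The disjoint edges \<open>{0, 1}\<close> and \<open>{2, 3}\<close> outweigh the
    rest. Whichever end closes one of them, all other vertices remain connected by lighter edges and
    so lie before it. The branch set reaching furthest would belong to both edges. \<open>F2\<close>
    and \<open>F3\<close> follow the same pattern.\<close>
  define ps :: "(nat \<times> nat \<times> real) list" where
    "ps = [(0, 1, 1), (0, 2, 0), (0, 3, 0), (1, 2, 0), (1, 3, 0), (2, 3, 2)]"
  obtain lo hi where t: "\<forall>i\<in>verts F1. lo i \<le> hi i \<and> (card (B i) = 1 \<longrightarrow> lo i = hi i)"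
    "\<forall>(i, j, c)\<in>set ps. \<exists>t. closes (verts F1) ps lo hi c i j t \<or> closes (verts F1) ps lo hi c j i t"
    by (rule layout_tokens[OF assms(1,2) _ _ _ _ lay, of ps]) (auto simp: F1_def ps_def doubleton_eq_iff)
  from t show False unfolding F1_def ps_def closes_def by simp smt
qed

lemma no_layout_F2:
  assumes "simple_graph G" "model G F2 B"
  shows "\<not> (\<forall>w. \<exists>r. layout1 G w r)"
proof
  assume lay: "\<forall>w. \<exists>r. layout1 G w r"
  define ps :: "(nat \<times> nat \<times> real) list" where
    "ps = [(0, 1, 2), (1, 2, 0), (2, 0, 0), (2, 3, 0), (3, 4, 1), (4, 2, 0)]"
  obtain lo hi where t: "\<forall>i\<in>verts F2. lo i \<le> hi i \<and> (card (B i) = 1 \<longrightarrow> lo i = hi i)"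
    "\<forall>(i, j, c)\<in>set ps. \<exists>t. closes (verts F2) ps lo hi c i j t \<or> closes (verts F2) ps lo hi c j i t"
    by (rule layout_tokens[OF assms(1,2) _ _ _ _ lay, of ps]) (auto simp: F2_def ps_def doubleton_eq_iff)
  from t show False unfolding F2_def ps_def closes_def by simp smt
qed

lemma no_layout_F3:
  assumes "simple_graph G" "model G F3 B"
  shows "\<not> (\<forall>w. \<exists>r. layout1 G w r)"
proof
  assume lay: "\<forall>w. \<exists>r. layout1 G w r"
  define ps :: "(nat \<times> nat \<times> real) list" where
    "ps = [(0, 1, 2), (1, 2, 0), (2, 3, 1), (3, 4, 0), (4, 0, 0), (1, 4, 0)]"
  obtain lo hi where t: "\<forall>i\<in>verts F3. lo i \<le> hi i \<and> (card (B i) = 1 \<longrightarrow> lo i = hi i)"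
    "\<forall>(i, j, c)\<in>set ps. \<exists>t. closes (verts F3) ps lo hi c i j t \<or> closes (verts F3) ps lo hi c j i t"
    by (rule layout_tokens[OF assms(1,2) _ _ _ _ lay, of ps]) (auto simp: F3_def ps_def doubleton_eq_iff)
  from t show False unfolding F3_def ps_def closes_def by simp smt
qed

lemma no_layout_F4:
  assumes "simple_graph G" "model G F4 B"
  shows "\<not> (\<forall>w. \<exists>r. layout1 G w r)"
proof
  assume lay: "\<forall>w. \<exists>r. layout1 G w r"
  \<comment> \<open>The heaviest edge \<open>{1, 2}\<close> closes after everything else. So
    \<open>{3, 4}\<close> and \<open>{5, 6}\<close> cannot close at the tips \<open>4\<close> and
    \<open>6\<close>, but only at \<open>3\<close> and \<open>5\<close>; there the vertices tied
    together by weight 0, among them the other inner tail vertex, must come later. Thus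
    \<open>3\<close> and \<open>5\<close> would each have to precede the other.\<close>
  define ps :: "(nat \<times> nat \<times> real) list" where
    "ps = [(0, 1, 0), (1, 2, 2), (2, 0, 0), (0, 3, 0), (3, 4, 1), (0, 5, 0), (5, 6, 1)]"
  obtain lo hi where t: "\<forall>i\<in>verts F4. lo i \<le> hi i \<and> (card (B i) = 1 \<longrightarrow> lo i = hi i)"
    "\<forall>(i, j, c)\<in>set ps. \<exists>t. closes (verts F4) ps lo hi c i j t \<or> closes (verts F4) ps lo hi c j i t"
    by (rule layout_tokens[OF assms(1,2) _ _ _ _ lay, of ps]) (auto simp: F4_def ps_def doubleton_eq_iff)
  from t show False unfolding F4_def ps_def closes_def by simp smt
qed

lemma no_layout_F5:
  assumes "simple_graph G" "model G F5 B"
  shows "\<not> (\<forall>w. \<exists>r. layout1 G w r)"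
proof
  assume lay: "\<forall>w. \<exists>r. layout1 G w r"
  \<comment> \<open>By symmetry let \<open>{1, 2}\<close> close at \<open>2\<close>, after
    \<open>0\<close>, \<open>1\<close>, \<open>3\<close>, \<open>4\<close> and \<open>5\<close>. As
    for \<open>F4\<close>, the edge \<open>{3, 4}\<close> closes at \<open>3\<close>, and
    \<open>0\<close>, \<open>1\<close>, \<open>2\<close> come later. Then \<open>{1, 5}\<close>
    fails: closing at \<open>5\<close> would put \<open>2\<close> before \<open>5\<close>, and
    closing at \<open>1\<close> would have \<open>4\<close>, hence through lighter edges also
    \<open>2\<close>, before \<open>1\<close>.\<close>
  define ps :: "(nat \<times> nat \<times> real) list" where
    "ps = [(0, 1, 0), (1, 2, 3), (2, 0, 0), (0, 3, 0), (3, 4, 1), (1, 5, 2), (2, 6, 2)]"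
  obtain lo hi where t: "\<forall>i\<in>verts F5. lo i \<le> hi i \<and> (card (B i) = 1 \<longrightarrow> lo i = hi i)"
    "\<forall>(i, j, c)\<in>set ps. \<exists>t. closes (verts F5) ps lo hi c i j t \<or> closes (verts F5) ps lo hi c j i t"
    by (rule layout_tokens[OF assms(1,2) _ _ _ _ lay, of ps]) (auto simp: F5_def ps_def doubleton_eq_iff)
  from t show False unfolding F5_def ps_def closes_def by simp smt
qed

lemma no_layout_F6:
  assumes "simple_graph G" "model G F6 B"
  shows "\<not> (\<forall>w. \<exists>r. layout1 G w r)"
proof
  assume lay: "\<forall>w. \<exists>r. layout1 G w r"
  \<comment> \<open>The edge \<open>{0, 2}\<close> makes \<open>0\<close> or \<open>2\<close> reach
    furthest; \<open>{3, 4}\<close> then closes at \<open>3\<close> before \<open>0\<close>,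
    \<open>1\<close>, \<open>2\<close> start; \<open>{1, 2}\<close> closes at \<open>2\<close>,
    after \<open>0\<close>. Finally \<open>{3, 0}\<close> fails: closing at \<open>0\<close> would
    put \<open>2\<close> before \<open>0\<close>, and closing at \<open>3\<close> would stretch
    branch set \<open>3\<close> across the closing of \<open>{0, 1}\<close>.\<close>
  define ps :: "(nat \<times> nat \<times> real) list" where
    "ps = [(0, 1, 0), (1, 2, 2), (2, 3, 0), (3, 0, 1), (0, 2, 4), (3, 4, 3)]"
  obtain lo hi where t: "\<forall>i\<in>verts F6. lo i \<le> hi i \<and> (card (B i) = 1 \<longrightarrow> lo i = hi i)"
    "\<forall>(i, j, c)\<in>set ps. \<exists>t. closes (verts F6) ps lo hi c i j t \<or> closes (verts F6) ps lo hi c j i t"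
    by (rule layout_tokens[OF assms(1,2) _ _ _ _ lay, of ps]) (auto simp: F6_def ps_def doubleton_eq_iff)
  from t show False unfolding F6_def ps_def closes_def by simp smt
qed

lemma no_layout_F7:
  assumes "simple_graph G" "model G F7 B" and "card (B 0) = 1"
  shows "\<not> (\<forall>w. \<exists>r. layout1 G w r)"
proof
  assume lay: "\<forall>w. \<exists>r. layout1 G w r"
  \<comment> \<open>If \<open>0\<close> comes after \<open>1\<close>, \<open>2\<close> and
    \<open>3\<close>, then \<open>{2, 3}\<close> cannot close, because lighter edges tie
    \<open>0\<close> to its earlier end; closing \<open>{0, 4}\<close> at \<open>4\<close> leads to
    this case through \<open>{0, 2}\<close>. Otherwise \<open>0\<close> precedes them,
    \<open>{0, 2}\<close> puts \<open>2\<close> after \<open>1\<close> and \<open>3\<close>, and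
    \<open>{3, 0}\<close> could only close at \<open>3\<close> after \<open>2\<close>. Comparing
    different closings at \<open>0\<close> relies on its single position.\<close>
  define ps :: "(nat \<times> nat \<times> real) list" where
    "ps = [(0, 1, 0), (1, 2, 0), (2, 3, 2), (3, 0, 1), (0, 2, 4), (0, 4, 3)]"
  obtain lo hi where t: "\<forall>i\<in>verts F7. lo i \<le> hi i \<and> (card (B i) = 1 \<longrightarrow> lo i = hi i)"
    "\<forall>(i, j, c)\<in>set ps. \<exists>t. closes (verts F7) ps lo hi c i j t \<or> closes (verts F7) ps lo hi c j i t"
    by (rule layout_tokens[OF assms(1,2) _ _ _ _ lay, of ps]) (auto simp: F7_def ps_def doubleton_eq_iff)
  from t assms(3) show False unfolding F7_def ps_def closes_def by simp smt
qed

lemma no_layout_F8: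
  assumes "simple_graph G" "model G F8 B"
  shows "\<not> (\<forall>w. \<exists>r. layout1 G w r)"
proof
  assume lay: "\<forall>w. \<exists>r. layout1 G w r"
  \<comment> \<open>The edges \<open>{0, 1}\<close> and \<open>{5, 6}\<close> force the tail
    \<open>6\<close>, \<open>5\<close> to the start; with \<open>{0, 4}\<close>, vertex
    \<open>0\<close> reaches beyond \<open>1\<close>, \<open>2\<close>, \<open>3\<close>. Now
    \<open>{2, 3}\<close> closes at \<open>3\<close>, after \<open>1\<close> and \<open>2\<close>,
    while a closing of \<open>{1, 2}\<close> would need \<open>3\<close> before it, since the
    lightest edge ties \<open>3\<close> to the early \<open>5\<close>.\<close>
  define ps :: "(nat \<times> nat \<times> real) list" where
    "ps = [(0, 1, 6), (1, 2, 1), (2, 3, 3), (3, 0, 2), (0, 4, 4), (3, 5, 0), (5, 6, 5)]"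
  obtain lo hi where t: "\<forall>i\<in>verts F8. lo i \<le> hi i \<and> (card (B i) = 1 \<longrightarrow> lo i = hi i)"
    "\<forall>(i, j, c)\<in>set ps. \<exists>t. closes (verts F8) ps lo hi c i j t \<or> closes (verts F8) ps lo hi c j i t"
    by (rule layout_tokens[OF assms(1,2) _ _ _ _ lay, of ps]) (auto simp: F8_def ps_def doubleton_eq_iff)
  from t show False unfolding F8_def ps_def closes_def by simp smt
qed

section \<open>Branch sets\<close>

text \<open>A minor model written as a list, in the vertex order of the forbidden graph; along
  \<open>Cons\<close> it unfolds into explicit disjointness facts for the simplifier.\<close>

definition branches :: "'a graph \<Rightarrow> 'a set list \<Rightarrow> bool" where
  "branches G Bs \<longleftrightarrow>
     (\<forall>B\<in>set Bs. conn (edges G) B \<and> B \<subseteq> verts G) \<and> sorted_wrt (\<lambda>A B. A \<inter> B = {}) Bs"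

abbreviation adj :: "'a graph \<Rightarrow> 'a set \<Rightarrow> 'a set \<Rightarrow> bool" where
  "adj G \<equiv> adjacent (edges G)"

lemmas adj_simps = adjacent_Un1 adjacent_Un2 adjacent_sym
lemmas dj_simps = Int_Un_distrib Int_Un_distrib2 Int_commute

lemma model_nth:
  assumes "branches G Bs" "verts F = {..<length Bs}" "edges F = (\<lambda>(i, j). {i, j}) ` set ps"
    "\<forall>(i, j)\<in>set ps. adj G (Bs ! i) (Bs ! j)"
  shows "model G F (\<lambda>i. Bs ! i)"
  unfolding model_def assms(2)
proof (intro conjI ballI allI impI)
  fix i assume "i \<in> {..<length Bs}"
  then show "conn (edges G) (Bs ! i)" "Bs ! i \<subseteq> verts G"
    using assms(1) unfolding branches_def by auto
next
  have "Bs ! i \<inter> Bs ! j = {}" if "i < j" "j < length Bs" for i j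
    using assms(1) that unfolding branches_def sorted_wrt_iff_nth_less by blast
  then show "disjoint_family_on (\<lambda>i. Bs ! i) {..<length Bs}"
    unfolding disjoint_family_on_def by (metis inf_commute lessThan_iff linorder_neqE_nat)
next
  fix i j assume "{i, j} \<in> edges F"
  then obtain k l where kl: "(k, l) \<in> set ps" "{i, j} = {k, l}" unfolding assms(3) by auto
  then have "adj G (Bs ! k) (Bs ! l)" using assms(4) by blast
  then show "adj G (Bs ! i) (Bs ! j)" using kl(2) by (metis adjacent_sym doubleton_eq_iff)
qed

lemma branches_of_model:
  assumes "model G F B" "verts F = {..<n}"
  shows "branches G (map B [0..<n])"
  using assms unfolding branches_def model_def
  by (auto simp: sorted_wrt_iff_nth_less disjoint_family_on_def)

lemma model_F1I:
  assumes "branches G [a, b, c, d]" "adj G a b" "adj G a c" "adj G a d" "adj G b c" "adj G b d" "adj G c d"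
  shows "\<exists>B. model G F1 B"
  by (rule exI, rule model_nth[OF assms(1), where ps = "[(0, 1), (0, 2), (0, 3), (1, 2), (1, 3), (2, 3)]"])
    (use assms in \<open>auto simp: F1_def numeral_eq_Suc\<close>)

lemma model_F2I:
  assumes "branches G [a, b, c, d, e]"
    "adj G a b" "adj G b c" "adj G c a" "adj G c d" "adj G d e" "adj G e c"
  shows "\<exists>B. model G F2 B"
  by (rule exI, rule model_nth[OF assms(1), where ps = "[(0, 1), (1, 2), (2, 0), (2, 3), (3, 4), (4, 2)]"])
    (use assms in \<open>auto simp: F2_def numeral_eq_Suc\<close>)

lemma model_F3I:
  assumes "branches G [a, b, c, d, e]"
    "adj G a b" "adj G b c" "adj G c d" "adj G d e" "adj G e a" "adj G b e"
  shows "\<exists>B. model G F3 B"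
  by (rule exI, rule model_nth[OF assms(1), where ps = "[(0, 1), (1, 2), (2, 3), (3, 4), (4, 0), (1, 4)]"])
    (use assms in \<open>auto simp: F3_def numeral_eq_Suc\<close>)

lemma model_F4I:
  assumes "branches G [a, b, c, d, e, f, g]"
    "adj G a b" "adj G b c" "adj G c a" "adj G a d" "adj G d e" "adj G a f" "adj G f g"
  shows "\<exists>B. model G F4 B"
  by (rule exI, rule model_nth[OF assms(1), where ps = "[(0, 1), (1, 2), (2, 0), (0, 3), (3, 4), (0, 5), (5, 6)]"])
    (use assms in \<open>auto simp: F4_def numeral_eq_Suc\<close>)

lemma model_F5I:
  assumes "branches G [a, b, c, d, e, f, g]"
    "adj G a b" "adj G b c" "adj G c a" "adj G a d" "adj G d e" "adj G b f" "adj G c g"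
  shows "\<exists>B. model G F5 B"
  by (rule exI, rule model_nth[OF assms(1), where ps = "[(0, 1), (1, 2), (2, 0), (0, 3), (3, 4), (1, 5), (2, 6)]"])
    (use assms in \<open>auto simp: F5_def numeral_eq_Suc\<close>)

lemma model_F6I:
  assumes "branches G [a, b, c, d, e]"
    "adj G a b" "adj G b c" "adj G c d" "adj G d a" "adj G a c" "adj G d e"
  shows "\<exists>B. model G F6 B"
  by (rule exI, rule model_nth[OF assms(1), where ps = "[(0, 1), (1, 2), (2, 3), (3, 0), (0, 2), (3, 4)]"])
    (use assms in \<open>auto simp: F6_def numeral_eq_Suc\<close>)

lemma model_F7I:
  assumes "branches G [a, b, c, d, e]"
    "adj G a b" "adj G b c" "adj G c d" "adj G d a" "adj G a c" "adj G a e"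
  shows "model G F7 (\<lambda>i. [a, b, c, d, e] ! i)"
  by (rule model_nth[OF assms(1), where ps = "[(0, 1), (1, 2), (2, 3), (3, 0), (0, 2), (0, 4)]"])
    (use assms in \<open>auto simp: F7_def numeral_eq_Suc\<close>)

lemma model_F8I:
  assumes "branches G [a, b, c, d, e, f, g]"
    "adj G a b" "adj G b c" "adj G c d" "adj G d a" "adj G a e" "adj G d f" "adj G f g"
  shows "\<exists>B. model G F8 B"
  by (rule exI, rule model_nth[OF assms(1), where ps = "[(0, 1), (1, 2), (2, 3), (3, 0), (0, 4), (3, 5), (5, 6)]"])
    (use assms in \<open>auto simp: F8_def numeral_eq_Suc\<close>)

lemma branches_Cons:
  "branches G (B # Bs) \<longleftrightarrow> conn (edges G) B \<and> B \<subseteq> verts G \<and> B \<inter> \<Union>(set Bs) = {} \<and> branches G Bs"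
  unfolding branches_def by auto

lemma branches_Nil [simp]: "branches G []"
  unfolding branches_def by simp

text \<open>As long as \<open>K\<close> is not covered, an edge leaves the union of the sets, and
  its outer end joins the set at its inner end. This makes the branch sets of a model inside a
  component fill the component.\<close>

lemma conn_extend:
  assumes K: "conn E K" "finite K" and I: "I \<noteq> {}"
    and B: "\<And>i. i \<in> I \<Longrightarrow> conn E (B i) \<and> B i \<subseteq> K" "disjoint_family_on B I"
  shows "\<exists>B'. (\<forall>i\<in>I. B i \<subseteq> B' i \<and> conn E (B' i)) \<and> disjoint_family_on B' I \<and> (\<Union>i\<in>I. B' i) = K"
  using B
proof (induction "card (K - (\<Union>i\<in>I. B i))" arbitrary: B rule: less_induct)
  case less
  let ?U = "\<Union>i\<in>I. B i"
  have sub: "?U \<subseteq> K" using less.prems(1) by blast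
  obtain i0 where i0: "i0 \<in> I" using I by blast
  then have ne: "?U \<noteq> {}" using conn_ne[of E "B i0"] less.prems(1)[OF i0] by blast
  show ?case
  proof (cases "K - ?U = {}")
    case True
    then have "?U = K" using sub by blast
    then show ?thesis using less.prems by (intro exI[of _ B]) auto
  next
    case False
    have "adjacent E ?U (K - ?U)" using conn_cut[OF K(1) sub ne False] .
    then obtain x y where xy: "x \<in> ?U" "y \<in> K - ?U" "{x, y} \<in> E" by (rule adjacentE)
    then obtain i where i: "i \<in> I" "x \<in> B i" by blast
    define B' where "B' = B(i := insert y (B i))"
    have U': "(\<Union>i\<in>I. B' i) = insert y ?U" unfolding B'_def using i by (auto split: if_splits)
    have "conn E (insert y (B i))" using less.prems(1)[OF i(1)] i(2) xy(3) by (intro conn_insert) auto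
    then have 1: "conn E (B' j) \<and> B' j \<subseteq> K" if "j \<in> I" for j
      using less.prems(1)[OF that] xy(2) unfolding B'_def by auto
    have 2: "disjoint_family_on B' I"
      using less.prems(2) xy(2) unfolding B'_def disjoint_family_on_def by auto
    have "card (K - (\<Union>i\<in>I. B' i)) < card (K - ?U)"
      unfolding U' using xy(2) K(2) by (intro psubset_card_mono) auto
    from less.hyps[OF this 1 2] obtain B'' where
      B'': "\<forall>j\<in>I. B' j \<subseteq> B'' j \<and> conn E (B'' j)" "disjoint_family_on B'' I" "(\<Union>j\<in>I. B'' j) = K" by blast
    have "B j \<subseteq> B' j" for j unfolding B'_def by auto
    then show ?thesis using B'' by (intro exI[of _ B'']) blast
  qed
qed

text \<open>Grow \<open>{x}\<close> and \<open>{y}\<close>, indexed by the two Booleans, until they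
  fill \<open>A\<close>; connectivity of \<open>A\<close> joins the two parts.\<close>

lemma conn_split:
  assumes "conn E A" "finite A" "x \<in> A" "y \<in> A" "x \<noteq> y"
  obtains X Y where "conn E X" "conn E Y" "X \<union> Y = A" "X \<inter> Y = {}" "adjacent E X Y" "x \<in> X" "y \<in> Y"
proof -
  have "\<exists>B'. (\<forall>i\<in>UNIV. {if i then x else y} \<subseteq> B' i \<and> conn E (B' i)) \<and> disjoint_family_on B' UNIV
      \<and> (\<Union>i\<in>UNIV. B' i) = A"
    by (rule conn_extend[OF assms(1,2)]) (use assms in \<open>auto simp: disjoint_family_on_def\<close>)
  then obtain B where B: "\<forall>i. {if i then x else y} \<subseteq> B i \<and> conn E (B i)"
    "disjoint_family_on B UNIV" "(\<Union>i\<in>UNIV. B i) = A" by auto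
  have 1: "x \<in> B True" "y \<in> B False" "conn E (B True)" "conn E (B False)"
    using B(1) by (metis (full_types) empty_subsetI insert_subset)+
  have 2: "B True \<inter> B False = {}" using B(2) unfolding disjoint_family_on_def by blast
  have 3: "B True \<union> B False = A" using B(3) by (auto simp: UNIV_bool)
  have "A - B True = B False" using 2 3 by blast
  moreover have "adjacent E (B True) (A - B True)"
    using 1 2 3 by (intro conn_cut[OF assms(1)]) auto
  ultimately show ?thesis using that[of "B True" "B False"] 1 2 3 by simp
qed

section \<open>Shrinking the branch set of the vertex of degree four in F7\<close>

definition F7_branches :: "'a graph \<Rightarrow> 'a set \<Rightarrow> 'a set \<Rightarrow> 'a set \<Rightarrow> 'a set \<Rightarrow> 'a set \<Rightarrow> bool" where
  "F7_branches G a b c d e \<longleftrightarrow> branches G [a, b, c, d, e] \<and>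
     adj G a b \<and> adj G b c \<and> adj G c d \<and> adj G d a \<and> adj G a c \<and> adj G a e"

text \<open>If one of the parts \<open>X\<close> and \<open>Y\<close> serves at most one of the neighbours of \<open>a\<close>, it can be merged into
  that neighbour. Otherwise each part serves two, which leads to \<open>F3\<close> or \<open>F6\<close>.\<close>

lemma F7_split:
  assumes m: "F7_branches G (X \<union> Y) b c d e"
    and XY: "conn (edges G) X" "conn (edges G) Y" "X \<inter> Y = {}" "adj G X Y" and Xb: "adj G X b"
  shows "(\<exists>B. model G F3 B) \<or> (\<exists>B. model G F6 B) \<or>
    (\<exists>a' b' c' d' e'. (a' = X \<or> a' = Y) \<and> F7_branches G a' b' c' d' e')"
proof -
  note br = m[unfolded F7_branches_def branches_Cons]
  have dj: "X \<inter> b = {}" "X \<inter> c = {}" "X \<inter> d = {}" "X \<inter> e = {}" "Y \<inter> b = {}" "Y \<inter> c = {}" "Y \<inter> d = {}" "Y \<inter> e = {}"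
    "X \<subseteq> verts G" "Y \<subseteq> verts G"
    using br by auto
  note ctx = br XY dj
  have "adj G X c \<or> adj G Y c" "adj G X d \<or> adj G Y d" "adj G X e \<or> adj G Y e"
    using br by (auto simp: adj_simps)
  then consider
    "adj G X c" "adj G X d" "adj G X e" | "adj G X c" "adj G X d" "adj G Y e"
    | "adj G X c" "adj G Y d" "adj G X e" | "adj G X c" "adj G Y d" "adj G Y e"
    | "adj G Y c" "adj G X d" "adj G X e" | "adj G Y c" "adj G X d" "adj G Y e"
    | "adj G Y c" "adj G Y d" "adj G X e" | "adj G Y c" "adj G Y d" "adj G Y e" by blast
  then show ?thesis
  proof cases
    case 1
    then have "F7_branches G X b c d e" using ctx Xb unfolding F7_branches_def branches_Cons
      by (simp add: adj_simps dj_simps)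
    then show ?thesis by blast
  next
    case 2
    then have "conn (edges G) (e \<union> Y)" using ctx Xb by (intro conn_Un) (simp_all add: adj_simps)
    then have "F7_branches G X b c d (e \<union> Y)" using 2 ctx Xb unfolding F7_branches_def branches_Cons
      by (simp add: adj_simps dj_simps)
    then show ?thesis by blast
  next
    case 3
    then have "conn (edges G) (d \<union> Y)" using ctx Xb by (intro conn_Un) (simp_all add: adj_simps)
    then have "F7_branches G X b c (d \<union> Y) e" using 3 ctx Xb unfolding F7_branches_def branches_Cons
      by (simp add: adj_simps dj_simps)
    then show ?thesis by blast
  next
    case 4
    have "branches G [b, X, Y, d, c]" using ctx unfolding branches_Cons
      by (simp add: dj_simps)
    then have "\<exists>B. model G F3 B" using ctx 4 Xb by (intro model_F3I[of G b X Y d c]) (simp_all add: adj_simps)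
    then show ?thesis by blast
  next
    case 5
    then have "conn (edges G) (c \<union> Y)" using ctx Xb by (intro conn_Un) (simp_all add: adj_simps)
    then have "F7_branches G X b (c \<union> Y) d e" using 5 ctx Xb unfolding F7_branches_def branches_Cons
      by (simp add: adj_simps dj_simps)
    then show ?thesis by blast
  next
    \<comment> \<open>Two neighbours at each part, with the leaf \<open>e\<close> at
      \<open>Y\<close>: after merging \<open>b\<close> into \<open>X\<close>, the sets
      \<open>X \<union> b\<close> and \<open>c\<close> are the vertices of degree three not carrying
      the leaf, and \<open>Y\<close> carries it.\<close>
    case 6
    have "conn (edges G) (X \<union> b)" using ctx Xb by (intro conn_Un) simp_all
    then have "branches G [X \<union> b, d, c, Y, e]" using ctx unfolding branches_Cons
      by (simp add: dj_simps)
    then have "\<exists>B. model G F6 B" using ctx 6 Xb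
      by (intro model_F6I[of G "X \<union> b" d c Y e]) (simp_all add: adj_simps)
    then show ?thesis by blast
  next
    case 7
    have "branches G [d, Y, X, b, c]" using ctx unfolding branches_Cons
      by (simp add: dj_simps)
    then have "\<exists>B. model G F3 B" using ctx 7 Xb by (intro model_F3I[of G d Y X b c]) (simp_all add: adj_simps)
    then show ?thesis by blast
  next
    case 8
    then have "conn (edges G) (b \<union> X)" using ctx Xb by (intro conn_Un) (simp_all add: adj_simps)
    then have "F7_branches G Y (b \<union> X) c d e" using 8 ctx Xb unfolding F7_branches_def branches_Cons
      by (simp add: adj_simps dj_simps)
    then show ?thesis by blast
  qed
qed

text \<open>A set \<open>a\<close> with two vertices splits into two smaller connected parts, one of
  which takes over its role unless \<open>F3\<close> or \<open>F6\<close> appears. The size of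
  \<open>a\<close> decreases.\<close>

lemma F7_singleton:
  assumes "simple_graph G" "F7_branches G a b c d e"
  shows "(\<exists>B. model G F3 B) \<or> (\<exists>B. model G F6 B) \<or> (\<exists>x b c d e. F7_branches G {x} b c d e)"
  using assms(2)
proof (induction "card a" arbitrary: a b c d e rule: less_induct)
  case less
  have a: "conn (edges G) a" "a \<subseteq> verts G" using less.prems unfolding F7_branches_def branches_Cons by auto
  then have fin: "finite a" using simple_graph_finite[OF assms(1)] finite_subset by blast
  obtain x where x: "x \<in> a" using conn_ne[OF a(1)] by blast
  show ?case
  proof (cases "a = {x}")
    case True
    then show ?thesis using less.prems by blast
  next
    case False
    then obtain y where "y \<in> a" "x \<noteq> y" using x by blast
    then obtain X Y where XY: "conn (edges G) X" "conn (edges G) Y" "X \<union> Y = a" "X \<inter> Y = {}" "adj G X Y"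
      using conn_split[OF a(1) fin x] by metis
    have "adj G X b \<or> adj G Y b" using less.prems XY(3) unfolding F7_branches_def by (auto simp: adj_simps)
    then have "(\<exists>B. model G F3 B) \<or> (\<exists>B. model G F6 B) \<or>
      (\<exists>a' b' c' d' e'. (a' = X \<or> a' = Y) \<and> F7_branches G a' b' c' d' e')"
    proof
      assume "adj G X b"
      moreover have "F7_branches G (X \<union> Y) b c d e" using less.prems XY(3) by simp
      ultimately show ?thesis using F7_split[of G X Y b c d e] XY(1,2,4,5) by blast
    next
      assume "adj G Y b"
      moreover have "F7_branches G (Y \<union> X) b c d e" using less.prems XY(3) by (simp add: Un_commute)
      moreover have "Y \<inter> X = {}" "adj G Y X" using XY(4,5) by (simp_all add: Int_commute adjacent_sym)
      ultimately show ?thesis using F7_split[of G Y X b c d e] XY(1,2) by blast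
    qed
    moreover have "card X < card a" "card Y < card a"
      using XY conn_ne[OF XY(1)] conn_ne[OF XY(2)] fin by (auto intro!: psubset_card_mono)
    ultimately show ?thesis using less.hyps by blast
  qed
qed

lemma no_layout_of_minor:
  assumes G: "simple_graph G" and F: "F \<in> {F1, F2, F3, F4, F5, F6, F7, F8}" and m: "model G F B"
  shows "\<not> (\<forall>w. \<exists>r. layout1 G w r)"
proof (cases "F = F7")
  case True
  have V: "verts F7 = {..<5}" unfolding F7_def by auto
  have "branches G (map B [0..<5])" using branches_of_model[OF _ V] m True by blast
  moreover have "[0..<5] = [0, 1, 2, 3, 4::nat]" by (simp add: upt_rec)
  ultimately have br: "branches G [B 0, B 1, B 2, B 3, B 4]" by simp
  have "adj G (B i) (B j)" if "{i, j} \<in> edges F7" for i j using m that True unfolding model_def by blast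
  then have "F7_branches G (B 0) (B 1) (B 2) (B 3) (B 4)"
    unfolding F7_branches_def using br by (simp add: F7_def)
  from F7_singleton[OF G this] consider B where "model G F3 B" | B where "model G F6 B"
    | x b c d e where "F7_branches G {x} b c d e" by blast
  then show ?thesis
  proof cases
    case 3
    have "model G F7 (\<lambda>i. [{x}, b, c, d, e] ! i)"
      using 3 unfolding F7_branches_def by (intro model_F7I) auto
    then show ?thesis by (rule no_layout_F7[OF G]) simp
  qed (use no_layout_F3[OF G] no_layout_F6[OF G] in blast)+
next
  case False
  then show ?thesis
    using F m no_layout_F1[OF G] no_layout_F2[OF G] no_layout_F3[OF G] no_layout_F4[OF G] no_layout_F5[OF G]
      no_layout_F6[OF G] no_layout_F8[OF G] by auto
qed

section \<open>Components with more than one cycle\<close>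

definition minor_free :: "'a graph \<Rightarrow> bool" where
  "minor_free G \<longleftrightarrow> simple_graph G \<and> (\<forall>F\<in>{F1, F2, F3, F4, F5, F6, F7, F8}. \<not> (\<exists>B. model G F B))"

lemma minor_freeD:
  assumes "minor_free G"
  shows "simple_graph G" "\<not> (\<exists>B. model G F1 B)" "\<not> (\<exists>B. model G F2 B)" "\<not> (\<exists>B. model G F3 B)"
    "\<not> (\<exists>B. model G F4 B)" "\<not> (\<exists>B. model G F5 B)" "\<not> (\<exists>B. model G F6 B)" "\<not> (\<exists>B. model G F7 B)"
    "\<not> (\<exists>B. model G F8 B)"
  using assms unfolding minor_free_def by blast+

section \<open>Unsplittable branch sets in K_4 minus an edge (\<open>diamond\<close>) and K_{2,3}
  (\<open>theta\<close>)\<close>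

lemma singleton_or_split:
  assumes "conn E A" "finite A"
  obtains x where "A = {x}"
  | X Y where "conn E X" "conn E Y" "X \<union> Y = A" "X \<inter> Y = {}" "adjacent E X Y"
proof -
  obtain x where x: "x \<in> A" using conn_ne[OF assms(1)] by blast
  show ?thesis
  proof (cases "A = {x}")
    case False
    then obtain y where "y \<in> A" "x \<noteq> y" using x by blast
    then show ?thesis using conn_split[OF assms x] that(2) by metis
  qed (use that(1) in blast)
qed

text \<open>The hubs are \<open>a\<close> and \<open>c\<close>. With the same names, this is
  \<open>F6\<close> and \<open>F7\<close> without their leaf.\<close>

definition diamond :: "'a graph \<Rightarrow> 'a set \<Rightarrow> 'a set \<Rightarrow> 'a set \<Rightarrow> 'a set \<Rightarrow> bool" where
  "diamond G a b c d \<longleftrightarrow> branches G [a, b, c, d] \<and> adj G a b \<and> adj G b c \<and> adj G c d \<and> adj G d a \<and> adj G a c"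

definition theta :: "'a graph \<Rightarrow> 'a set \<Rightarrow> 'a set \<Rightarrow> 'a set \<Rightarrow> 'a set \<Rightarrow> 'a set \<Rightarrow> bool" where
  "theta G p q x y z \<longleftrightarrow> branches G [p, q, x, y, z] \<and>
     adj G p x \<and> adj G p y \<and> adj G p z \<and> adj G q x \<and> adj G q y \<and> adj G q z"

lemma diamond_sym: "diamond G a b c d \<Longrightarrow> diamond G c b a d" "diamond G a b c d \<Longrightarrow> diamond G a d c b"
  unfolding diamond_def branches_Cons by (auto simp: adj_simps)

lemma theta_sym: "theta G p q x y z \<Longrightarrow> theta G q p x y z" "theta G p q x y z \<Longrightarrow> theta G p q y x z"
  "theta G p q x y z \<Longrightarrow> theta G p q x z y"
  unfolding theta_def branches_Cons by (auto simp: adj_simps)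

text \<open>If both hubs touch the part \<open>X\<close>, then \<open>Y\<close> is a leaf at a
  middle vertex, as in \<open>F6\<close>. If they touch different parts, a triangle has been
  stretched to a 4-cycle, as in \<open>F3\<close>.\<close>

lemma diamond_split_middle:
  assumes G: "minor_free G" and m: "diamond G a (X \<union> Y) c d"
    and XY: "conn (edges G) X" "conn (edges G) Y" "X \<inter> Y = {}" "adj G X Y" and aX: "adj G a X"
  shows False
proof -
  note br = m[unfolded diamond_def branches_Cons]
  have sub: "X \<subseteq> verts G" "Y \<subseteq> verts G" using br by auto
  note ctx = br XY aX sub
  have "adj G c X \<or> adj G c Y" using br by (simp add: adj_simps)
  then show False
  proof
    assume *: "adj G c X"
    have "branches G [a, d, c, X, Y]" using ctx unfolding branches_Cons by (simp add: dj_simps)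
    then show False
      by (rule notE[OF minor_freeD(7)[OF G] model_F6I]) (use ctx * in \<open>simp_all add: adj_simps\<close>)
  next
    assume *: "adj G c Y"
    have "branches G [d, a, X, Y, c]" using ctx unfolding branches_Cons by (simp add: dj_simps)
    then show False
      by (rule notE[OF minor_freeD(4)[OF G] model_F3I]) (use ctx * in \<open>simp_all add: adj_simps\<close>)
  qed
qed

text \<open>If \<open>X\<close> gets all three neighbours, \<open>Y\<close> is a leaf at a hub, as
  in \<open>F7\<close>. If \<open>b\<close> and \<open>d\<close> end up at different parts, the
  result is \<open>F3\<close>. The only harmless split leaves exactly \<open>c\<close> to
  \<open>Y\<close>, and then \<open>Y\<close> is a third middle set between \<open>X\<close> and
  \<open>c\<close>.\<close>

lemma diamond_split_hub:
  assumes G: "minor_free G" and m: "diamond G (X \<union> Y) b c d"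
    and XY: "conn (edges G) X" "conn (edges G) Y" "X \<inter> Y = {}" "adj G X Y" and Xb: "adj G X b"
  shows "theta G X c b d Y"
proof -
  note br = m[unfolded diamond_def branches_Cons]
  have sub: "X \<subseteq> verts G" "Y \<subseteq> verts G" using br by auto
  note ctx = br XY Xb sub
  have "adj G X c \<or> adj G Y c" "adj G X d \<or> adj G Y d" using br by (auto simp: adj_simps)
  then consider "adj G X c" "adj G X d" | "adj G X c" "adj G Y d" | "adj G Y c" "adj G X d"
    | "adj G Y c" "adj G Y d" by blast
  then show ?thesis
  proof cases
    case 1
    have "branches G [X, b, c, d, Y]" using ctx unfolding branches_Cons by (simp add: dj_simps)
    then have "model G F7 (\<lambda>i. [X, b, c, d, Y] ! i)"
      by (rule model_F7I) (use ctx 1 in \<open>simp_all add: adj_simps\<close>)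
    then show ?thesis using minor_freeD[OF G] by blast
  next
    case 2
    have "branches G [b, X, Y, d, c]" using ctx unfolding branches_Cons by (simp add: dj_simps)
    then show ?thesis
      by (rule notE[OF minor_freeD(4)[OF G] model_F3I]) (use ctx 2 in \<open>simp_all add: adj_simps\<close>)
  next
    case 3
    then show ?thesis using ctx unfolding theta_def branches_Cons by (simp add: dj_simps adj_simps)
  next
    case 4
    have "branches G [d, Y, X, b, c]" using ctx unfolding branches_Cons by (simp add: dj_simps)
    then show ?thesis
      by (rule notE[OF minor_freeD(4)[OF G] model_F3I]) (use ctx 4 in \<open>simp_all add: adj_simps\<close>)
  qed
qed

text \<open>Merging \<open>p\<close> with \<open>y\<close> gives K_4 minus an edge with hubs
  \<open>p \<union> y\<close> and \<open>q\<close>, and the argument for a split middle set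
  repeats.\<close>

lemma theta_split_middle:
  assumes G: "minor_free G" and m: "theta G p q (X \<union> Y) y z"
    and XY: "conn (edges G) X" "conn (edges G) Y" "X \<inter> Y = {}" "adj G X Y" and pX: "adj G p X"
  shows False
proof -
  note br = m[unfolded theta_def branches_Cons]
  have sub: "X \<subseteq> verts G" "Y \<subseteq> verts G" using br by auto
  have py: "conn (edges G) (p \<union> y)" using br by (intro conn_Un) simp_all
  note ctx = br XY pX sub py
  have "adj G q X \<or> adj G q Y" using br by (simp add: adj_simps)
  then show False
  proof
    assume *: "adj G q X"
    have "branches G [p \<union> y, z, q, X, Y]" using ctx unfolding branches_Cons by (simp add: dj_simps)
    then show False
      by (rule notE[OF minor_freeD(7)[OF G] model_F6I]) (use ctx * in \<open>simp_all add: adj_simps\<close>)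
  next
    assume *: "adj G q Y"
    have "branches G [z, p \<union> y, X, Y, q]" using ctx unfolding branches_Cons by (simp add: dj_simps)
    then show False
      by (rule notE[OF minor_freeD(4)[OF G] model_F3I]) (use ctx * in \<open>simp_all add: adj_simps\<close>)
  qed
qed

text \<open>Merging \<open>q\<close> with a middle set gives K_4 minus an edge with a split hub. If
  both parts touch middle sets, the merged one is chosen such that the remaining two are at
  different parts, which yields \<open>F3\<close>; so no harmless split remains.\<close>

lemma theta_split_hub:
  assumes G: "minor_free G" and m: "theta G (X \<union> Y) q x y z"
    and XY: "conn (edges G) X" "conn (edges G) Y" "X \<inter> Y = {}" "adj G X Y" and Xx: "adj G X x"
  shows False
proof -
  note br = m[unfolded theta_def branches_Cons]
  have sub: "X \<subseteq> verts G" "Y \<subseteq> verts G" using br by auto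
  have qy: "conn (edges G) (q \<union> y)" "conn (edges G) (q \<union> z)" using br by (auto intro: conn_Un)
  note ctx = br XY Xx sub qy
  have "adj G X y \<or> adj G Y y" "adj G X z \<or> adj G Y z" using br by (auto simp: adj_simps)
  then consider "adj G X y" "adj G X z" | "adj G X y" "adj G Y z" | "adj G Y y" "adj G X z"
    | "adj G Y y" "adj G Y z" by blast
  then show False
  proof cases
    case 1
    have "branches G [X, x, q \<union> y, z, Y]" using ctx unfolding branches_Cons by (simp add: dj_simps)
    then have "model G F7 (\<lambda>i. [X, x, q \<union> y, z, Y] ! i)"
      by (rule model_F7I) (use ctx 1 in \<open>simp_all add: adj_simps\<close>)
    then show ?thesis using minor_freeD[OF G] by blast
  next
    case 2
    have "branches G [x, X, Y, z, q \<union> y]" using ctx unfolding branches_Cons by (simp add: dj_simps)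
    then show ?thesis
      by (rule notE[OF minor_freeD(4)[OF G] model_F3I]) (use ctx 2 in \<open>simp_all add: adj_simps\<close>)
  next
    case 3
    have "branches G [x, X, Y, y, q \<union> z]" using ctx unfolding branches_Cons by (simp add: dj_simps)
    then show ?thesis
      by (rule notE[OF minor_freeD(4)[OF G] model_F3I]) (use ctx 3 in \<open>simp_all add: adj_simps\<close>)
  next
    case 4
    have "branches G [y, Y, X, x, q \<union> z]" using ctx unfolding branches_Cons by (simp add: dj_simps)
    then show ?thesis
      by (rule notE[OF minor_freeD(4)[OF G] model_F3I]) (use ctx 4 in \<open>simp_all add: adj_simps\<close>)
  qed
qed

lemma branches_finite: "simple_graph G \<Longrightarrow> branches G Bs \<Longrightarrow> B \<in> set Bs \<Longrightarrow> finite B"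
  using simple_graph_finite(1) unfolding branches_def by (blast intro: finite_subset)

lemma diamond_middle_singleton:
  assumes G: "minor_free G" and m: "diamond G a b c d"
  shows "\<exists>x. b = {x}"
proof -
  have b: "conn (edges G) b" "finite b"
    using m branches_finite[OF minor_freeD(1)[OF G], of "[a, b, c, d]" b]
    unfolding diamond_def by (auto simp: branches_Cons)
  show ?thesis
    using b
  proof (rule singleton_or_split)
    fix X Y assume XY: "conn (edges G) X" "conn (edges G) Y" "X \<union> Y = b" "X \<inter> Y = {}" "adj G X Y"
    have m': "diamond G a (X \<union> Y) c d" "diamond G a (Y \<union> X) c d" using m XY(3) by (simp_all add: Un_commute)
    have "adj G a X \<or> adj G a Y" using m' unfolding diamond_def by (simp add: adj_simps)
    then show ?thesis
      using diamond_split_middle[OF G m'(1) XY(1,2)] diamond_split_middle[OF G m'(2) XY(2,1)] XY(4,5)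
      by (metis Int_commute adjacent_sym)
  qed blast
qed

lemma diamond_hub_singleton:
  assumes G: "minor_free G" and m: "diamond G a b c d"
  shows "(\<exists>x. a = {x}) \<or> (\<exists>p q x y z. theta G p q x y z \<and> p \<union> q \<union> x \<union> y \<union> z = a \<union> b \<union> c \<union> d)"
proof -
  have a: "conn (edges G) a" "finite a"
    using m branches_finite[OF minor_freeD(1)[OF G], of "[a, b, c, d]" a]
    unfolding diamond_def by (auto simp: branches_Cons)
  show ?thesis
    using a
  proof (rule singleton_or_split)
    fix X Y assume XY: "conn (edges G) X" "conn (edges G) Y" "X \<union> Y = a" "X \<inter> Y = {}" "adj G X Y"
    have m': "diamond G (X \<union> Y) b c d" "diamond G (Y \<union> X) b c d" using m XY(3) by (simp_all add: Un_commute)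
    have "adj G X b \<or> adj G Y b" using m' unfolding diamond_def by (auto simp: adj_simps)
    then have "theta G X c b d Y \<or> theta G Y c b d X"
      using diamond_split_hub[OF G m'(1) XY(1,2)] diamond_split_hub[OF G m'(2) XY(2,1)] XY(4,5)
      by (auto simp: Int_commute adjacent_sym)
    moreover have "X \<union> c \<union> b \<union> d \<union> Y = a \<union> b \<union> c \<union> d" "Y \<union> c \<union> b \<union> d \<union> X = a \<union> b \<union> c \<union> d"
      using XY(3) by auto
    ultimately show ?thesis by blast
  qed blast
qed

lemma theta_hub_singleton:
  assumes G: "minor_free G" and m: "theta G p q x y z"
  shows "\<exists>v. p = {v}"
proof -
  have p: "conn (edges G) p" "finite p"
    using m branches_finite[OF minor_freeD(1)[OF G], of "[p, q, x, y, z]" p]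
    unfolding theta_def by (auto simp: branches_Cons)
  show ?thesis
    using p
  proof (rule singleton_or_split)
    fix X Y assume XY: "conn (edges G) X" "conn (edges G) Y" "X \<union> Y = p" "X \<inter> Y = {}" "adj G X Y"
    have m': "theta G (X \<union> Y) q x y z" "theta G (Y \<union> X) q x y z" using m XY(3) by (simp_all add: Un_commute)
    have "adj G X x \<or> adj G Y x" using m' unfolding theta_def by (auto simp: adj_simps)
    then show ?thesis
      using theta_split_hub[OF G m'(1) XY(1,2)] theta_split_hub[OF G m'(2) XY(2,1)] XY(4,5)
      by (metis Int_commute adjacent_sym)
  qed blast
qed

lemma theta_middle_singleton:
  assumes G: "minor_free G" and m: "theta G p q x y z"
  shows "\<exists>v. x = {v}"
proof -
  have x: "conn (edges G) x" "finite x"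
    using m branches_finite[OF minor_freeD(1)[OF G], of "[p, q, x, y, z]" x]
    unfolding theta_def by (auto simp: branches_Cons)
  show ?thesis
    using x
  proof (rule singleton_or_split)
    fix X Y assume XY: "conn (edges G) X" "conn (edges G) Y" "X \<union> Y = x" "X \<inter> Y = {}" "adj G X Y"
    have m': "theta G p q (X \<union> Y) y z" "theta G p q (Y \<union> X) y z" using m XY(3) by (simp_all add: Un_commute)
    have "adj G p X \<or> adj G p Y" using m' unfolding theta_def by (auto simp: adj_simps)
    then show ?thesis
      using theta_split_middle[OF G m'(1) XY(1,2)] theta_split_middle[OF G m'(2) XY(2,1)] XY(4,5)
      by (metis Int_commute adjacent_sym)
  qed blast
qed

lemma adj_single [simp]: "adj G {x} {y} \<longleftrightarrow> {x, y} \<in> edges G"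
  unfolding adjacent_def by simp

text \<open>Further edges are impossible: one between the hubs would complete \<open>F7\<close>, one
  between two middle vertices \<open>F3\<close>.\<close>

lemma theta_component:
  assumes G: "minor_free G" and m: "theta G p q x y z"
  obtains P Q X Y Z where "p \<union> q \<union> x \<union> y \<union> z = {P, Q, X, Y, Z}" "distinct [P, Q, X, Y, Z]"
    "{e\<in>edges G. e \<subseteq> {P, Q, X, Y, Z}} = {{P, X}, {P, Y}, {P, Z}, {Q, X}, {Q, Y}, {Q, Z}}"
proof -
  obtain P where P: "p = {P}" using theta_hub_singleton[OF G m] by blast
  obtain Q where Q: "q = {Q}" using theta_hub_singleton[OF G theta_sym(1)[OF m]] by blast
  obtain X where X: "x = {X}" using theta_middle_singleton[OF G m] by blast
  obtain Y where Y: "y = {Y}" using theta_middle_singleton[OF G theta_sym(2)[OF m]] by blast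
  obtain Z where Z: "z = {Z}"
    using theta_middle_singleton[OF G theta_sym(2)[OF theta_sym(3)[OF m]]] by blast
  have t: "theta G {P} {Q} {X} {Y} {Z}" using m unfolding P Q X Y Z .
  have noPQ: "\<not> adj G p q" if t: "theta G p q x y z" for p q x y z
  proof
    assume *: "adj G p q"
    have "branches G [p, x, q, y, z]" using t unfolding theta_def branches_Cons by (simp add: dj_simps)
    then have "model G F7 (\<lambda>i. [p, x, q, y, z] ! i)"
      by (rule model_F7I) (use t * in \<open>simp_all add: adj_simps theta_def\<close>)
    then show False using minor_freeD[OF G] by blast
  qed
  have noXY: "\<not> adj G x y" if t: "theta G p q x y z" for p q x y z
  proof
    assume *: "adj G x y"
    have "branches G [x, p, z, q, y]" using t unfolding theta_def branches_Cons by (simp add: dj_simps)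
    then show False
      by (rule notE[OF minor_freeD(4)[OF G] model_F3I]) (use t * in \<open>simp_all add: adj_simps theta_def\<close>)
  qed
  have no: "{P, Q} \<notin> edges G" "{X, Y} \<notin> edges G" "{X, Z} \<notin> edges G" "{Y, Z} \<notin> edges G"
    using noPQ[OF t] noXY[OF t] noXY[OF theta_sym(3)[OF t]] noXY[OF theta_sym(3)[OF theta_sym(2)[OF t]]] by auto
  have yes: "{P, X} \<in> edges G" "{P, Y} \<in> edges G" "{P, Z} \<in> edges G"
    "{Q, X} \<in> edges G" "{Q, Y} \<in> edges G" "{Q, Z} \<in> edges G" "distinct [P, Q, X, Y, Z]"
    using t unfolding theta_def branches_Cons by auto
  show ?thesis
  proof
    show "p \<union> q \<union> x \<union> y \<union> z = {P, Q, X, Y, Z}" unfolding P Q X Y Z by auto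
    show "{e\<in>edges G. e \<subseteq> {P, Q, X, Y, Z}} = {{P, X}, {P, Y}, {P, Z}, {Q, X}, {Q, Y}, {Q, Z}}" (is "?L = ?R")
    proof
      show "?R \<subseteq> ?L" using yes by auto
      show "?L \<subseteq> ?R"
      proof
        fix e assume e: "e \<in> ?L"
        then obtain u v where uv: "e = {u, v}" "u \<noteq> v"
          using minor_freeD(1)[OF G] unfolding simple_graph_def by (auto simp: card_2_iff)
        have uvK: "u = P \<or> u = Q \<or> u = X \<or> u = Y \<or> u = Z" "v = P \<or> v = Q \<or> v = X \<or> v = Y \<or> v = Z"
          and E: "{u, v} \<in> edges G" using e uv by auto
        have no': "{Q, P} \<notin> edges G" "{Y, X} \<notin> edges G" "{Z, X} \<notin> edges G" "{Z, Y} \<notin> edges G"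
          using no by (simp_all add: insert_commute)
        show "e \<in> ?R" unfolding uv(1) using uvK
          by (elim disjE; use E no no' uv(2) in \<open>simp add: doubleton_eq_iff\<close>)
      qed
    qed
  qed (use yes in simp)
qed

lemma diamond_component:
  assumes G: "minor_free G" and m: "diamond G a b c d" and a: "a = {A}" and c: "c = {C}"
  obtains B D where "a \<union> b \<union> c \<union> d = {A, B, C, D}" "distinct [A, B, C, D]"
    "{e\<in>edges G. e \<subseteq> {A, B, C, D}} = {{A, B}, {B, C}, {C, D}, {D, A}, {A, C}}"
proof -
  obtain B where B: "b = {B}" using diamond_middle_singleton[OF G m] by blast
  obtain D where D: "d = {D}" using diamond_middle_singleton[OF G diamond_sym(2)[OF m]] by blast
  have t: "diamond G {A} {B} {C} {D}" using m unfolding a B c D .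
  have "\<not> adj G {B} {D}"
  proof
    assume *: "adj G {B} {D}"
    have "branches G [{A}, {B}, {C}, {D}]" using t unfolding diamond_def by blast
    then show False
      by (rule notE[OF minor_freeD(2)[OF G] model_F1I]) (use t * in \<open>simp_all add: diamond_def insert_commute\<close>)
  qed
  then have no: "{B, D} \<notin> edges G" by simp
  have yes: "{A, B} \<in> edges G" "{B, C} \<in> edges G" "{C, D} \<in> edges G"
    "{D, A} \<in> edges G" "{A, C} \<in> edges G" "distinct [A, B, C, D]"
    using t unfolding diamond_def branches_Cons by auto
  show ?thesis
  proof
    show "a \<union> b \<union> c \<union> d = {A, B, C, D}" unfolding a B c D by auto
    show "{e\<in>edges G. e \<subseteq> {A, B, C, D}} = {{A, B}, {B, C}, {C, D}, {D, A}, {A, C}}" (is "?L = ?R")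
    proof
      show "?R \<subseteq> ?L" using yes by auto
      show "?L \<subseteq> ?R"
      proof
        fix e assume e: "e \<in> ?L"
        then obtain u v where uv: "e = {u, v}" "u \<noteq> v"
          using minor_freeD(1)[OF G] unfolding simple_graph_def by (auto simp: card_2_iff)
        have uvK: "u = A \<or> u = B \<or> u = C \<or> u = D" "v = A \<or> v = B \<or> v = C \<or> v = D"
          and E: "{u, v} \<in> edges G" using e uv by auto
        have no': "{D, B} \<notin> edges G" using no by (simp add: insert_commute)
        show "e \<in> ?R" unfolding uv(1) using uvK
          by (elim disjE; use E no no' uv(2) in \<open>simp add: doubleton_eq_iff\<close>)
      qed
    qed
  qed (use yes in simp)
qed

lemma branches_extend:
  assumes "conn (edges G) K" "finite K" "K \<subseteq> verts G" "branches G Bs" "Bs \<noteq> []" "\<forall>B\<in>set Bs. B \<subseteq> K"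
  obtains Cs where "branches G Cs" "length Cs = length Bs" "\<Union>(set Cs) = K" "\<forall>i<length Bs. Bs ! i \<subseteq> Cs ! i"
proof -
  let ?I = "{..<length Bs}"
  have dj: "disjoint_family_on (\<lambda>i. Bs ! i) ?I"
  proof -
    have "Bs ! i \<inter> Bs ! j = {}" if "i < j" "j < length Bs" for i j
      using assms(4) that unfolding branches_def sorted_wrt_iff_nth_less by blast
    then show ?thesis unfolding disjoint_family_on_def by (metis inf_commute lessThan_iff linorder_neqE_nat)
  qed
  obtain B' where B': "\<forall>i\<in>?I. Bs ! i \<subseteq> B' i \<and> conn (edges G) (B' i)" "disjoint_family_on B' ?I" "(\<Union>i\<in>?I. B' i) = K"
    using conn_extend[OF assms(1,2) _ _ dj] assms(4-6) unfolding branches_def by fastforce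
  have sub: "B' i \<subseteq> verts G" if "i < length Bs" for i
  proof -
    have "B' i \<subseteq> (\<Union>i\<in>?I. B' i)" using that by (intro UN_upper) simp
    then show ?thesis using B'(3) assms(3) by simp
  qed
  have "set (map B' [0..<length Bs]) = B' ` ?I" by (simp add: atLeast0LessThan)
  moreover have "branches G (map B' [0..<length Bs])"
    using B'(1,2) sub unfolding branches_def sorted_wrt_iff_nth_less disjoint_family_on_def by auto
  ultimately show ?thesis using that[of "map B' [0..<length Bs]"] B' by auto
qed

text \<open>The branch sets are first enlarged to partition \<open>K\<close>. Once they are shown to
  be singletons, no other vertex is left in the component.\<close>

lemma diamond_classify:
  assumes G: "minor_free G" and K: "conn (edges G) K" "K \<subseteq> verts G"
    and m: "diamond G a b c d" "a \<union> b \<union> c \<union> d \<subseteq> K"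
  shows "(\<exists>A B C D. K = {A, B, C, D} \<and> distinct [A, B, C, D] \<and>
      {e\<in>edges G. e \<subseteq> K} = {{A, B}, {B, C}, {C, D}, {D, A}, {A, C}}) \<or>
    (\<exists>P Q X Y Z. K = {P, Q, X, Y, Z} \<and> distinct [P, Q, X, Y, Z] \<and>
      {e\<in>edges G. e \<subseteq> K} = {{P, X}, {P, Y}, {P, Z}, {Q, X}, {Q, Y}, {Q, Z}})"
proof -
  have fK: "finite K" using K(2) simple_graph_finite[OF minor_freeD(1)[OF G]] finite_subset by blast
  have br: "branches G [a, b, c, d]" using m(1) unfolding diamond_def by blast
  obtain Cs where Cs: "branches G Cs" "length Cs = length [a, b, c, d]" "\<Union>(set Cs) = K"
    "\<forall>i<length [a, b, c, d]. [a, b, c, d] ! i \<subseteq> Cs ! i"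
    using branches_extend[OF K(1) fK K(2) br] m(2) by auto
  then obtain a' b' c' d' where *: "Cs = [a', b', c', d']" by (auto simp: length_Suc_conv)
  have sub: "a \<subseteq> a'" "b \<subseteq> b'" "c \<subseteq> c'" "d \<subseteq> d'"
    using Cs(4)[rule_format, of 0] Cs(4)[rule_format, of 1] Cs(4)[rule_format, of 2] Cs(4)[rule_format, of 3]
    unfolding * by simp_all
  have m': "diamond G a' b' c' d'" using m(1) Cs(1) adjacent_mono[OF _ order_refl] sub
    unfolding diamond_def * by metis
  have U: "a' \<union> b' \<union> c' \<union> d' = K" "c' \<union> b' \<union> a' \<union> d' = K" using Cs(3) unfolding * by auto
  have th: ?thesis if t: "theta G p q x y z" "p \<union> q \<union> x \<union> y \<union> z = K" for p q x y z
  proof -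
    obtain P Q X Y Z where *: "p \<union> q \<union> x \<union> y \<union> z = {P, Q, X, Y, Z}" "distinct [P, Q, X, Y, Z]"
      "{e\<in>edges G. e \<subseteq> {P, Q, X, Y, Z}} = {{P, X}, {P, Y}, {P, Z}, {Q, X}, {Q, Y}, {Q, Z}}"
      by (rule theta_component[OF G t(1)])
    have "K = {P, Q, X, Y, Z}" using *(1) t(2) by simp
    then show ?thesis using *(2,3)
      by (intro disjI2 exI[of _ P] exI[of _ Q] exI[of _ X] exI[of _ Y] exI[of _ Z]) simp
  qed
  consider p q x y z where "theta G p q x y z" "p \<union> q \<union> x \<union> y \<union> z = K" | A C where "a' = {A}" "c' = {C}"
    using diamond_hub_singleton[OF G m'] diamond_hub_singleton[OF G diamond_sym(1)[OF m']] U by auto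
  then show ?thesis
  proof cases
    case 2
    obtain B D where *: "a' \<union> b' \<union> c' \<union> d' = {A, B, C, D}" "distinct [A, B, C, D]"
      "{e\<in>edges G. e \<subseteq> {A, B, C, D}} = {{A, B}, {B, C}, {C, D}, {D, A}, {A, C}}"
      by (rule diamond_component[OF G m' 2])
    have "K = {A, B, C, D}" using *(1) U(1) by simp
    then show ?thesis using *(2,3)
      by (intro disjI1 exI[of _ A] exI[of _ B] exI[of _ C] exI[of _ D]) simp
  qed (rule th)
qed

section \<open>From two cycles to K_4 minus an edge\<close>

lemma cycle_middle:
  assumes "x \<noteq> y" and X: "conn (E - {{x, y}}) X" "x \<in> X" "y \<in> X"
  obtains M where "conn E M" "M \<subseteq> X - {x, y}" "adjacent E M {x}" "adjacent E M {y}"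
proof -
  let ?E = "E - {{x, y}}"
  \<comment> \<open>These are candidates for the part of the cycle between \<open>x\<close> and
    \<open>y\<close>, as seen from \<open>x\<close>. An edge of \<open>X\<close> that leaves their
    union together with \<open>x\<close> must lead to \<open>y\<close>, since any other outer end
    could be added to a candidate.\<close>
  define \<M> where "\<M> = {M. conn ?E M \<and> M \<subseteq> X - {x, y} \<and> adjacent ?E M {x}}"
  have step: "insert q M \<in> \<M>" if "M \<in> \<M>" "p \<in> M" "{p, q} \<in> ?E" "q \<in> X - {x, y}" for M p q
  proof -
    have "conn ?E (insert q M)" using that unfolding \<M>_def by (intro conn_insert) auto
    moreover have "adjacent ?E (insert q M) {x}"
      using that unfolding \<M>_def by (auto intro: adjacent_mono[of ?E M "{x}"])
    ultimately show ?thesis using that unfolding \<M>_def by simp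
  qed
  have "adjacent ?E (insert x (\<Union>\<M>)) (X - insert x (\<Union>\<M>))"
  proof (rule conn_cut[OF X(1)])
    show "insert x (\<Union>\<M>) \<subseteq> X" using X(2) unfolding \<M>_def by auto
    show "X - insert x (\<Union>\<M>) \<noteq> {}" using X(3) assms(1) unfolding \<M>_def by auto
  qed simp
  then obtain p q where pq: "p \<in> insert x (\<Union>\<M>)" "q \<in> X" "q \<noteq> x" "q \<notin> \<Union>\<M>" "{p, q} \<in> ?E"
    by (auto elim!: adjacentE)
  have "p \<noteq> x"
  proof
    assume p: "p = x"
    then have "q \<noteq> y" using pq(5) by auto
    then have "{q} \<in> \<M>" using p pq unfolding \<M>_def by (auto simp: adjacent_def insert_commute)
    then show False using pq(4) by blast
  qed
  then obtain M where M: "M \<in> \<M>" "p \<in> M" using pq(1) by blast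
  have "q = y"
  proof (rule ccontr)
    assume "q \<noteq> y"
    then have "insert q M \<in> \<M>" using step[OF M pq(5)] pq(2,3) by simp
    then show False using pq(4) by blast
  qed
  then have "adjacent E M {y}" using M(2) pq(5) by (intro adjacentI[of p y]) auto
  moreover have "conn E M" "M \<subseteq> X - {x, y}" "adjacent E M {x}"
    using M(1) conn_mono[of ?E M E] adjacent_mono[of ?E M "{x}" E] unfolding \<M>_def by auto
  ultimately show ?thesis using that by blast
qed

lemma triangle_partition:
  assumes K: "conn (edges G) K" "finite K" "K \<subseteq> verts G"
    and xy: "{x, y} \<in> edges G" "x \<noteq> y" and X: "conn (edges G - {{x, y}}) X" "x \<in> X" "y \<in> X" "X \<subseteq> K"
  obtains A B C where "branches G [A, B, C]" "adj G A B" "adj G B C" "adj G C A" "A \<union> B \<union> C = K"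
proof -
  obtain M where M: "conn (edges G) M" "M \<subseteq> X - {x, y}" "adj G M {x}" "adj G M {y}"
    using cycle_middle[OF xy(2) X(1-3)] by metis
  have br: "branches G [{x}, {y}, M]"
    unfolding branches_Cons using M(1,2) X K(3) xy(2) by auto
  have MK: "M \<subseteq> K" using M(2) X(4) by blast
  obtain Cs where Cs: "branches G Cs" "length Cs = length [{x}, {y}, M]" "\<Union>(set Cs) = K"
    "\<forall>i<length [{x}, {y}, M]. [{x}, {y}, M] ! i \<subseteq> Cs ! i"
    using branches_extend[OF K br] MK X(2-4) by (auto simp: subset_iff)
  then obtain A B C where *: "Cs = [A, B, C]" by (auto simp: length_Suc_conv)
  have sub: "{x} \<subseteq> A" "{y} \<subseteq> B" "M \<subseteq> C"
    using Cs(4)[rule_format, of 0] Cs(4)[rule_format, of 1] Cs(4)[rule_format, of 2] unfolding * by simp_all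
  have "adj G A B" using xy(1) sub by (intro adjacentI[of x y]) auto
  moreover have "adj G B C" using adjacent_mono[OF M(4) order_refl sub(3,2)] by (simp add: adjacent_sym)
  moreover have "adj G C A" using adjacent_mono[OF M(3) order_refl sub(3,1)] .
  moreover have "A \<union> B \<union> C = K" using Cs(3) unfolding * by auto
  ultimately show ?thesis using that Cs(1) unfolding * by blast
qed

text \<open>If \<open>B\<close> and \<open>C\<close> touch the inner triangle at the same corner,
  two triangles share this corner, as in \<open>F2\<close>. Otherwise \<open>B \<union> C\<close>
  sees two corners and completes K_4 minus an edge.\<close>

lemma triangle_in_branch:
  assumes G: "minor_free G" and br: "branches G [D1, D2, D3, B, C]"
    and ad: "adj G D1 D2" "adj G D2 D3" "adj G D3 D1" "adj G B C" "adj G B D1" "adj G C (D1 \<union> D2 \<union> D3)"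
  shows "\<exists>a b c d. diamond G a b c d \<and> a \<union> b \<union> c \<union> d \<subseteq> D1 \<union> D2 \<union> D3 \<union> B \<union> C"
proof -
  note ctx = br[unfolded branches_Cons] ad
  have BC: "conn (edges G) (B \<union> C)" using ctx by (intro conn_Un) simp_all
  have "adj G C D1 \<or> adj G C D2 \<or> adj G C D3" using ad(6) by (simp add: adj_simps)
  then consider "adj G C D1" | "adj G C D2" | "adj G C D3" by blast
  then show ?thesis
  proof cases
    case 1
    have "branches G [D2, D3, D1, B, C]" using ctx unfolding branches_Cons by (simp add: dj_simps)
    then show ?thesis
      by (rule notE[OF minor_freeD(3)[OF G] model_F2I]) (use ad 1 in \<open>simp_all add: adj_simps\<close>)
  next
    case 2
    then have "diamond G D1 D3 D2 (B \<union> C)"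
      using ctx BC unfolding diamond_def branches_Cons by (simp add: dj_simps adj_simps)
    moreover have "D1 \<union> D3 \<union> D2 \<union> (B \<union> C) \<subseteq> D1 \<union> D2 \<union> D3 \<union> B \<union> C" by auto
    ultimately show ?thesis by blast
  next
    case 3
    then have "diamond G D1 D2 D3 (B \<union> C)"
      using ctx BC unfolding diamond_def branches_Cons by (simp add: dj_simps adj_simps)
    moreover have "D1 \<union> D2 \<union> D3 \<union> (B \<union> C) \<subseteq> D1 \<union> D2 \<union> D3 \<union> B \<union> C" by auto
    ultimately show ?thesis by blast
  qed
qed

lemma chord_in_branch:
  assumes G: "minor_free G" and br: "branches G [A, B, C]"
    and ad: "adj G A B" "adj G B C" "adj G C A"
    and e: "{u, v} \<in> edges G" "u \<noteq> v" "u \<in> A" "v \<in> A" "conn (edges G - {{u, v}}) A"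
  shows "\<exists>a b c d. diamond G a b c d \<and> a \<union> b \<union> c \<union> d \<subseteq> A \<union> B \<union> C"
proof -
  have A: "conn (edges G) A" "A \<subseteq> verts G" using br unfolding branches_Cons by auto
  have fA: "finite A" using branches_finite[OF minor_freeD(1)[OF G] br] by simp
  obtain D1 D2 D3 where D: "branches G [D1, D2, D3]" "adj G D1 D2" "adj G D2 D3" "adj G D3 D1" "D1 \<union> D2 \<union> D3 = A"
    by (rule triangle_partition[OF A(1) fA A(2) e(1,2,5,3,4) order_refl])
  have br': "branches G [P, Q, R, B, C]" if "branches G [P, Q, R]" "P \<union> Q \<union> R = A" for P Q R
    using that br unfolding branches_Cons by auto
  have perm: "branches G [D2, D3, D1]" "branches G [D3, D1, D2]" "D2 \<union> D3 \<union> D1 = A" "D3 \<union> D1 \<union> D2 = A"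
    using D(1,5) unfolding branches_Cons by (simp_all add: dj_simps Un_ac)
  have CA: "adj G C (P \<union> Q \<union> R)" if "P \<union> Q \<union> R = A" for P Q R using ad(3) that by simp
  have "adj G B D1 \<or> adj G B D2 \<or> adj G B D3" using ad(1) D(5)[symmetric] by (simp add: adj_simps)
  then consider "adj G B D1" | "adj G B D2" | "adj G B D3" by blast
  then show ?thesis
  proof cases
    case 1
    show ?thesis using triangle_in_branch[OF G br'[OF D(1,5)] D(2-4) ad(2) 1 CA[OF D(5)]] unfolding D(5) .
  next
    case 2
    show ?thesis using triangle_in_branch[OF G br'[OF perm(1,3)] D(3,4,2) ad(2) 2 CA[OF perm(3)]] unfolding perm(3) .
  next
    case 3
    show ?thesis using triangle_in_branch[OF G br'[OF perm(2,4)] D(4,2,3) ad(2) 3 CA[OF perm(4)]] unfolding perm(4) .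
  qed
qed

text \<open>The part of \<open>A\<close> that \<open>C\<close> touches becomes a hub together with
  \<open>B\<close>; the other part and \<open>C\<close> are the middle sets.\<close>

lemma double_edge_between_branches:
  assumes G: "minor_free G" and br: "branches G [A, B, C]"
    and ad: "adj G B C" "adj G C A" "adj G X B" "adj G Y B"
    and XY: "conn (edges G) X" "conn (edges G) Y" "X \<union> Y = A" "X \<inter> Y = {}" "adj G X Y"
  shows "\<exists>a b c d. diamond G a b c d \<and> a \<union> b \<union> c \<union> d \<subseteq> A \<union> B \<union> C"
proof -
  note ctx = br[unfolded branches_Cons XY(3)[symmetric]] ad XY(1,2,4,5)
  have s: "X \<subseteq> verts G" "Y \<subseteq> verts G" using ctx by auto
  have "adj G C X \<or> adj G C Y" using ad(2) XY(3)[symmetric] by (simp add: adj_simps)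
  then show ?thesis
  proof
    assume "adj G C X"
    then have "diamond G B Y X C" using ctx s unfolding diamond_def branches_Cons by (simp add: dj_simps adj_simps)
    moreover have "B \<union> Y \<union> X \<union> C \<subseteq> A \<union> B \<union> C" using XY(3) by auto
    ultimately show ?thesis by blast
  next
    assume "adj G C Y"
    then have "diamond G B X Y C" using ctx s unfolding diamond_def branches_Cons by (simp add: dj_simps adj_simps)
    moreover have "B \<union> X \<union> Y \<union> C \<subseteq> A \<union> B \<union> C" using XY(3) by auto
    ultimately show ?thesis by blast
  qed
qed

lemma chord_between_branches:
  assumes G: "minor_free G" and br: "branches G [A, B, C]"
    and ad: "adjacent (edges G - {{u, v}}) A B" "adj G B C" "adj G C A"
    and e: "{u, v} \<in> edges G" "u \<in> A" "v \<in> B"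
  shows "\<exists>a b c d. diamond G a b c d \<and> a \<union> b \<union> c \<union> d \<subseteq> A \<union> B \<union> C"
proof -
  have A: "conn (edges G) A" "conn (edges G) B" using br unfolding branches_Cons by auto
  have fin: "finite A" "finite B" using branches_finite[OF minor_freeD(1)[OF G] br] by simp_all
  obtain x y where xy: "x \<in> A" "y \<in> B" "{x, y} \<in> edges G" "{x, y} \<noteq> {u, v}"
    using ad(1) by (auto elim!: adjacentE)
  then have "x \<noteq> u \<or> y \<noteq> v" by auto
  then show ?thesis
  proof
    assume "x \<noteq> u"
    then obtain X Y where XY: "conn (edges G) X" "conn (edges G) Y" "X \<union> Y = A" "X \<inter> Y = {}" "adj G X Y" "x \<in> X" "u \<in> Y"
      using conn_split[OF A(1) fin(1) xy(1) e(2)] by metis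
    show ?thesis
      by (rule double_edge_between_branches[OF G br ad(2,3) _ _ XY(1-5)]) (use XY xy e in \<open>auto intro: adjacentI\<close>)
  next
    assume "y \<noteq> v"
    then obtain X Y where XY: "conn (edges G) X" "conn (edges G) Y" "X \<union> Y = B" "X \<inter> Y = {}" "adj G X Y" "y \<in> X" "v \<in> Y"
      using conn_split[OF A(2) fin(2) xy(2) e(3)] by metis
    have br': "branches G [B, A, C]" using br unfolding branches_Cons by (simp add: dj_simps)
    have ad': "adj G A C" "adj G C B" "adj G X A" "adj G Y A"
      using ad XY(6,7) xy e adjacentI[of u v "edges G" A Y] adjacentI[of x y "edges G" A X]
      by (simp_all add: adjacent_sym)
    show ?thesis
      using double_edge_between_branches[OF G br' ad' XY(1-5)] by (simp add: Un_commute)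
  qed
qed

text \<open>With \<open>{u, v}\<close> set aside, \<open>K\<close> is still connected and has a
  cycle, so it is partitioned into three pairwise adjacent sets. Putting the edge back either closes
  a cycle inside one of them or doubles the connection between two.\<close>

lemma two_cycles_diamond:
  assumes G: "minor_free G" and K: "K \<subseteq> verts G"
    and e: "{u, v} \<in> edges G" "u \<in> K" "v \<in> K" "conn (edges G - {{u, v}}) K"
    and f: "{x, y} \<in> edges G" "{x, y} \<noteq> {u, v}" "conn (edges G - {{u, v}} - {{x, y}}) X" "x \<in> X" "y \<in> X" "X \<subseteq> K"
  shows "\<exists>a b c d. diamond G a b c d \<and> a \<union> b \<union> c \<union> d \<subseteq> K"
proof -
  let ?E = "edges G - {{u, v}}" and ?G = "(verts G, edges G - {{u, v}})"
  have ne: "p \<noteq> q" if "{p, q} \<in> edges G" for p q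
    using minor_freeD(1)[OF G] that unfolding simple_graph_def by fastforce
  have fK: "finite K" using K simple_graph_finite[OF minor_freeD(1)[OF G]] finite_subset by blast
  obtain A B C where ABC: "branches ?G [A, B, C]" "adj ?G A B" "adj ?G B C" "adj ?G C A" "A \<union> B \<union> C = K"
    using triangle_partition[of ?G K x y X] K e(4) f fK ne[OF f(1)] by auto
  have up: "branches G Bs" if "branches ?G Bs" for Bs
    using that conn_mono[of ?E _ "edges G"] unfolding branches_def by auto
  have adup: "adj G P Q" if "adj ?G P Q" for P Q
    using adjacent_mono[OF that[simplified], of "edges G" P Q] by auto
  have bin: ?thesis if "branches ?G [P, Q, R]" "adj ?G P Q" "adj ?G Q R" "adj ?G R P" "P \<union> Q \<union> R = K" "u \<in> P" "v \<in> P" for P Q R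
  proof -
    have "conn ?E P" using that(1) unfolding branches_Cons by simp
    then show ?thesis
      using chord_in_branch[OF G up[OF that(1)] adup[OF that(2)] adup[OF that(3)] adup[OF that(4)] e(1) ne[OF e(1)] that(6,7)]
      unfolding that(5) by blast
  qed
  have btw: ?thesis if "branches ?G [P, Q, R]" "adj ?G P Q" "adj ?G Q R" "adj ?G R P" "P \<union> Q \<union> R = K" "u \<in> P" "v \<in> Q" for P Q R
    using chord_between_branches[OF G up[OF that(1)] _ adup[OF that(3)] adup[OF that(4)] e(1) that(6,7)] that(2)
    unfolding that(5) by simp
  have perm: "branches ?G [B, C, A]" "branches ?G [C, A, B]" "branches ?G [B, A, C]" "branches ?G [A, C, B]" "branches ?G [C, B, A]"
    using ABC(1) unfolding branches_Cons by (simp_all add: dj_simps)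
  have un: "B \<union> C \<union> A = K" "C \<union> A \<union> B = K" "B \<union> A \<union> C = K" "A \<union> C \<union> B = K" "C \<union> B \<union> A = K"
    using ABC(5) by auto
  have ad': "adj ?G B A" "adj ?G C B" "adj ?G A C" using ABC(2-4) adjacent_sym by metis+
  have "u \<in> A \<or> u \<in> B \<or> u \<in> C" "v \<in> A \<or> v \<in> B \<or> v \<in> C" using e(2,3) ABC(5) by auto
  then show ?thesis
    using bin[OF ABC] bin[OF perm(1) ABC(3,4,2) un(1)] bin[OF perm(2) ABC(4,2,3) un(2)]
      btw[OF ABC] btw[OF perm(1) ABC(3,4,2) un(1)] btw[OF perm(2) ABC(4,2,3) un(2)]
      btw[OF perm(3) ad'(1,3,2) un(3)] btw[OF perm(4) ad'(3,2,1) un(4)] btw[OF perm(5) ad'(2,1,3) un(5)]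
    by blast
qed

section \<open>Building a layout from left to right\<close>

text \<open>The vertex sets that can be the initial segment of a layout with one queue. The order of
  insertion is forgotten, since later steps only depend on what has been placed;
  \<open>{u', v'}\<close> ranges over the edges that are open beyond \<open>v\<close>.\<close>

inductive build :: "'a set set \<Rightarrow> ('a set \<Rightarrow> real) \<Rightarrow> 'a set \<Rightarrow> bool" for E w where
  empty: "build E w {}"
| insert: "build E w S \<Longrightarrow> v \<notin> S \<Longrightarrow>
    (\<And>u u' v'. u \<in> S \<Longrightarrow> {u, v} \<in> E \<Longrightarrow> u' \<in> S \<Longrightarrow> v' \<notin> S \<Longrightarrow> v' \<noteq> v \<Longrightarrow> {u', v'} \<in> E \<Longrightarrow>
      w {u, v} \<le> w {u', v'}) \<Longrightarrow> build E w (insert v S)"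

lemma build_layout1:
  assumes "build (edges G) w (verts G)"
  shows "\<exists>r. layout1 G w r"
proof -
  have "\<exists>r. r \<subseteq> S \<times> S \<and> strict_linear_order_on S r \<and>
      (\<forall>v\<in>S. \<forall>u u' v'. {u, v} \<in> edges G \<longrightarrow> {u', v'} \<in> edges G \<longrightarrow> (u, v) \<in> r \<longrightarrow> (u', v) \<in> r \<longrightarrow>
        v' \<noteq> v \<longrightarrow> (v', v) \<notin> r \<longrightarrow> w {u, v} \<le> w {u', v'})" if "build (edges G) w S" for S
    using that
  proof induction
    case empty
    show ?case by (rule exI[of _ "{}"]) (simp add: strict_linear_order_on_def)
  next
    case (insert S v)
    from insert.IH obtain r where r: "r \<subseteq> S \<times> S" "strict_linear_order_on S r" and
      rS: "\<forall>v\<in>S. \<forall>u u' v'. {u, v} \<in> edges G \<longrightarrow> {u', v'} \<in> edges G \<longrightarrow> (u, v) \<in> r \<longrightarrow> (u', v) \<in> r \<longrightarrow>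
        v' \<noteq> v \<longrightarrow> (v', v) \<notin> r \<longrightarrow> w {u, v} \<le> w {u', v'}" by (elim exE conjE)
    define r' where "r' = r \<union> S \<times> {v}"
    have r'_old: "(u, x) \<in> r' \<longleftrightarrow> (u, x) \<in> r" if "x \<in> S" for u x
      using that \<open>v \<notin> S\<close> unfolding r'_def by auto
    have r'_new: "(u, v) \<in> r' \<longleftrightarrow> u \<in> S" for u
      using r(1) \<open>v \<notin> S\<close> unfolding r'_def by auto
    show ?case
    proof (intro exI[of _ r'] conjI ballI allI impI)
      show "r' \<subseteq> insert v S \<times> insert v S" using r(1) unfolding r'_def by auto
      have "trans r" "irrefl r" "total_on S r" using r(2) unfolding strict_linear_order_on_def by auto
      then show "strict_linear_order_on (insert v S) r'"
        using r(1) \<open>v \<notin> S\<close> unfolding strict_linear_order_on_def trans_def irrefl_def total_on_def r'_def by blast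
    next
      fix x u u' v' assume *: "x \<in> insert v S" "{u, x} \<in> edges G" "{u', v'} \<in> edges G" "(u, x) \<in> r'" "(u', x) \<in> r'"
        "v' \<noteq> x" "(v', x) \<notin> r'"
      show "w {u, x} \<le> w {u', v'}"
      proof (cases "x = v")
        case True
        then show ?thesis using * insert.hyps(3)[of u u' v'] r'_new by simp
      next
        case False
        then show ?thesis using * rS[rule_format, of x u u' v'] r'_old by simp
      qed
    qed
  qed
  from this[OF assms] obtain r where r: "r \<subseteq> verts G \<times> verts G" "strict_linear_order_on (verts G) r"
    "\<forall>v\<in>verts G. \<forall>u u' v'. {u, v} \<in> edges G \<longrightarrow> {u', v'} \<in> edges G \<longrightarrow> (u, v) \<in> r \<longrightarrow> (u', v) \<in> r \<longrightarrow>
        v' \<noteq> v \<longrightarrow> (v', v) \<notin> r \<longrightarrow> w {u, v} \<le> w {u', v'}" by blast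
  have asym: "y \<noteq> x \<and> (y, x) \<notin> r" if "(x, y) \<in> r" for x y
    using that r(2) unfolding strict_linear_order_on_def trans_def irrefl_def by blast
  have "layout1 G w r"
    unfolding layout1_def
  proof (intro conjI r(2) notI, elim exE conjE)
    fix u v u' v' assume *: "{u, v} \<in> edges G" "{u', v'} \<in> edges G" "w {u', v'} < w {u, v}"
      "(u, v) \<in> r" "(u', v) \<in> r" "(v, v') \<in> r"
    have "v \<in> verts G" using *(4) r(1) by blast
    then have "w {u, v} \<le> w {u', v'}" using r(3) * asym[OF *(6)] by blast
    then show False using *(3) by simp
  qed
  then show ?thesis ..
qed

text \<open>Once such a set is placed, nothing is open, and the next component starts
  afresh.\<close>

definition sealed :: "'a set set \<Rightarrow> 'a set \<Rightarrow> bool" where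
  "sealed E S \<longleftrightarrow> (\<forall>x\<in>S. \<forall>y. {x, y} \<in> E \<longrightarrow> y \<in> S)"

lemma sealedD: "sealed E S \<Longrightarrow> {x, y} \<in> E \<Longrightarrow> x \<in> S \<longleftrightarrow> y \<in> S"
  unfolding sealed_def by (metis insert_commute)

lemma sealed_Un: "sealed E S \<Longrightarrow> sealed E T \<Longrightarrow> sealed E (S \<union> T)"
  unfolding sealed_def by blast

text \<open>\<open>S0\<close> is a union of finished components. Besides heavy edges, of weight at least \<open>m\<close>, the
  edges leaving \<open>S\<close> all go to \<open>p\<close>, so that \<open>p\<close> can come next as soon as no heavy edge ends there.\<close>

definition aimed :: "'a set set \<Rightarrow> ('a set \<Rightarrow> real) \<Rightarrow> real \<Rightarrow> 'a set \<Rightarrow> 'a set \<Rightarrow> 'a \<Rightarrow> bool" where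
  "aimed E w m S0 S p \<longleftrightarrow> build E w S \<and> S0 \<subseteq> S \<and> p \<notin> S \<and> conn E (insert p (S - S0)) \<and>
     (\<forall>x\<in>S. \<forall>y. y \<notin> S \<longrightarrow> {x, y} \<in> E \<longrightarrow> y = p \<or> m \<le> w {x, y})"

lemma aimed_start:
  assumes "build E w S0" "sealed E S0" "p \<notin> S0"
  shows "aimed E w m S0 S0 p"
  using assms sealedD[OF assms(2)] unfolding aimed_def by auto

text \<open>No edge ends at \<open>l\<close>, so the queue condition at \<open>l\<close> is
  void.\<close>

lemma aimed_leaf:
  assumes a: "aimed E w m S0 S p" and l: "l \<notin> S" "l \<noteq> p" "{p, l} \<in> E" "\<And>x. x \<in> S \<Longrightarrow> {x, l} \<notin> E"
    "\<And>y. {l, y} \<in> E \<Longrightarrow> y \<notin> insert l S \<Longrightarrow> y = p \<or> m \<le> w {l, y}"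
  shows "aimed E w m S0 (insert l S) p"
proof -
  have b: "build E w (insert l S)"
    using a l unfolding aimed_def by (intro build.insert) auto
  have "insert p (insert l S - S0) = insert l (insert p (S - S0))"
    using a l(1) unfolding aimed_def by auto
  moreover have "conn E (insert l (insert p (S - S0)))"
    using a l(3) unfolding aimed_def by (intro conn_insert[of E "insert p (S - S0)" p l]) simp_all
  ultimately show ?thesis using a b l unfolding aimed_def by auto
qed

lemma aimed_leaves:
  assumes "finite Q" "aimed E w m S0 S p" "Q \<inter> S = {}" "p \<notin> Q" "\<And>l. l \<in> Q \<Longrightarrow> {p, l} \<in> E"
    "\<And>l y. l \<in> Q \<Longrightarrow> {l, y} \<in> E \<Longrightarrow> y = p \<or> y \<notin> S \<union> Q \<and> m \<le> w {l, y}"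
  shows "aimed E w m S0 (S \<union> Q) p"
  using assms
proof (induction Q)
  case (insert l Q)
  have "aimed E w m S0 (S \<union> Q) p" using insert.prems by (intro insert.IH) fastforce+
  moreover have "p \<notin> S" using insert.prems(1) unfolding aimed_def by blast
  moreover have "{x, l} \<notin> E" if "x \<in> S \<union> Q" for x
    using insert.prems(5)[of l x] insert.prems(3) that \<open>p \<notin> S\<close> by (auto simp: insert_commute)
  moreover have "y = p \<or> m \<le> w {l, y}" if "{l, y} \<in> E" for y using insert.prems(5)[of l y] that by auto
  ultimately have "aimed E w m S0 (insert l (S \<union> Q)) p"
    using insert.prems insert.hyps by (intro aimed_leaf) auto
  then show ?case by simp
qed simp

lemma aimed_close:
  assumes a: "aimed E w m S0 S p" and into: "\<And>x. x \<in> S \<Longrightarrow> {x, p} \<in> E \<Longrightarrow> w {x, p} \<le> m"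
  shows "build E w (insert p S)" "S0 \<subseteq> insert p S" "conn E (insert p S - S0)"
proof -
  show "build E w (insert p S)"
  proof (rule build.insert)
    show "build E w S" "p \<notin> S" using a unfolding aimed_def by auto
    fix u u' v' assume *: "u \<in> S" "{u, p} \<in> E" "u' \<in> S" "v' \<notin> S" "v' \<noteq> p" "{u', v'} \<in> E"
    have "m \<le> w {u', v'}" using a * unfolding aimed_def by blast
    then show "w {u, p} \<le> w {u', v'}" using into[OF *(1,2)] by linarith
  qed
  have "insert p S - S0 = insert p (S - S0)" using a unfolding aimed_def by auto
  then show "S0 \<subseteq> insert p S" "conn E (insert p S - S0)" using a unfolding aimed_def by auto
qed

text \<open>Placing \<open>p\<close> opens, besides heavy edges, only an edge to \<open>q\<close>,
  which becomes the new target.\<close>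

lemma aimed_move:
  assumes a: "aimed E w m S0 S p" and q: "q \<notin> S" "q \<noteq> p" "{p, q} \<in> E"
    and into: "\<And>x. x \<in> S \<Longrightarrow> {x, p} \<in> E \<Longrightarrow> w {x, p} \<le> m"
    and out: "\<And>y. y \<notin> S \<Longrightarrow> {p, y} \<in> E \<Longrightarrow> y = q \<or> m \<le> w {p, y}"
  shows "aimed E w m S0 (insert p S) q"
proof -
  note c = aimed_close[OF a into]
  have "p \<in> insert p S - S0" using a unfolding aimed_def by auto
  then have "conn E (insert q (insert p S - S0))" using c(3) q(3) by (intro conn_insert) auto
  then show ?thesis using a c q out unfolding aimed_def by auto
qed

lemma conn_within:
  assumes "conn E X" "\<And>e. e \<in> E \<Longrightarrow> e \<subseteq> X \<Longrightarrow> e \<in> E'"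
  shows "conn E' X"
proof (rule connI)
  show "X \<noteq> {}" using conn_ne[OF assms(1)] .
  fix A assume A: "A \<subseteq> X" "A \<noteq> {}" "X - A \<noteq> {}"
  obtain x y where xy: "x \<in> A" "y \<in> X - A" "{x, y} \<in> E" using conn_cut[OF assms(1) A] by (rule adjacentE)
  then show "adjacent E' A (X - A)" using assms(2)[of "{x, y}"] A by (intro adjacentI) auto
qed

text \<open>Lying on a cycle, expressed without cycles: the ends stay connected after the edge is
  removed.\<close>

definition nonbridge :: "'a set set \<Rightarrow> 'a \<Rightarrow> 'a \<Rightarrow> bool" where
  "nonbridge E x y \<longleftrightarrow> {x, y} \<in> E \<and> (\<exists>X. conn (E - {{x, y}}) X \<and> x \<in> X \<and> y \<in> X)"

lemma nonbridge_sym: "nonbridge E x y \<longleftrightarrow> nonbridge E y x"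
  unfolding nonbridge_def by (metis insert_commute)

text \<open>Prim's algorithm: each new vertex is attached by a single edge, the lightest one available.\<close>

lemma build_prim:
  assumes E: "finite E" and S0: "sealed E S0" and K: "conn E K" "finite K" "K \<inter> S0 = {}" "sealed E K"
    and S: "build E w S" "S0 \<subseteq> S" "S - S0 \<subseteq> K" "conn E (S - S0)"
    and br: "\<And>x y. x \<in> K \<Longrightarrow> nonbridge E x y \<Longrightarrow> {x, y} \<subseteq> S"
  shows "build E w (S0 \<union> K)"
  using S br
proof (induction "card (K - S)" arbitrary: S rule: less_induct)
  case less
  let ?T = "S - S0"
  show ?case
  proof (cases "K - ?T = {}")
    case True
    then have "S = S0 \<union> K" using less.prems(2,3) by blast
    then show ?thesis using less.prems(1) by simp
  next
    case False
    define C where "C = {e\<in>E. \<exists>x\<in>S. \<exists>y. y \<notin> S \<and> e = {x, y}}"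
    have "adjacent E ?T (K - ?T)" using conn_cut[OF K(1) less.prems(3) conn_ne[OF less.prems(4)] False] .
    then obtain x0 y0 where "x0 \<in> ?T" "y0 \<in> K - ?T" "{x0, y0} \<in> E" by (rule adjacentE)
    then have "{x0, y0} \<in> C" unfolding C_def using K(3) by blast
    then have "finite C" "C \<noteq> {}" unfolding C_def using E by auto
    then obtain e where e: "e \<in> C" "\<And>f. f \<in> C \<Longrightarrow> w e \<le> w f" using arg_min_if_finite[of C w] by (metis not_le)
    then obtain x y where xy: "x \<in> S" "y \<notin> S" "{x, y} \<in> E" "e = {x, y}" unfolding C_def by blast
    have xT: "x \<in> ?T" using xy sealedD[OF S0 xy(3)] less.prems(2) by blast
    then have yK: "y \<in> K" using less.prems(3) sealedD[OF K(4) xy(3)] by blast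
    \<comment> \<open>A second edge into \<open>y\<close> would put \<open>{x, y}\<close> on a
      cycle, because \<open>S - S0\<close> is connected without \<open>y\<close>; but all edges on
      cycles of \<open>K\<close> have both ends in \<open>S\<close>.\<close>
    have only: "u = x" if u: "u \<in> S" "{u, y} \<in> E" for u
    proof (rule ccontr)
      assume "u \<noteq> x"
      have uT: "u \<in> ?T" using u sealedD[OF S0 u(2)] xy(2) less.prems(2) by blast
      have "conn (E - {{x, y}}) ?T" using xy(2) by (intro conn_within[OF less.prems(4)]) auto
      moreover have "{u, y} \<in> E - {{x, y}}" using u \<open>u \<noteq> x\<close> by (auto simp: doubleton_eq_iff)
      ultimately have "conn (E - {{x, y}}) (insert y ?T)" using uT by (intro conn_insert)
      then have "nonbridge E x y" unfolding nonbridge_def using xy(3) xT by blast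
      then show False using less.prems(5)[of x y] less.prems(3) xT xy(2) by auto
    qed
    have "build E w (insert y S)"
    proof (rule build.insert[OF less.prems(1) xy(2)])
      fix u u' v' assume *: "u \<in> S" "{u, y} \<in> E" "u' \<in> S" "v' \<notin> S" "v' \<noteq> y" "{u', v'} \<in> E"
      have "{u', v'} \<in> C" unfolding C_def using *(3,4,6) by blast
      then show "w {u, y} \<le> w {u', v'}" using e(2) only[OF *(1,2)] xy(4) by simp
    qed
    moreover have "y \<notin> S0" using yK K(3) by blast
    then have T': "insert y S - S0 = insert y ?T" by auto
    moreover have "conn E (insert y ?T)" using less.prems(4) xT xy(3) by (intro conn_insert)
    moreover have "card (K - insert y S) < card (K - S)"
      using yK xy(2) K(2) by (intro psubset_card_mono) auto
    ultimately show ?thesis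
      using less.prems yK by (intro less.hyps[of "insert y S"]) auto
  qed
qed

section \<open>Hanging trees\<close>

definition component :: "'a set set \<Rightarrow> 'a \<Rightarrow> 'a set" where
  "component L x = \<Union>{X. conn L X \<and> x \<in> X}"

lemma component_self: "x \<in> component L x"
  unfolding component_def by (rule UnionI[of "{x}"]) auto

lemma component_superset: "conn L X \<Longrightarrow> x \<in> X \<Longrightarrow> X \<subseteq> component L x"
  unfolding component_def by blast

lemma component_conn: "conn L (component L x)"
proof (rule connI)
  show "component L x \<noteq> {}" using component_self[of x L] by auto
  fix A assume A: "A \<subseteq> component L x" "A \<noteq> {}" "component L x - A \<noteq> {}"
  let ?B = "component L x - A"
  obtain y where y: "y \<in> component L x" "x \<in> A \<longleftrightarrow> y \<notin> A" using A by blast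
  then obtain X where X: "conn L X" "x \<in> X" "y \<in> X" unfolding component_def by blast
  have "adjacent L (A \<inter> X) (X - A \<inter> X)" using X y(2) by (intro conn_cut) auto
  then show "adjacent L A ?B"
    using component_superset[OF X(1,2)] by (elim adjacent_mono) auto
qed

lemma component_step: "y \<in> component L x \<Longrightarrow> {y, z} \<in> L \<Longrightarrow> z \<in> component L x"
  using component_superset[OF conn_insert[OF component_conn], of y L x z x] component_self by fastforce

lemma component_subset:
  assumes "x \<in> V" "\<And>y z. y \<in> V \<Longrightarrow> {y, z} \<in> L \<Longrightarrow> z \<in> V"
  shows "component L x \<subseteq> V"
proof
  fix y assume y: "y \<in> component L x"
  show "y \<in> V"
  proof (rule ccontr)
    assume n: "y \<notin> V"
    have "adjacent L (component L x \<inter> V) (component L x - component L x \<inter> V)"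
      using assms(1) component_self[of x L] y n by (intro conn_cut[OF component_conn]) auto
    then show False using assms(2) by (auto elim!: adjacentE)
  qed
qed

text \<open>Two legs of length two on a connected part around the root; together with a cycle
  through \<open>x\<close> this is \<open>F4\<close>.\<close>

definition spider :: "'a set set \<Rightarrow> 'a \<Rightarrow> bool" where
  "spider L x \<longleftrightarrow> (\<exists>A s t s' t'. conn L A \<and> x \<in> A \<and> A \<subseteq> component L x \<and>
     {s, t, s', t'} \<subseteq> component L x - A \<and> distinct [s, t, s', t'] \<and>
     adjacent L A {s} \<and> {s, t} \<in> L \<and> adjacent L A {s'} \<and> {s', t'} \<in> L)"

lemma hanging_tree:
  assumes "finite L" "L \<subseteq> E" "\<And>e. e \<in> E \<Longrightarrow> card e = 2" "\<And>a b. \<not> nonbridge L a b" "\<And>e. e \<in> L \<Longrightarrow> w e \<le> m"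
    and S0: "build E w S0" "sealed E S0" "x \<notin> S0" "finite (component L x)"
    and out: "\<And>y z. y \<in> component L x \<Longrightarrow> y \<noteq> x \<Longrightarrow> {y, z} \<in> E \<Longrightarrow>
       {y, z} \<in> L \<or> m \<le> w {y, z} \<and> z \<notin> component L x"
  shows "aimed E w m S0 (S0 \<union> (component L x - {x})) x \<or> spider L x"
  using assms(1,2,4,5) S0(3,4) out
proof (induction "card L" arbitrary: L x rule: less_induct)
  case less
  let ?K = "component L x"
  note L = less.prems(2) and forest = less.prems(3) and light = less.prems(4) and out = less.prems(7)
  have ne: "a \<noteq> b" if "{a, b} \<in> E" for a b using assms(3)[OF that] by auto
  define Ch where "Ch = {y. {x, y} \<in> L}"
  have ChK: "Ch \<subseteq> ?K" unfolding Ch_def using component_step[OF component_self, of x _ L] by auto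
  then have fCh: "finite Ch" using less.prems(6) finite_subset by blast
  have xCh: "x \<notin> Ch" unfolding Ch_def using ne L by blast
  have KS0: "?K \<inter> S0 = {}"
  proof -
    have "?K \<subseteq> - S0" using less.prems(5) sealedD[OF S0(2)] L by (intro component_subset) auto
    then show ?thesis by blast
  qed
  define deep where "deep y \<longleftrightarrow> (\<exists>z. z \<noteq> x \<and> {y, z} \<in> L)" for y
  have no_path: "\<not> (conn (L - {{a, b}}) X \<and> a \<in> X \<and> b \<in> X)" if "{a, b} \<in> L" for a b X
    using forest[of a b] that unfolding nonbridge_def by blast
  have leaf: "y = x \<or> m \<le> w {l, y} \<and> y \<notin> ?K" if l: "l \<in> Ch" "\<not> deep l" "{l, y} \<in> E" for l y
  proof -
    have "{l, y} \<in> L \<or> m \<le> w {l, y} \<and> y \<notin> ?K" using l ChK xCh by (intro out) auto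
    then show ?thesis using l(2) unfolding deep_def by blast
  qed
  consider y1 y2 where "y1 \<in> Ch" "y2 \<in> Ch" "y1 \<noteq> y2" "deep y1" "deep y2"
    | y where "y \<in> Ch" "deep y" "\<forall>l\<in>Ch - {y}. \<not> deep l" | "\<forall>l\<in>Ch. \<not> deep l" by blast
  then show ?case
  proof cases
    case (1 y1 y2)
    then obtain z1 z2 where z: "z1 \<noteq> x" "{y1, z1} \<in> L" "z2 \<noteq> x" "{y2, z2} \<in> L" unfolding deep_def by blast
    have xy: "{x, y1} \<in> L" "{x, y2} \<in> L" using 1 unfolding Ch_def by auto
    have n: "x \<noteq> y1" "x \<noteq> y2" "y1 \<noteq> z1" "y2 \<noteq> z2" using xy z ne L by blast+
    let ?L = "L - {{x, y1}}"
    have L2: "{x, y2} \<in> ?L" using xy 1(3) n by (auto simp: doubleton_eq_iff)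
    \<comment> \<open>Any coincidence between the two legs would close a cycle through
      \<open>{x, y1}\<close>, which the forest \<open>L\<close> excludes.\<close>
    have "z1 \<noteq> y2"
    proof
      assume "z1 = y2"
      then have "{y2, y1} \<in> ?L" using z(2) n 1(3) by (auto simp: doubleton_eq_iff insert_commute)
      then have "conn ?L (insert y1 {x, y2})" by (intro conn_insert[OF conn_edge[OF L2], of y2 y1]) simp_all
      then show False using no_path[OF xy(1)] by blast
    qed
    moreover have "z2 \<noteq> y1"
    proof
      assume "z2 = y1"
      then have "{y2, y1} \<in> ?L" using z(4) n 1(3) by (auto simp: doubleton_eq_iff insert_commute)
      then have "conn ?L (insert y1 {x, y2})" by (intro conn_insert[OF conn_edge[OF L2], of y2 y1]) simp_all
      then show False using no_path[OF xy(1)] by blast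
    qed
    moreover have "z1 \<noteq> z2"
    proof
      assume "z1 = z2"
      then have e: "{y2, z2} \<in> ?L" "{z2, y1} \<in> ?L" using z n 1(3) by (auto simp: doubleton_eq_iff insert_commute)
      have "conn ?L (insert z2 {x, y2})" by (rule conn_insert[OF conn_edge[OF L2] _ e(1)]) simp
      then have "conn ?L (insert y1 (insert z2 {x, y2}))" by (rule conn_insert[OF _ _ e(2)]) simp
      then show False using no_path[OF xy(1)] by blast
    qed
    ultimately have "distinct [y1, z1, y2, z2]" using n 1(3) by auto
    moreover have "{y1, z1, y2, z2} \<subseteq> ?K - {x}"
      using ChK 1(1,2) z n component_step[of _ L x] by auto
    ultimately have "spider L x"
      unfolding spider_def using z xy component_self[of x L]
      by (intro exI[of _ "{x}"] exI[of _ y1] exI[of _ z1] exI[of _ y2] exI[of _ z2]) (simp add: adjacent_def)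
    then show ?thesis ..
  next
    case 3
    have "?K \<subseteq> insert x Ch"
    proof (rule component_subset)
      fix y z assume "y \<in> insert x Ch" "{y, z} \<in> L"
      then show "z \<in> insert x Ch" using 3 unfolding deep_def Ch_def by blast
    qed simp
    then have K: "?K - {x} = Ch" using ChK xCh by blast
    have "aimed E w m S0 (S0 \<union> Ch) x"
    proof (rule aimed_leaves[OF fCh aimed_start[OF S0(1,2) less.prems(5)]])
      show "Ch \<inter> S0 = {}" using ChK KS0 by blast
      show "x \<notin> Ch" by (rule xCh)
      show "{x, l} \<in> E" if "l \<in> Ch" for l using that L unfolding Ch_def by blast
      fix l y assume l: "l \<in> Ch" "{l, y} \<in> E"
      moreover have "y \<notin> S0" using l sealedD[OF S0(2) l(2)] ChK KS0 by blast
      ultimately show "y = x \<or> y \<notin> S0 \<union> Ch \<and> m \<le> w {l, y}" using leaf[OF l(1) _ l(2)] 3 ChK by blast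
    qed
    then show ?thesis unfolding K by blast
  next
    case (2 y)
    define L' where "L' = {e\<in>L. x \<notin> e}"
    let ?K' = "component L' y"
    have "{x, y} \<in> L" using 2(1) unfolding Ch_def by simp
    then have xy: "{x, y} \<in> L" "{x, y} \<in> E" "x \<noteq> y" using L ne[of x y] by blast+
    have L'L: "L' \<subseteq> L" unfolding L'_def by auto
    have "{x, y} \<notin> L'" unfolding L'_def by simp
    then have "L' \<subset> L" using xy(1) L'L by blast
    then have card: "card L' < card L" using less.prems(1) by (intro psubset_card_mono)
    have xK': "x \<notin> ?K'"
    proof -
      have "?K' \<subseteq> - {x}" using xy(3) unfolding L'_def by (intro component_subset) auto
      then show ?thesis by blast
    qed
    have K'K: "?K' \<subseteq> ?K"
      using component_step[of _ L x] ChK 2(1) L'L by (intro component_subset) auto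
    have ChK': "l = y" if l: "l \<in> Ch" "l \<in> ?K'" for l
    proof (rule ccontr)
      assume "l \<noteq> y"
      have sub: "L' \<subseteq> L - {{x, l}}" unfolding L'_def by auto
      have "{y, x} \<in> L - {{x, l}}" using xy \<open>l \<noteq> y\<close> by (auto simp: doubleton_eq_iff insert_commute)
      then have "conn (L - {{x, l}}) (insert x ?K')"
        by (rule conn_insert[OF conn_mono[OF component_conn sub] component_self])
      then show False using no_path[of x l] l unfolding Ch_def by blast
    qed
    have K: "?K = insert x (Ch \<union> ?K')"
    proof
      show "?K \<subseteq> insert x (Ch \<union> ?K')"
      proof (rule component_subset)
        fix a b assume ab: "a \<in> insert x (Ch \<union> ?K')" "{a, b} \<in> L"
        show "b \<in> insert x (Ch \<union> ?K')"
        proof (cases "a \<in> ?K' \<and> b \<noteq> x")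
          case True
          then have "{a, b} \<in> L'" using ab(2) xK' unfolding L'_def by auto
          then show ?thesis using True component_step[of a L' y b] by blast
        next
          case False
          then have "b = x \<or> a = x \<or> a \<in> Ch - {y}" using ab(1) component_self[of y L'] by blast
          then show ?thesis using ab(2) 2(3) unfolding deep_def Ch_def by blast
        qed
      qed simp
      show "insert x (Ch \<union> ?K') \<subseteq> ?K" using component_self[of x L] ChK K'K by blast
    qed
    have out': "{v, z} \<in> L' \<or> m \<le> w {v, z} \<and> z \<notin> ?K'" if v: "v \<in> ?K'" "v \<noteq> y" "{v, z} \<in> E" for v z
    proof -
      have vx: "v \<noteq> x" using v xK' by blast
      then have "{v, z} \<in> L \<or> m \<le> w {v, z} \<and> z \<notin> ?K" using v K'K by (intro out) auto
      moreover have "z \<noteq> x" if "{v, z} \<in> L"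
      proof
        assume "z = x"
        then have "v \<in> Ch" using that unfolding Ch_def by (simp add: insert_commute)
        then show False using ChK' v(1,2) by blast
      qed
      ultimately show ?thesis using vx K'K unfolding L'_def by auto
    qed
    have yS0: "y \<notin> S0" using 2(1) ChK KS0 by blast
    have forest': "\<not> nonbridge L' a b" for a b
    proof
      assume "nonbridge L' a b"
      then obtain X where X: "{a, b} \<in> L'" "conn (L' - {{a, b}}) X" "a \<in> X" "b \<in> X" unfolding nonbridge_def by blast
      have "conn (L - {{a, b}}) X" using X(2) L'L by (intro conn_mono[OF X(2)]) auto
      then show False using no_path[of a b X] X L'L by blast
    qed
    have fin': "finite L'" "L' \<subseteq> E" using less.prems(1) L L'L finite_subset by blast+
    have fK': "finite ?K'" using K'K less.prems(6) finite_subset by blast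
    have IH: "aimed E w m S0 (S0 \<union> (?K' - {y})) y \<or> spider L' y"
      by (rule less.hyps[OF card fin' forest' _ yS0 fK' out']) (use light L'L in auto)
    then show ?thesis
    proof
      assume "spider L' y"
      then obtain A s t s' t' where sp: "conn L' A" "y \<in> A" "A \<subseteq> ?K'" "{s, t, s', t'} \<subseteq> ?K' - A"
        "distinct [s, t, s', t']" "adjacent L' A {s}" "{s, t} \<in> L'" "adjacent L' A {s'}" "{s', t'} \<in> L'"
        unfolding spider_def by (elim exE conjE)
      have c: "conn L (insert x A)"
        using conn_mono[OF sp(1) L'L] sp(2) xy(1) by (intro conn_insert[of _ _ y]) (auto simp: insert_commute)
      have a: "adjacent L (insert x A) {s}" "adjacent L (insert x A) {s'}"
        using adjacent_mono[OF sp(6) L'L subset_insertI order_refl]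
          adjacent_mono[OF sp(8) L'L subset_insertI order_refl] by simp_all
      have "insert x A \<subseteq> ?K" "{s, t, s', t'} \<subseteq> ?K - insert x A" using sp(3,4) K'K component_self[of x L] xK' by auto
      moreover have "{s, t} \<in> L" "{s', t'} \<in> L" using sp(7,9) L'L by blast+
      ultimately have "spider L x" unfolding spider_def using c a sp(5)
        by (intro exI[of _ "insert x A"] exI[of _ s] exI[of _ t] exI[of _ s'] exI[of _ t']) simp
      then show ?thesis ..
    next
      assume a: "aimed E w m S0 (S0 \<union> (?K' - {y})) y"
      have "aimed E w m S0 (insert y (S0 \<union> (?K' - {y}))) x"
      proof (rule aimed_move[OF a])
        show "x \<notin> S0 \<union> (?K' - {y})" using less.prems(5) xK' by blast
        show "x \<noteq> y" "{y, x} \<in> E" using xy by (simp_all add: insert_commute)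
      next
        fix v assume v: "v \<in> S0 \<union> (?K' - {y})" "{v, y} \<in> E"
        then have "v \<notin> S0" using sealedD[OF S0(2) v(2)] yS0 by blast
        then have "{v, y} \<in> L' \<or> m \<le> w {v, y} \<and> y \<notin> ?K'" using v by (intro out') auto
        then have "{v, y} \<in> L" using component_self[of y L'] L'L by blast
        then show "w {v, y} \<le> m" by (rule light)
      next
        fix z assume z: "z \<notin> S0 \<union> (?K' - {y})" "{y, z} \<in> E"
        have "{y, z} \<in> L \<or> m \<le> w {y, z} \<and> z \<notin> ?K" using z 2(1) ChK xy(3) by (intro out) auto
        moreover have "z = x" if "{y, z} \<in> L"
        proof (rule ccontr)
          assume "z \<noteq> x"
          then have "{y, z} \<in> L'" using that xy(3) unfolding L'_def by auto
          then have "z \<in> ?K'" using component_step[OF component_self, of y z L'] by simp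
          then show False using z ne[OF z(2)] by blast
        qed
        ultimately show "z = x \<or> m \<le> w {y, z}" by blast
      qed
      also have "insert y (S0 \<union> (?K' - {y})) = S0 \<union> ?K'" using component_self[of y L'] by blast
      finally have a': "aimed E w m S0 (S0 \<union> ?K') x" .
      have "aimed E w m S0 (S0 \<union> ?K' \<union> (Ch - {y})) x"
      proof (rule aimed_leaves[OF _ a'])
        show "finite (Ch - {y})" using fCh by blast
        show "(Ch - {y}) \<inter> (S0 \<union> ?K') = {}" using ChK KS0 ChK' by blast
        show "x \<notin> Ch - {y}" using xCh by blast
        show "{x, l} \<in> E" if "l \<in> Ch - {y}" for l using that L unfolding Ch_def by blast
        fix l z assume l: "l \<in> Ch - {y}" "{l, z} \<in> E"
        moreover have "z \<notin> S0" using l sealedD[OF S0(2) l(2)] ChK KS0 by blast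
        ultimately show "z = x \<or> z \<notin> S0 \<union> ?K' \<union> (Ch - {y}) \<and> m \<le> w {l, z}"
          using leaf[of l z] 2(3) ChK K'K by blast
      qed
      also have "S0 \<union> ?K' \<union> (Ch - {y}) = S0 \<union> (?K - {x})"
        unfolding K using xCh xK' component_self[of y L'] by blast
      finally show ?thesis ..
    qed
  qed
qed

section \<open>Components with a single cycle\<close>

lemma conn_path:
  assumes X: "conn E X" "x \<in> X" "y \<in> X"
  obtains xs where "xs \<noteq> []" "distinct xs" "hd xs = x" "last xs = y" "set xs \<subseteq> X"
    "successively (\<lambda>a b. {a, b} \<in> E) xs"
proof -
  let ?path = "\<lambda>z xs. xs \<noteq> [] \<and> distinct xs \<and> hd xs = x \<and> last xs = z \<and> set xs \<subseteq> X \<and>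
    successively (\<lambda>a b. {a, b} \<in> E) xs"
  define R where "R = {z\<in>X. \<exists>xs. ?path z xs}"
  have xR: "x \<in> R" unfolding R_def using X(2) by (auto intro!: exI[of _ "[x]"])
  have "X - R = {}"
  proof (rule ccontr)
    assume "X - R \<noteq> {}"
    then have "adjacent E R (X - R)" using xR by (intro conn_cut[OF X(1)]) (auto simp: R_def)
    then obtain z z' where z: "z \<in> R" "z' \<in> X" "z' \<notin> R" "{z, z'} \<in> E" by (auto elim!: adjacentE)
    then obtain xs where xs: "?path z xs" unfolding R_def by blast
    have "\<exists>ys. ?path z' ys"
    proof (cases "z' \<in> set xs")
      case True
      then obtain as bs where as: "xs = as @ z' # bs" by (meson split_list)
      then have "successively (\<lambda>a b. {a, b} \<in> E) ((as @ [z']) @ bs)" using xs by simp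
      then have "successively (\<lambda>a b. {a, b} \<in> E) (as @ [z'])"
        unfolding successively_append_iff[of _ "as @ [z']"] by blast
      moreover have "hd (as @ [z']) = x" using xs as by (cases as) auto
      ultimately have "?path z' (as @ [z'])" using xs as by auto
      then show ?thesis ..
    next
      case False
      then have "?path z' (xs @ [z'])" using xs z by (auto simp: successively_append_iff)
      then show ?thesis ..
    qed
    then show False using z(2,3) unfolding R_def by blast
  qed
  then have "y \<in> R" using X(3) by blast
  then show ?thesis using that unfolding R_def by blast
qed

lemma path_conn: "xs \<noteq> [] \<Longrightarrow> successively (\<lambda>a b. {a, b} \<in> E) xs \<Longrightarrow> conn E (set xs)"
proof (induction xs)
  case (Cons x xs)
  show ?case
  proof (cases "xs = []")
    case False
    then have "{x, hd xs} \<in> E" "conn E (set xs)" using Cons by (auto simp: successively_Cons)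
    then show ?thesis using conn_insert[of E "set xs" "hd xs" x] False by (simp add: insert_commute)
  qed simp
qed simp

text \<open>The edges lost in \<open>E'\<close> all lie inside \<open>C\<close>, which is still
  connected. So a cut of \<open>X \<union> C\<close> either cuts \<open>C\<close> or is crossed by a
  surviving edge. This reroutes a connected set along a cycle.\<close>

lemma conn_replace:
  assumes X: "conn E X" and C: "conn E' C" and "X \<inter> C \<noteq> {}" and e: "\<And>e. e \<in> E \<Longrightarrow> e \<subseteq> C \<or> e \<in> E'"
  shows "conn E' (X \<union> C)"
proof (rule connI)
  show "X \<union> C \<noteq> {}" using conn_ne[OF C] by blast
  have half: "adjacent E' A (X \<union> C - A)" if A: "C \<subseteq> A" "A \<subseteq> X \<union> C" "X \<union> C - A \<noteq> {}" for A
  proof -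
    have "adjacent E (A \<inter> X) (X - A \<inter> X)" using A assms(3) by (intro conn_cut[OF X]) auto
    then obtain p q where "p \<in> A" "q \<in> X - A" "{p, q} \<in> E" by (auto elim!: adjacentE)
    moreover from this have "{p, q} \<in> E'" using e[of "{p, q}"] A(1) by auto
    ultimately show ?thesis by (intro adjacentI[of p q]) auto
  qed
  fix A assume A: "A \<subseteq> X \<union> C" "A \<noteq> {}" "X \<union> C - A \<noteq> {}"
  consider "C \<subseteq> A" | "C \<subseteq> X \<union> C - A" | "A \<inter> C \<noteq> {}" "C - A \<noteq> {}" by blast
  then show "adjacent E' A (X \<union> C - A)"
  proof cases
    case 1
    then show ?thesis using half A by blast
  next
    case 2
    have "X \<union> C - (X \<union> C - A) = A" using A(1) by blast
    then have "adjacent E' (X \<union> C - A) A" using half[OF 2] A(2) by simp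
    then show ?thesis by (simp add: adjacent_sym)
  next
    case 3
    then have "adjacent E' (A \<inter> C) (C - A \<inter> C)" by (intro conn_cut[OF C]) auto
    then show ?thesis by (elim adjacent_mono) auto
  qed
qed

definition bridges :: "'a set set \<Rightarrow> 'a set set" where
  "bridges E = {f\<in>E. \<forall>x y. f = {x, y} \<longrightarrow> \<not> nonbridge E x y}"

lemma bridges_sub: "bridges E \<subseteq> E"
  unfolding bridges_def by blast

lemma bridges_iff: "{x, y} \<in> bridges E \<longleftrightarrow> {x, y} \<in> E \<and> \<not> nonbridge E x y"
  unfolding bridges_def by (auto simp: doubleton_eq_iff nonbridge_sym)

lemma no_bridge_cycle:
  assumes "conn (E - {{x, y}}) X" "x \<in> X" "y \<in> X"
  shows "{x, y} \<notin> bridges E"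
  using assms unfolding bridges_iff nonbridge_def by blast

text \<open>The vertices of the cycle are \<open>c 0, \<dots>, c (n - 1)\<close>, continued periodically.\<close>

locale unicyclic =
  fixes G :: "'a graph" and w :: "'a set \<Rightarrow> real" and K S0 :: "'a set"
    and c :: "nat \<Rightarrow> 'a" and n :: nat and m :: real
  assumes free: "minor_free G"
    and K: "conn (edges G) K" "K \<subseteq> verts G" "sealed (edges G) K"
    and S0: "build (edges G) w S0" "sealed (edges G) S0" "K \<inter> S0 = {}"
    and n: "3 \<le> n" and period: "\<And>i. c (i + n) = c i" and inj: "inj_on c {..<n}"
    and edge: "\<And>i. {c i, c (Suc i)} \<in> edges G" and c0: "c 0 \<in> K"
    and unique: "\<And>x y u v. x \<in> K \<Longrightarrow> u \<in> K \<Longrightarrow> nonbridge (edges G) x y \<Longrightarrow>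
      \<not> nonbridge (edges G - {{x, y}}) u v"
    and heavy: "\<And>i. w {c i, c (Suc i)} \<le> m"
begin

abbreviation "E \<equiv> edges G"
abbreviation "V \<equiv> verts G"
abbreviation "C \<equiv> range c"
abbreviation "Br \<equiv> bridges E"

lemma simple: "simple_graph G"
  using minor_freeD(1)[OF free] .

lemma E_card: "e \<in> E \<Longrightarrow> card e = 2"
  using simple unfolding simple_graph_def by blast

lemma E_ne: "{x, y} \<in> E \<Longrightarrow> x \<noteq> y"
  using E_card by fastforce

lemma finK: "finite K"
  using K(2) simple_graph_finite[OF simple] finite_subset by blast

lemma c_mod: "c i = c (i mod n)"
proof -
  have "c (j + k * n) = c j" for j k
  proof (induction k)
    case (Suc k)
    then show ?case using period[of "j + k * n"] by (simp add: ac_simps)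
  qed simp
  from this[of "i mod n" "i div n"] show ?thesis by simp
qed

lemma c_eq: "c i = c j \<longleftrightarrow> i mod n = j mod n"
proof
  assume "c i = c j"
  then have "c (i mod n) = c (j mod n)" using c_mod by metis
  then show "i mod n = j mod n" using inj n by (auto dest!: inj_onD)
qed (metis c_mod)

lemma c_neq: "i < j \<Longrightarrow> j < i + n \<Longrightarrow> c i \<noteq> c j"
proof
  assume ij: "i < j" "j < i + n" "c i = c j"
  then have "n dvd j - i" using c_eq mod_eq_dvd_iff_nat[of i j n] by auto
  then show False using ij by (auto dest!: dvd_imp_le)
qed

lemma inj_arc: "inj_on c {a..<a + n}"
proof (rule linorder_inj_onI')
  fix i j assume "i \<in> {a..<a + n}" "j \<in> {a..<a + n}" "i < j"
  then show "c i \<noteq> c j" by (intro c_neq) auto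
qed

lemma c_arc: "C = c ` {a..<a + n}"
proof -
  have *: "c (a + k) \<in> c ` {a..<a + n}" for k
  proof (induction k)
    case 0
    then show ?case using n by auto
  next
    case (Suc k)
    then obtain j where j: "j \<in> {a..<a + n}" "c (a + k) = c j" by auto
    then have "(a + k) mod n = j mod n" using c_eq by blast
    then have "Suc (a + k) mod n = Suc j mod n" by (metis mod_Suc_eq)
    then have e: "c (a + Suc k) = c (Suc j)" using c_eq by simp
    show ?case
    proof (cases "Suc j < a + n")
      case True
      then show ?thesis unfolding e using j(1) by auto
    next
      case False
      then have "Suc j = a + n" using j(1) by auto
      then show ?thesis unfolding e using period[of a] n by auto
    qed
  qed
  have "c i \<in> c ` {a..<a + n}" for i
  proof -
    have "c i = c (i + a * n)" using c_eq by simp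
    also have "i + a * n = a + (i + a * n - a)" using n by (simp add: trans_le_add2)
    finally show ?thesis using *[of "i + a * n - a"] by simp
  qed
  then show ?thesis by auto
qed

lemma arc_conn:
  assumes "a \<le> b" "\<And>j. a \<le> j \<Longrightarrow> j < b \<Longrightarrow> {c j, c (Suc j)} \<in> E'"
  shows "conn E' (c ` {a..b})"
  using assms
proof (induction b rule: dec_induct)
  case (step k)
  have "conn E' (insert (c (Suc k)) (c ` {a..k}))"
    using step by (intro conn_insert[of _ _ "c k"]) auto
  moreover have "insert (c (Suc k)) (c ` {a..k}) = c ` {a..Suc k}"
    using step(1) by (auto simp: atLeastAtMostSuc_conv)
  ultimately show ?case by simp
qed simp

lemma cycle_edge_ne:
  assumes "i < j" "j < i + n"
  shows "{c j, c (Suc j)} \<noteq> {c i, c (Suc i)}"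
proof
  assume "{c j, c (Suc j)} = {c i, c (Suc i)}"
  then have *: "c j = c i \<and> c (Suc j) = c (Suc i) \<or> c j = c (Suc i) \<and> c (Suc j) = c i"
    by (auto simp: doubleton_eq_iff)
  have "c j \<noteq> c i" using c_neq[OF assms] by simp
  then have 1: "c j = c (Suc i)" "c (Suc j) = c i" using * by auto
  have "j = Suc i" using c_neq[of "Suc i" j] 1 assms by (cases "j = Suc i") auto
  \<comment> \<open>Here \<open>Suc j = i + 2\<close>, which is not congruent to \<open>i\<close>
    because \<open>n\<close> is at least 3.\<close>
  then show False using c_neq[of i "Suc j"] 1 n by simp
qed

lemma cycle_conn: "conn (E - {{c i, c (Suc i)}}) C"
proof -
  have "conn (E - {{c i, c (Suc i)}}) (c ` {Suc i..i + n})"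
    using n edge cycle_edge_ne[of i] by (intro arc_conn) auto
  moreover have "{Suc i..i + n} = {Suc i..<Suc i + n}" by auto
  ultimately show ?thesis using c_arc[of "Suc i"] by simp
qed

lemma cycle_conn': "conn E C"
  using conn_mono[OF cycle_conn] by blast

lemma c_nonbridge: "nonbridge E (c i) (c (Suc i))"
  unfolding nonbridge_def using edge cycle_conn by blast

lemma c_in_K: "c i \<in> K"
proof (induction i)
  case (Suc i)
  then show ?case using sealedD[OF K(3) edge[of i]] by simp
qed (rule c0)

text \<open>An edge on some other cycle would still be on a cycle after removing
  \<open>{c 0, c (Suc 0)}\<close>, as the set connecting its ends can be rerouted along the rest of
  the cycle. That contradicts \<open>unique\<close>, which is how the locale says that there is a
  single cycle.\<close>

lemma nonbridge_cycle:
  assumes "nonbridge E x y" "x \<in> K"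
  shows "\<exists>i. {x, y} = {c i, c (Suc i)}"
proof (rule ccontr)
  assume nc: "\<not> ?thesis"
  let ?e = "{c 0, c (Suc 0)}"
  obtain X where X: "{x, y} \<in> E" "conn (E - {{x, y}}) X" "x \<in> X" "y \<in> X"
    using assms(1) unfolding nonbridge_def by blast
  have xy: "{x, y} \<in> E - {?e}" using X(1) nc by auto
  have cyc: "conn (E - {?e} - {{x, y}}) C"
  proof -
    have "conn (E - {?e} - {{x, y}}) (c ` {Suc 0..n})"
      using n nc edge cycle_edge_ne[of 0] by (intro arc_conn) auto
    moreover have "{Suc 0..n} = {Suc 0..<Suc 0 + n}" by auto
    ultimately show ?thesis using c_arc[of "Suc 0"] by simp
  qed
  have "\<exists>X. conn (E - {?e} - {{x, y}}) X \<and> x \<in> X \<and> y \<in> X"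
  proof (cases "X \<inter> C = {}")
    case True
    have "c 0 \<notin> X" using True by blast
    then have "conn (E - {?e} - {{x, y}}) X" by (intro conn_within[OF X(2)]) auto
    then show ?thesis using X by blast
  next
    case False
    have "conn (E - {?e} - {{x, y}}) (X \<union> C)"
      by (rule conn_replace[OF X(2) cyc False]) auto
    then show ?thesis using X by blast
  qed
  then have "nonbridge (E - {?e}) x y" unfolding nonbridge_def using xy by blast
  then show False using unique[OF c_in_K assms(2) c_nonbridge] by blast
qed

lemma edge_cases:
  assumes "{x, y} \<in> E" "x \<in> K"
  obtains "{x, y} \<in> Br" | i where "{x, y} = {c i, c (Suc i)}"
  using nonbridge_cycle[OF _ assms(2)] assms(1) bridges_iff by metis

lemma light_cycle: "nonbridge E x y \<Longrightarrow> x \<in> K \<Longrightarrow> w {x, y} \<le> m"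
  using nonbridge_cycle heavy by metis

text \<open>A path of bridges between two cycle vertices would form, together with the cycle, a
  cycle through its first bridge. So each cycle vertex has a tree of bridges of its own.\<close>

lemma bridge_conn_meets_once:
  assumes X: "conn Br X" "c i \<in> X" "c j \<in> X"
  shows "c i = c j"
proof (rule ccontr)
  assume ne: "c i \<noteq> c j"
  obtain xs where xs: "xs \<noteq> []" "distinct xs" "hd xs = c i" "last xs = c j" "successively (\<lambda>a b. {a, b} \<in> Br) xs"
    using conn_path[OF X] by metis
  then obtain z zs where z: "xs = c i # z # zs" using ne by (metis last.simps list.collapse)
  have f: "{c i, z} \<in> Br" using xs(5) z by simp
  have "successively (\<lambda>a b. {a, b} \<in> E - {{c i, z}}) (z # zs)"
    using xs(2,5) z bridges_sub by (auto simp: doubleton_eq_iff elim!: successively_mono)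
  then have "conn (E - {{c i, z}}) (set (z # zs))" by (rule path_conn[rotated]) simp
  moreover have "conn (E - {{c i, z}}) C"
  proof -
    have "{c i, z} \<noteq> {c k, c (Suc k)}" for k using f c_nonbridge[of k] bridges_iff by metis
    then have "conn (E - {{c i, z}}) (c ` {0..n - 1})" using edge by (intro arc_conn) auto
    moreover have "{0..n - 1} = {0..<0 + n}" using n by auto
    ultimately show ?thesis using c_arc[of 0] by simp
  qed
  moreover have "c j \<in> set (z # zs)" using last_in_set[of "z # zs"] xs(4) z by simp
  then have "c j \<in> set (z # zs) \<inter> C" by blast
  ultimately have "conn (E - {{c i, z}}) (set (z # zs) \<union> C)" by (intro conn_Un_meet) auto
  then show False using no_bridge_cycle[of E "c i" z] f by auto
qed

lemma bridge_component_cycle: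
  assumes "y \<in> component Br (c i)" "y \<in> C"
  shows "y = c i"
proof -
  obtain j where "y = c j" using assms(2) by blast
  then show ?thesis
    using bridge_conn_meets_once[of "component Br (c i)" i j, OF component_conn component_self] assms(1) by simp
qed

lemma bridge_components_disjoint:
  assumes "c i \<noteq> c j"
  shows "component Br (c i) \<inter> component Br (c j) = {}"
proof (rule ccontr)
  assume "component Br (c i) \<inter> component Br (c j) \<noteq> {}"
  then have "conn Br (component Br (c i) \<union> component Br (c j))"
    by (intro conn_Un_meet component_conn)
  then show False using bridge_conn_meets_once[of _ i j] component_self assms by fastforce
qed

lemma component_K: "component Br (c i) \<subseteq> K"
  using c_in_K sealedD[OF K(3)] bridges_sub by (intro component_subset) blast+

lemma hanging_edge:
  assumes "y \<in> component Br (c i)" "y \<noteq> c i" "{y, z} \<in> E"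
  shows "{y, z} \<in> Br" "z \<in> component Br (c i)"
proof -
  have "y \<notin> C" using bridge_component_cycle assms(1,2) by blast
  moreover have "y \<in> K" using component_K assms(1) by blast
  ultimately show "{y, z} \<in> Br" using edge_cases[OF assms(3)] by (metis insertI1 insert_iff rangeI singletonD)
  then show "z \<in> component Br (c i)" using component_step[OF assms(1)] by blast
qed

text \<open>The tree at \<open>c i\<close> supplies the tail of \<open>F5\<close> and
  \<open>F8\<close>; a vertex that is merely not \<open>trivial\<close> supplies a leaf.\<close>

definition deep :: "nat \<Rightarrow> bool" where
  "deep i \<longleftrightarrow> (\<exists>y z. {c i, y} \<in> Br \<and> {y, z} \<in> Br \<and> z \<noteq> c i)"

definition trivial :: "nat \<Rightarrow> bool" where
  "trivial i \<longleftrightarrow> (\<forall>y. {c i, y} \<notin> Br)"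

lemma rotate: "unicyclic G w K S0 (\<lambda>i. c (i + k)) n m"
proof
  show "inj_on (\<lambda>i. c (i + k)) {..<n}"
  proof (rule linorder_inj_onI')
    fix i j assume "i \<in> {..<n}" "j \<in> {..<n}" "i < j"
    then show "c (i + k) \<noteq> c (j + k)" by (intro c_neq) auto
  qed
  show "c (i + n + k) = c (i + k)" for i using period[of "i + k"] by (simp add: ac_simps)
  show "{c (i + k), c (Suc i + k)} \<in> E" "w {c (i + k), c (Suc i + k)} \<le> m" for i
    using edge[of "i + k"] heavy[of "i + k"] by simp_all
qed (rule free K S0 n c_in_K unique; assumption)+

text \<open>Multiplication by \<open>n - 1\<close> is negation modulo \<open>n\<close>, so the cycle
  is run through backwards without subtracting indices.\<close>

lemma reverse: "unicyclic G w K S0 (\<lambda>i. c ((n - 1) * i)) n m"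
proof
  have eq: "c ((n - 1) * i) = c ((n - 1) * Suc i + 1)" for i
  proof -
    have "(n - 1) * Suc i + 1 = (n - 1) * i + n" using n by simp
    then show ?thesis using period[of "(n - 1) * i"] by (simp only:)
  qed
  show "{c ((n - 1) * i), c ((n - 1) * Suc i)} \<in> E" for i
    unfolding eq[of i] using edge[of "(n - 1) * Suc i"] by (simp add: insert_commute)
  show "w {c ((n - 1) * i), c ((n - 1) * Suc i)} \<le> m" for i
    unfolding eq[of i] using heavy[of "(n - 1) * Suc i"] by (simp add: insert_commute)
  show "c ((n - 1) * (i + n)) = c ((n - 1) * i)" for i
    unfolding c_eq distrib_left by (rule mod_mult_self1)
  show "inj_on (\<lambda>i. c ((n - 1) * i)) {..<n}"
  proof (rule inj_onI)
    fix i j assume ij: "i \<in> {..<n}" "j \<in> {..<n}" "c ((n - 1) * i) = c ((n - 1) * j)"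
    then have "((n - 1) * i + (i + j)) mod n = ((n - 1) * j + (i + j)) mod n"
      unfolding c_eq by (metis mod_add_left_eq)
    moreover obtain k where "n = Suc k" using n by (cases n) auto
    then have "(n - 1) * i + (i + j) = n * i + j" "(n - 1) * j + (i + j) = n * j + i" by simp_all
    ultimately have "(n * i + j) mod n = (n * j + i) mod n" by (simp only:)
    then show "i = j" using ij(1,2) by simp
  qed
qed (rule free K S0 n c_in_K unique; assumption)+

end

section \<open>What F4, F5 and F8 forbid around the cycle\<close>

context unicyclic
begin

lemma arc_branch: "a \<le> b \<Longrightarrow> conn E (c ` {a..b}) \<and> c ` {a..b} \<subseteq> V"
  using arc_conn[OF _ edge] c_in_K K(2) by auto

lemma arcs_disjoint:
  assumes "I \<subseteq> {a..<a + n}" "J \<subseteq> {a..<a + n}" "I \<inter> J = {}"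
  shows "c ` I \<inter> c ` J = {}"
  using inj_on_image_Int[OF inj_arc assms(1,2)] assms(3) by simp

text \<open>A spider gives \<open>F4\<close>: the corners of the triangle are \<open>A\<close>,
  which contains \<open>c i\<close>, the vertex \<open>c (Suc i)\<close>, and the rest
  \<open>R\<close> of the cycle.\<close>

lemma no_spider:
  assumes "L \<subseteq> Br"
  shows "\<not> spider L (c i)"
proof
  assume "spider L (c i)"
  then obtain A s t s' t' where A: "conn L A" "c i \<in> A" "A \<subseteq> component L (c i)"
    "{s, t, s', t'} \<subseteq> component L (c i) - A" "distinct [s, t, s', t']"
    "adjacent L A {s}" "{s, t} \<in> L" "adjacent L A {s'}" "{s', t'} \<in> L"
    unfolding spider_def by (elim exE conjE)
  have sub: "component L (c i) \<subseteq> component Br (c i)"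
    using component_superset[OF conn_mono[OF component_conn assms] component_self] .
  let ?H = "component Br (c i)"
  have LE: "L \<subseteq> E" using assms bridges_sub by blast
  have AH: "A \<subseteq> ?H" "{s, t, s', t'} \<subseteq> ?H - A" using A(3,4) sub by blast+
  have HC: "x \<notin> c ` {Suc i..<i + n}" if "x \<in> ?H" for x
  proof
    assume "x \<in> c ` {Suc i..<i + n}"
    then obtain j where j: "x = c j" "i < j" "j < i + n" by auto
    then have "x = c i" using bridge_component_cycle[OF that] by blast
    then show False using j c_neq[OF j(2,3)] by simp
  qed
  define R where "R = c ` {i + 2..i + n - 1}"
  have sR: "R \<subseteq> c ` {Suc i..<i + n}" "c (Suc i) \<in> c ` {Suc i..<i + n}" unfolding R_def using n by auto
  have R: "conn E R" "R \<subseteq> V" unfolding R_def using arc_branch[of "i + 2" "i + n - 1"] n by auto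
  have cR: "c (Suc i) \<notin> R"
  proof
    assume "c (Suc i) \<in> R"
    then obtain j where "c (Suc i) = c j" "i + 2 \<le> j" "j \<le> i + n - 1" unfolding R_def by auto
    then show False using c_neq[of "Suc i" j] n by simp
  qed
  have HV: "?H \<subseteq> V" using component_K K(2) by blast
  have br: "branches G [A, {c (Suc i)}, R, {s}, {t}, {s'}, {t'}]"
  proof -
    have H: "s \<in> ?H" "t \<in> ?H" "s' \<in> ?H" "t' \<in> ?H" using AH(2) by auto
    then have V: "s \<in> V" "t \<in> V" "s' \<in> V" "t' \<in> V" "A \<subseteq> V" "c (Suc i) \<in> V"
      using HV AH(1) c_in_K[of "Suc i"] K(2) by auto
    have A': "s \<notin> A" "t \<notin> A" "s' \<notin> A" "t' \<notin> A" using AH(2) by auto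
    have AR: "c (Suc i) \<notin> A" "A \<inter> R = {}" using HC[of "c (Suc i)"] HC[THEN contra_subsetD[OF sR(1)]] AH(1) sR(2) by auto
    have R': "x \<notin> R" "x \<noteq> c (Suc i)" if "x \<in> ?H" for x using HC[OF that] sR by auto
    have ne: "s \<noteq> c (Suc i)" "t \<noteq> c (Suc i)" "s' \<noteq> c (Suc i)" "t' \<noteq> c (Suc i)"
      using H R'(2) by simp_all
    have R': "s \<notin> R" "t \<notin> R" "s' \<notin> R" "t' \<notin> R" using H R'(1) by simp_all
    have ne': "s \<noteq> t" "s \<noteq> s'" "s \<noteq> t'" "t \<noteq> s'" "t \<noteq> t'" "s' \<noteq> t'" using A(5) by auto
    show ?thesis unfolding branches_Cons
      using conn_mono[OF A(1) LE] R V A' AR R' ne ne' cR by (simp add: dj_simps ne[symmetric] ne'[symmetric])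
  qed
  have "adj G A {c (Suc i)}" using edge[of i] A(2) by (intro adjacentI) auto
  moreover have "adj G {c (Suc i)} R" unfolding R_def using edge[of "Suc i"] n by (intro adjacentI) auto
  moreover have "adj G R A"
  proof (rule adjacentI)
    show "{c (i + n - 1), c i} \<in> E" using edge[of "i + n - 1"] period[of i] n by simp
  qed (use A(2) n in \<open>auto simp: R_def\<close>)
  moreover have "adj G A {s}" "adj G A {s'}" using A(6,8) adjacent_mono[OF _ LE] by blast+
  moreover have "adj G {s} {t}" "adj G {s'} {t'}" using A(7,9) LE by auto
  ultimately have "\<exists>B. model G F4 B" by (intro model_F4I[OF br])
  then show False using minor_freeD[OF free] by blast
qed

lemma Br_step: "{c i, y} \<in> Br \<Longrightarrow> y \<in> component Br (c i) \<and> y \<notin> C"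
proof -
  assume y: "{c i, y} \<in> Br"
  have 1: "y \<in> component Br (c i)" using component_step[OF component_self y] .
  have "y \<noteq> c i" using y bridges_sub E_ne by blast
  then show ?thesis using 1 bridge_component_cycle by blast
qed

lemma no_F8_short:
  assumes d: "deep 0" "\<not> trivial j" "0 < j" "j + 3 \<le> n"
  shows False
proof -
  obtain y z where yz: "{c 0, y} \<in> Br" "{y, z} \<in> Br" "z \<noteq> c 0" using d(1) unfolding deep_def by blast
  obtain t where t: "{c j, t} \<in> Br" using d(2) unfolding trivial_def by blast
  have y: "y \<in> component Br (c 0)" "y \<notin> C" and t': "t \<in> component Br (c j)" "t \<notin> C"
    using Br_step yz(1) t by blast+
  have z: "z \<in> component Br (c 0)" using component_step[OF y(1) yz(2)] .
  then have zC: "z \<notin> C" using bridge_component_cycle yz(3) by blast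
  have "c 0 \<noteq> c j" using c_neq[of 0 j] d by auto
  then have tyz: "t \<noteq> y" "t \<noteq> z" using bridge_components_disjoint y z t' by blast+
  have yzn: "y \<noteq> z" using yz(2) bridges_sub E_ne by blast
  have V: "t \<in> V" "y \<in> V" "z \<in> V" using y z t' component_K K(2) by blast+
  \<comment> \<open>These arcs form the 4-cycle of \<open>F8\<close>; \<open>?a\<close> carries the
    leaf at \<open>c j\<close>, and \<open>?d\<close> the tail at \<open>c 0\<close>. The assumption
    \<open>j + 3 \<le> n\<close> makes \<open>?c\<close> nonempty.\<close>
  let ?a = "c ` {1..j}" and ?b = "c ` {j + 1..j + 1}" and ?c = "c ` {j + 2..n - 1}" and ?d = "c ` {0..0}"
  have dj: "?a \<inter> ?b = {}" "?a \<inter> ?c = {}" "?a \<inter> ?d = {}" "?b \<inter> ?c = {}" "?b \<inter> ?d = {}" "?c \<inter> ?d = {}"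
    by (rule arcs_disjoint[of _ 0]; use d n in auto)+
  have cn: "conn E ?a \<and> ?a \<subseteq> V" "conn E ?b \<and> ?b \<subseteq> V" "conn E ?c \<and> ?c \<subseteq> V" "conn E ?d \<and> ?d \<subseteq> V"
    using d by (intro arc_branch; simp)+
  have out: "v \<notin> c ` I" if "v \<notin> C" for v I using that by blast
  have nc: "y \<noteq> c i" "z \<noteq> c i" "t \<noteq> c i" for i using y(2) zC t'(2) by blast+
  have br: "branches G [?a, ?b, ?c, ?d, {t}, {y}, {z}]"
    unfolding branches_Cons using dj cn V tyz yzn out[OF y(2)] out[OF zC] out[OF t'(2)]
    by (simp add: dj_simps nc nc[symmetric])
  have "adj G ?a ?b" using edge[of j] d by (intro adjacentI) auto
  moreover have "adj G ?b ?c" using edge[of "j + 1"] d by (intro adjacentI[of "c (j + 1)" "c (j + 2)"]) auto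
  moreover have "adj G ?c ?d" using edge[of "n - 1"] period[of 0] d by (intro adjacentI[of "c (n - 1)" "c 0"]) auto
  moreover have "adj G ?d ?a" using edge[of 0] d by (intro adjacentI[of "c 0" "c 1"]) auto
  moreover have "adj G ?a {t}" using t bridges_sub d by (intro adjacentI[of "c j" t]) auto
  moreover have "adj G ?d {y}" "adj G {y} {z}" using yz bridges_sub by auto
  ultimately have "\<exists>B. model G F8 B" by (intro model_F8I[OF br])
  then show False using minor_freeD[OF free] by blast
qed

lemma no_F5:
  assumes "n = 3" "deep 0" "\<not> trivial 1" "\<not> trivial 2"
  shows False
proof -
  obtain y z where yz: "{c 0, y} \<in> Br" "{y, z} \<in> Br" "z \<noteq> c 0" using assms(2) unfolding deep_def by blast
  obtain t where t: "{c 1, t} \<in> Br" using assms(3) unfolding trivial_def by blast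
  obtain u where u: "{c 2, u} \<in> Br" using assms(4) unfolding trivial_def by blast
  have y: "y \<in> component Br (c 0)" "y \<notin> C" and t': "t \<in> component Br (c 1)" "t \<notin> C"
    and u': "u \<in> component Br (c 2)" "u \<notin> C"
    using Br_step yz(1) t u by blast+
  have z: "z \<in> component Br (c 0)" using component_step[OF y(1) yz(2)] .
  then have zC: "z \<notin> C" using bridge_component_cycle yz(3) by blast
  have cc: "c 0 \<noteq> c 1" "c 0 \<noteq> c 2" "c 1 \<noteq> c 2" using c_neq[of 0 1] c_neq[of 0 2] c_neq[of 1 2] assms(1) by auto
  have ne: "t \<noteq> y" "t \<noteq> z" "u \<noteq> y" "u \<noteq> z" "t \<noteq> u"
    using bridge_components_disjoint[OF cc(1)] bridge_components_disjoint[OF cc(2)]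
      bridge_components_disjoint[OF cc(3)] y z t' u' by blast+
  have yzn: "y \<noteq> z" using yz(2) bridges_sub E_ne by blast
  have V: "t \<in> V" "y \<in> V" "z \<in> V" "u \<in> V" "c 0 \<in> V" "c 1 \<in> V" "c 2 \<in> V"
    using y z t' u' component_K c_in_K K(2) by blast+
  have nc: "y \<noteq> c i" "z \<noteq> c i" "t \<noteq> c i" "u \<noteq> c i" for i using y(2) zC t'(2) u'(2) by blast+
  have br: "branches G [{c 0}, {c 1}, {c 2}, {y}, {z}, {t}, {u}]"
    unfolding branches_Cons using V cc ne yzn nc by (simp add: nc[symmetric] ne[symmetric])
  have "\<exists>B. model G F5 B"
    by (rule model_F5I[OF br])
      (use edge[of 0] edge[of 1] edge[of 2] period[of 0] assms(1) yz t u bridges_sub in \<open>auto simp: numeral_eq_Suc\<close>)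
  then show False using minor_freeD[OF free] by blast
qed

end

lemma (in unicyclic) trivial_rotate: "unicyclic.trivial G (\<lambda>i. c (i + k)) i \<longleftrightarrow> trivial (i + k)"
  and deep_rotate: "unicyclic.deep G (\<lambda>i. c (i + k)) i \<longleftrightarrow> deep (i + k)"
proof -
  interpret r: unicyclic G w K S0 "\<lambda>i. c (i + k)" n m by (rule rotate)
  show "r.trivial i \<longleftrightarrow> trivial (i + k)" "r.deep i \<longleftrightarrow> deep (i + k)"
    unfolding r.trivial_def trivial_def r.deep_def deep_def by simp_all
qed

lemma (in unicyclic) trivial_cong: "c i = c j \<Longrightarrow> trivial i \<longleftrightarrow> trivial j"
  unfolding trivial_def by simp

text \<open>The last assumption says that one of the two arcs between the vertices has at least
  three edges; reversing the cycle exchanges the arcs. Only triangles and opposite vertices of a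
  4-cycle escape.\<close>

lemma (in unicyclic) no_F8:
  assumes d: "deep i" "\<not> trivial (i + j)" "0 < j" "j < n" "j + 3 \<le> n \<or> 3 \<le> j"
  shows False
proof (cases "j + 3 \<le> n")
  case True
  interpret r: unicyclic G w K S0 "\<lambda>k. c (k + i)" n m by (rule rotate)
  show False using r.no_F8_short[of j] True d trivial_rotate deep_rotate by (simp add: add.commute)
next
  case False
  interpret r: unicyclic G w K S0 "\<lambda>k. c (k + i)" n m by (rule rotate)
  interpret s: unicyclic G w K S0 "\<lambda>k. c ((n - 1) * k + i)" n m using r.reverse .
  have "s.deep 0" using d(1) unfolding s.deep_def deep_def by simp
  moreover have "c ((n - 1) * (n - j) + i) = c (i + j)"
  proof -
    obtain k where "n = Suc k" using n by (cases n) auto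
    then have "(n - 1) * (n - j) + i + (n - j) + j = n * (n - j) + i + j" by simp
    then have "((n - 1) * (n - j) + i) + n = (i + j) + n * (n - j)" using d(4) by linarith
    then show ?thesis unfolding c_eq by (metis mod_add_self2 mod_mult_self2)
  qed
  then have "\<not> s.trivial (n - j)" using d(2) unfolding s.trivial_def trivial_def by simp
  moreover have "0 < n - j" "n - j + 3 \<le> n" using d False by linarith+
  ultimately show False using s.no_F8_short[of "n - j"] by blast
qed

section \<open>Light bridges and moves along the cycle\<close>

context unicyclic
begin

text \<open>The bridges that must not stay open when the cycle closes. The others weigh at least
  \<open>m\<close>, so they cannot be undercut by a cycle edge.\<close>

definition L :: "'a set set" where
  "L = {f\<in>Br. w f < m}"

lemma L_Br: "L \<subseteq> Br"
  unfolding L_def by blast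

lemma L_E: "L \<subseteq> E"
  using L_Br bridges_sub by blast

lemma component_L_Br: "component L x \<subseteq> component Br x"
  using component_superset[OF conn_mono[OF component_conn L_Br] component_self] .

lemma component_edge:
  assumes "a \<in> component L x" "b \<in> component L x" "{a, b} \<in> Br"
  shows "{a, b} \<in> L"
proof (rule ccontr)
  assume "{a, b} \<notin> L"
  then have "L \<subseteq> E - {{a, b}}" using L_E by blast
  then have "conn (E - {{a, b}}) (component L x)" by (rule conn_mono[OF component_conn])
  then show False using no_bridge_cycle[of E a b] assms by blast
qed

lemma c_S0: "c i \<notin> S0"
  using c_in_K S0(3) by blast

lemma hang_start: "aimed E w m S0 (S0 \<union> (component L (c i) - {c i})) (c i)"
proof -
  have "aimed E w m S0 (S0 \<union> (component L (c i) - {c i})) (c i) \<or> spider L (c i)"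
  proof (rule hanging_tree[OF _ L_E E_card _ _ S0(1,2) c_S0])
    show "finite L" using L_E simple_graph_finite[OF simple] finite_subset by blast
    show "\<not> nonbridge L a b" for a b
    proof
      assume "nonbridge L a b"
      then obtain X where X: "{a, b} \<in> L" "conn (L - {{a, b}}) X" "a \<in> X" "b \<in> X" unfolding nonbridge_def by blast
      have "conn (E - {{a, b}}) X" using L_E by (intro conn_mono[OF X(2)]) auto
      then show False using no_bridge_cycle[of E a b] X L_Br by blast
    qed
    show "w e \<le> m" if "e \<in> L" for e using that unfolding L_def by simp
    show "finite (component L (c i))" by (rule finite_subset[OF subset_trans[OF component_L_Br component_K] finK])
    fix y z assume y: "y \<in> component L (c i)" "y \<noteq> c i" "{y, z} \<in> E"
    have "{y, z} \<in> Br" using hanging_edge(1)[OF subsetD[OF component_L_Br y(1)] y(2,3)] .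
    then show "{y, z} \<in> L \<or> m \<le> w {y, z} \<and> z \<notin> component L (c i)"
      using component_edge[OF y(1)] unfolding L_def by auto
  qed
  then show ?thesis using no_spider[OF L_Br] by blast
qed

text \<open>The index \<open>i + n - 1\<close> stands for the predecessor of \<open>i\<close>;
  adding \<open>n\<close> first keeps the subtraction exact at \<open>i = 0\<close>.\<close>

lemma cycle_neighbour:
  assumes "nonbridge E (c i) y"
  shows "y = c (Suc i) \<or> y = c (i + n - 1)"
proof -
  obtain k where k: "{c i, y} = {c k, c (Suc k)}" using nonbridge_cycle[OF assms c_in_K] by blast
  then consider "c i = c k" "y = c (Suc k)" | "c i = c (Suc k)" "y = c k" by (auto simp: doubleton_eq_iff)
  then show ?thesis
  proof cases
    case 1
    then have "Suc i mod n = Suc k mod n" unfolding c_eq by (metis mod_Suc_eq)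
    then show ?thesis using 1 c_eq by metis
  next
    case 2
    have "(i + (n - 1)) mod n = (Suc k + (n - 1)) mod n" using 2(1) unfolding c_eq by (metis mod_add_left_eq)
    also have "Suc k + (n - 1) = k + n" using n by simp
    finally have "c (i + n - 1) = c k" unfolding c_eq using n by simp
    then show ?thesis using 2 by simp
  qed
qed

lemma nonbridge_le: "{x, c i} \<in> E \<Longrightarrow> {x, c i} \<notin> Br \<Longrightarrow> w {x, c i} \<le> m"
  using light_cycle[of "c i" x] c_in_K bridges_iff nonbridge_sym by (metis insert_commute)

lemma Br_not_C: "{x, c i} \<in> Br \<Longrightarrow> x \<notin> C"
  using Br_step[of i x] by (simp add: insert_commute)

text \<open>With the whole cycle placed, all edges still to be closed in \<open>K\<close> are
  bridges, and \<open>build_prim\<close> applies.\<close>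

lemma finish:
  assumes S: "build E w S" "S0 \<subseteq> S" "conn E (S - S0)" "C \<subseteq> S"
  shows "build E w (S0 \<union> K)"
proof (rule build_prim[OF _ S0(2) K(1) finK S0(3) K(3) S(1,2) _ S(3)])
  show "finite E" using simple_graph_finite[OF simple] by blast
  have "c 0 \<in> S - S0" using S(4) c_S0 by blast
  then have "S - S0 \<subseteq> component E (c 0)" by (rule component_superset[OF S(3)])
  also have "\<dots> \<subseteq> K" using c0 sealedD[OF K(3)] by (intro component_subset) blast+
  finally show "S - S0 \<subseteq> K" .
  show "{x, y} \<subseteq> S" if xy: "x \<in> K" "nonbridge E x y" for x y
  proof -
    obtain i where i: "{x, y} = {c i, c (Suc i)}" using nonbridge_cycle[OF xy(2,1)] by blast
    have "{c i, c (Suc i)} \<subseteq> S" using S(4) by blast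
    then show ?thesis using i by simp
  qed
qed

lemma finish_aimed:
  assumes a: "aimed E w m S0 S (c i)" and C: "C \<subseteq> insert (c i) S"
    and into: "\<And>x. x \<in> S \<Longrightarrow> {x, c i} \<in> Br \<Longrightarrow> w {x, c i} \<le> m"
  shows "build E w (S0 \<union> K)"
proof -
  have "w {x, c i} \<le> m" if "x \<in> S" "{x, c i} \<in> E" for x
    using into[OF that(1)] nonbridge_le[OF that(2)] by blast
  note close = aimed_close[OF a this]
  show ?thesis by (rule finish[OF close C])
qed

lemma move_cycle:
  assumes a: "aimed E w m S0 S (c i)" and q: "q \<notin> S" "q \<noteq> c i" "{c i, q} \<in> E"
    and into: "\<And>x. x \<in> S \<Longrightarrow> {x, c i} \<in> Br \<Longrightarrow> w {x, c i} \<le> m"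
    and out: "\<And>y. y \<notin> S \<Longrightarrow> {c i, y} \<in> Br \<Longrightarrow> m \<le> w {c i, y}"
    and cyc: "\<And>y. y = c (Suc i) \<or> y = c (i + n - 1) \<Longrightarrow> y \<notin> S \<Longrightarrow> y = q \<or> m \<le> w {c i, y}"
  shows "aimed E w m S0 (insert (c i) S) q"
proof (rule aimed_move[OF a q])
  fix x assume "x \<in> S" "{x, c i} \<in> E"
  then show "w {x, c i} \<le> m" using into nonbridge_le by blast
next
  fix y assume y: "y \<notin> S" "{c i, y} \<in> E"
  show "y = q \<or> m \<le> w {c i, y}"
  proof (cases "{c i, y} \<in> Br")
    case False
    then have "nonbridge E (c i) y" using y(2) by (simp add: bridges_iff)
    then show ?thesis using cyc[OF cycle_neighbour y(1)] by blast
  qed (use out y(1) in blast)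
qed

text \<open>All trees of bridges are stars. On the walk from \<open>c 0\<close> to
  \<open>c (n - 1)\<close>, the light leaves of each vertex before the last are placed just before
  it, so that besides the edge ahead only heavy edges stay open. The heaviest cycle edge joins the
  two ends of the walk and stays open until the last vertex.\<close>

lemma layout_shallow:
  assumes nd: "\<And>i. \<not> deep i" and top: "m \<le> w {c (n - 1), c 0}"
  shows "build E w (S0 \<union> K)"
proof -
  define Q where "Q i = {y. {c i, y} \<in> L}" for i
  have Q: "l \<in> component Br (c i)" "l \<notin> C" "l \<in> K" "{c i, l} \<in> E" if "l \<in> Q i" for l i
  proof -
    have l: "{c i, l} \<in> Br" using that L_Br unfolding Q_def by blast
    show "l \<in> component Br (c i)" "l \<notin> C" using Br_step[OF l] by auto
    then show "l \<in> K" using component_K by blast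
    show "{c i, l} \<in> E" using l bridges_sub by blast
  qed
  have leaf: "y = c i" if "l \<in> Q i" "{l, y} \<in> E" for l i y
  proof -
    have "l \<noteq> c i" using Q(2)[OF that(1)] by blast
    then have "{l, y} \<in> Br" using hanging_edge(1)[OF Q(1)[OF that(1)] _ that(2)] by blast
    moreover have "{c i, l} \<in> Br" using that(1) L_Br unfolding Q_def by blast
    ultimately show ?thesis using nd[of i] unfolding deep_def by blast
  qed
  define T where "T k = S0 \<union> c ` {..<k} \<union> (\<Union>i<k. Q i)" for k
  have T_Br: "w {x, c k} \<le> m" if xT: "x \<in> T k \<union> Q k" and xB: "{x, c k} \<in> Br" for x k
  proof -
    have e: "{x, c k} \<in> E" using xB bridges_sub by blast
    have "x \<notin> C" using Br_not_C[OF xB] .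
    moreover have "x \<notin> S0" using sealedD[OF S0(2) e] c_S0 by blast
    ultimately obtain i where i: "x \<in> Q i" using xT unfolding T_def by blast
    then have "c k = c i" using leaf[OF i e] by simp
    then have "{c k, x} \<in> L" using i unfolding Q_def by simp
    then show ?thesis unfolding L_def by (simp add: insert_commute)
  qed
  have cT: "c j \<notin> T k \<union> Q k" if "k \<le> j" "j < n" for j k
  proof
    assume "c j \<in> T k \<union> Q k"
    then have "c j \<in> c ` {..<k}" using c_S0 Q(2) unfolding T_def by blast
    then obtain i where "c j = c i" "i < k" by auto
    then show False using c_neq[of i j] that by auto
  qed
  have "aimed E w m S0 (T k) (c k)" if "k < n" for k
    using that
  proof (induction k)
    case 0
    then show ?case using aimed_start[OF S0(1,2) c_S0] unfolding T_def by simp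
  next
    case (Suc k)
    then have k: "k < n" "Suc k < n" by simp_all
    have "aimed E w m S0 (T k \<union> Q k) (c k)"
    proof (rule aimed_leaves)
      show "finite (Q k)" using Q(3) finK by (meson finite_subset subsetI)
      show "aimed E w m S0 (T k) (c k)" using Suc by simp
      show "Q k \<inter> T k = {}"
      proof (rule ccontr)
        assume "Q k \<inter> T k \<noteq> {}"
        then obtain l where l: "l \<in> Q k" "l \<in> T k" by blast
        then obtain i where i: "i < k" "l \<in> Q i" using Q(2,3)[OF l(1)] S0(3) unfolding T_def by blast
        have "c i \<noteq> c k" using c_neq[of i k] i k by auto
        then show False using bridge_components_disjoint Q(1)[OF l(1)] Q(1)[OF i(2)] by blast
      qed
      show "c k \<notin> Q k" using Q(2) by blast
      show "{c k, l} \<in> E" if "l \<in> Q k" for l using Q(4)[OF that] .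
      show "y = c k \<or> y \<notin> T k \<union> Q k \<and> m \<le> w {l, y}" if "l \<in> Q k" "{l, y} \<in> E" for l y
        using leaf[OF that] by blast
    qed
    then have "aimed E w m S0 (insert (c k) (T k \<union> Q k)) (c (Suc k))"
    proof (rule move_cycle)
      show "c (Suc k) \<notin> T k \<union> Q k" using cT[of k "Suc k"] k by simp
      show "c (Suc k) \<noteq> c k" using c_neq[of k "Suc k"] n by auto
      show "{c k, c (Suc k)} \<in> E" by (rule edge)
      show "w {x, c k} \<le> m" if "x \<in> T k \<union> Q k" "{x, c k} \<in> Br" for x using T_Br[OF that] .
      show "m \<le> w {c k, y}" if "y \<notin> T k \<union> Q k" "{c k, y} \<in> Br" for y
        using that unfolding Q_def L_def by auto
      fix y assume y: "y = c (Suc k) \<or> y = c (k + n - 1)" "y \<notin> T k \<union> Q k"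
      show "y = c (Suc k) \<or> m \<le> w {c k, y}"
      proof (cases k)
        case 0
        then show ?thesis using y(1) top by (auto simp: insert_commute)
      next
        case (Suc k')
        then have "c (k + n - 1) = c k'" using period[of k'] by simp
        then have "c (k + n - 1) \<in> T k" using Suc unfolding T_def by auto
        then show ?thesis using y by blast
      qed
    qed
    moreover have "insert (c k) (T k \<union> Q k) = T (Suc k)"
      unfolding T_def by (auto simp: lessThan_Suc)
    ultimately show ?case by simp
  qed
  from this[of "n - 1"] have a: "aimed E w m S0 (T (n - 1)) (c (n - 1))" using n by simp
  have "C = c ` {0..<0 + n}" by (rule c_arc)
  also have "{0..<0 + n} = insert (n - 1) {..<n - 1}" using n by auto
  finally have "C \<subseteq> insert (c (n - 1)) (T (n - 1))" unfolding T_def by auto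
  then show ?thesis by (rule finish_aimed[OF a]) (use T_Br in auto)
qed

text \<open>Only the light tree at \<open>c k\<close> is placed before the cycle is complete. Any
  other cycle vertex passed on the way must be trivial, or its light bridges could be open at the
  last vertex.\<close>

definition near :: "nat \<Rightarrow> 'a set \<Rightarrow> bool" where
  "near k S \<longleftrightarrow> S \<subseteq> S0 \<union> component L (c k) \<union> C \<and> component L (c k) - {c k} \<subseteq> S"

lemma near_insert: "near k S \<Longrightarrow> near k (insert (c i) S)"
  unfolding near_def by auto

lemma near_into:
  assumes "near k S" "x \<in> S" "{x, c j} \<in> Br"
  shows "w {x, c j} \<le> m"
proof -
  have e: "{x, c j} \<in> E" using assms(3) bridges_sub by blast
  have xC: "x \<notin> C" using Br_not_C[OF assms(3)] .
  have "x \<notin> S0" using sealedD[OF S0(2) e] c_S0 by blast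
  then have x: "x \<in> component L (c k)" using assms(1,2) xC unfolding near_def by blast
  then have "c j \<in> component Br (c k)" using hanging_edge(2)[of x k] component_L_Br xC e by blast
  then have "c j = c k" using bridge_component_cycle by blast
  then have "{x, c j} \<in> L" using component_edge[OF x _ assms(3)] component_self by metis
  then show ?thesis unfolding L_def by simp
qed

lemma near_move:
  assumes near: "near k S" and a: "aimed E w m S0 S (c i)" and i: "i = k \<or> trivial i"
    and q: "q \<notin> S" "q \<noteq> c i" "{c i, q} \<in> E"
    and cyc: "\<And>y. y = c (Suc i) \<or> y = c (i + n - 1) \<Longrightarrow> y \<notin> S \<Longrightarrow> y = q \<or> m \<le> w {c i, y}"
  shows "aimed E w m S0 (insert (c i) S) q"
proof (rule move_cycle[OF a q near_into[OF near] _ cyc])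
  fix y assume y: "y \<notin> S" "{c i, y} \<in> Br"
  then have ik: "i = k" using i unfolding trivial_def by blast
  show "m \<le> w {c i, y}"
  proof (rule ccontr)
    assume "\<not> ?thesis"
    then have "{c i, y} \<in> L" using y(2) unfolding L_def by simp
    then have "y \<in> component L (c k)" using component_step[OF component_self] ik by metis
    moreover have "y \<noteq> c k" using y(2) Br_step ik by blast
    ultimately show False using near y(1) unfolding near_def by blast
  qed
qed assumption+

lemma near_start: "near k (S0 \<union> (component L (c k) - {c k}))"
  unfolding near_def by blast

lemma near_C:
  assumes "c i \<in> S0 \<union> (component L (c k) - {c k})"
  shows False
proof -
  have "c i \<in> component Br (c k)" "c i \<noteq> c k" using assms c_S0 component_L_Br by auto
  then show False using bridge_component_cycle by blast
qed

text \<open>A trivial neighbour of \<open>c k\<close> whose other cycle edge is heavy behaves like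
  one more leaf of \<open>c k\<close>. The cycle can thus be entered one step beside the root of the
  tree.\<close>

lemma start_with_leaf:
  assumes j: "trivial j" "c j \<noteq> c k" "{c k, c j} \<in> E"
    and cyc: "\<And>y. y = c (Suc j) \<or> y = c (j + n - 1) \<Longrightarrow> y = c k \<or> m \<le> w {c j, y}"
  shows "aimed E w m S0 (insert (c j) (S0 \<union> (component L (c k) - {c k}))) (c k)"
proof (rule aimed_leaf[OF hang_start _ j(2,3)])
  show "c j \<notin> S0 \<union> (component L (c k) - {c k})" using near_C by blast
  show "{x, c j} \<notin> E" if x: "x \<in> S0 \<union> (component L (c k) - {c k})" for x
  proof
    assume e: "{x, c j} \<in> E"
    then have "x \<notin> S0" using sealedD[OF S0(2) e] c_S0 by blast
    then have "x \<in> component Br (c k)" "x \<noteq> c k" using x component_L_Br by auto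
    then have "c j \<in> component Br (c k)" using hanging_edge(2) e by blast
    then show False using bridge_component_cycle j(2) by blast
  qed
  fix y assume y: "{c j, y} \<in> E"
  have "{c j, y} \<notin> Br" using j(1) unfolding trivial_def by blast
  then have "nonbridge E (c j) y" using y by (simp add: bridges_iff)
  then show "y = c k \<or> m \<le> w {c j, y}" using cyc[OF cycle_neighbour] by blast
qed

end

section \<open>Orders according to the length of the cycle\<close>

context unicyclic
begin

text \<open>The heaviest cycle edge is \<open>{c 2, c 0}\<close>. If \<open>c 0\<close> is trivial,
  the order is the light tree at \<open>c 1\<close> without its root, then \<open>c 0\<close>,
  \<open>c 1\<close>, \<open>c 2\<close>. If \<open>c 1\<close> is trivial, the tree at
  \<open>c 0\<close> precedes the same three. If \<open>c 2\<close> is trivial, the tree at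
  \<open>c 1\<close> precedes \<open>c 2\<close>, \<open>c 1\<close>, \<open>c 0\<close>. The last
  vertex may carry any tree.\<close>

lemma layout_3:
  assumes n3: "n = 3" and top: "m \<le> w {c (n - 1), c 0}" and triv: "trivial 0 \<or> trivial 1 \<or> trivial 2"
  shows "build E w (S0 \<union> K)"
proof -
  have per: "c 3 = c 0" "c 4 = c 1" unfolding c_eq using n3 by simp_all
  have ne: "c 0 \<noteq> c 1" "c 0 \<noteq> c 2" "c 1 \<noteq> c 2" unfolding c_eq using n3 by simp_all
  have ed: "{c 0, c 1} \<in> E" "{c 1, c 2} \<in> E" "{c 2, c 0} \<in> E"
    using edge[of 0] edge[of 1] edge[of 2] per by (simp_all add: numeral_eq_Suc)
  have top': "m \<le> w {c 2, c 0}" "m \<le> w {c 0, c 2}" using top n3 by (simp_all add: insert_commute)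
  have C: "C = {c 0, c 1, c 2}" using c_arc[of 0] n3 by (auto simp: numeral_eq_Suc lessThan_Suc atLeast0LessThan)
  from triv consider "trivial 0" | "trivial 1" | "trivial 2" by blast
  then show ?thesis
  proof cases
    case 1
    let ?S = "insert (c 0) (S0 \<union> (component L (c 1) - {c 1}))"
    have near: "near 1 ?S" by (intro near_insert near_start)
    have a: "aimed E w m S0 ?S (c 1)"
      by (rule start_with_leaf[OF 1]) (use ne ed top' n3 in \<open>auto simp: insert_commute numeral_eq_Suc\<close>)
    have b: "aimed E w m S0 (insert (c 1) ?S) (c 2)"
    proof (rule near_move[OF near a])
      show "c 2 \<notin> ?S" using near_C[of 2 1] ne by (metis insertE)
    qed (use ne ed per n3 in \<open>auto simp: numeral_eq_Suc\<close>)
    show ?thesis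
      by (rule finish_aimed[OF b]) (use C near_into[OF near_insert[OF near]] in auto)
  next
    case 2
    let ?S = "S0 \<union> (component L (c 0) - {c 0})"
    have near: "near 0 ?S" by (rule near_start)
    have a: "aimed E w m S0 (insert (c 0) ?S) (c 1)"
    proof (rule near_move[OF near hang_start])
      show "c 1 \<notin> ?S" using near_C[of 1 0] by blast
    qed (use ne ed top' n3 in \<open>auto simp: numeral_eq_Suc\<close>)
    have b: "aimed E w m S0 (insert (c 1) (insert (c 0) ?S)) (c 2)"
    proof (rule near_move[OF near_insert[OF near] a])
      show "c 2 \<notin> insert (c 0) ?S" using near_C[of 2 0] ne by (metis insertE)
    qed (use 2 ne ed per n3 in \<open>auto simp: numeral_eq_Suc\<close>)
    show ?thesis
      by (rule finish_aimed[OF b]) (use C near_into[OF near_insert[OF near_insert[OF near]]] in auto)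
  next
    case 3
    let ?S = "insert (c 2) (S0 \<union> (component L (c 1) - {c 1}))"
    have near: "near 1 ?S" by (intro near_insert near_start)
    have a: "aimed E w m S0 ?S (c 1)"
      by (rule start_with_leaf[OF 3]) (use ne ed top' per n3 in \<open>auto simp: insert_commute numeral_eq_Suc\<close>)
    have b: "aimed E w m S0 (insert (c 1) ?S) (c 0)"
    proof (rule near_move[OF near a])
      show "c 0 \<notin> ?S" using near_C[of 0 1] ne by (metis insertE)
    qed (use ne ed per n3 in \<open>auto simp: numeral_eq_Suc insert_commute\<close>)
    show ?thesis
      by (rule finish_aimed[OF b]) (use C near_into[OF near_insert[OF near]] in auto)
  qed
qed

text \<open>If \<open>c 0\<close> and \<open>c 2\<close> are trivial, the light tree at
  \<open>c 1\<close> without its root precedes \<open>c 0\<close>, \<open>c 1\<close>,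
  \<open>c 2\<close>, \<open>c 3\<close>. If \<open>c 1\<close> and \<open>c 3\<close> are trivial,
  the tree at \<open>c 2\<close> precedes \<open>c 3\<close>, \<open>c 2\<close>,
  \<open>c 1\<close>, \<open>c 0\<close>. Both remaining vertices may carry trees: one is the root
  of the tree placed first, the other comes last.\<close>

lemma layout_4:
  assumes n4: "n = 4" and top: "m \<le> w {c (n - 1), c 0}"
    and triv: "trivial 0 \<and> trivial 2 \<or> trivial 1 \<and> trivial 3"
  shows "build E w (S0 \<union> K)"
proof -
  have per: "c 4 = c 0" "c 5 = c 1" "c 6 = c 2" unfolding c_eq using n4 by simp_all
  have ne: "c 0 \<noteq> c 1" "c 0 \<noteq> c 2" "c 0 \<noteq> c 3" "c 1 \<noteq> c 2" "c 1 \<noteq> c 3" "c 2 \<noteq> c 3"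
    unfolding c_eq using n4 by simp_all
  have ed: "{c 0, c 1} \<in> E" "{c 1, c 2} \<in> E" "{c 2, c 3} \<in> E" "{c 3, c 0} \<in> E"
    using edge[of 0] edge[of 1] edge[of 2] edge[of 3] per by (simp_all add: numeral_eq_Suc)
  have top': "m \<le> w {c 3, c 0}" "m \<le> w {c 0, c 3}" using top n4 by (simp_all add: insert_commute)
  have C: "C = {c 0, c 1, c 2, c 3}"
    using c_arc[of 0] n4 by (auto simp: numeral_eq_Suc lessThan_Suc atLeast0LessThan)
  from triv consider "trivial 0" "trivial 2" | "trivial 1" "trivial 3" by blast
  then show ?thesis
  proof cases
    case 1
    let ?S = "insert (c 0) (S0 \<union> (component L (c 1) - {c 1}))"
    have near: "near 1 ?S" by (intro near_insert near_start)
    have a: "aimed E w m S0 ?S (c 1)"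
      by (rule start_with_leaf[OF 1(1)]) (use ne ed top' n4 in \<open>auto simp: insert_commute numeral_eq_Suc\<close>)
    have b: "aimed E w m S0 (insert (c 1) ?S) (c 2)"
    proof (rule near_move[OF near a])
      show "c 2 \<notin> ?S" using near_C[of 2 1] ne by (metis insertE)
    qed (use ne ed per n4 in \<open>auto simp: numeral_eq_Suc\<close>)
    have d: "aimed E w m S0 (insert (c 2) (insert (c 1) ?S)) (c 3)"
    proof (rule near_move[OF near_insert[OF near] b])
      show "c 3 \<notin> insert (c 1) ?S" using near_C[of 3 1] ne by (metis insertE)
    qed (use 1 ne ed per n4 in \<open>auto simp: numeral_eq_Suc\<close>)
    show ?thesis
      by (rule finish_aimed[OF d]) (use C near_into[OF near_insert[OF near_insert[OF near]]] in auto)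
  next
    case 2
    let ?S = "insert (c 3) (S0 \<union> (component L (c 2) - {c 2}))"
    have near: "near 2 ?S" by (intro near_insert near_start)
    have a: "aimed E w m S0 ?S (c 2)"
      by (rule start_with_leaf[OF 2(2)]) (use ne ed top' per n4 in \<open>auto simp: insert_commute numeral_eq_Suc\<close>)
    have b: "aimed E w m S0 (insert (c 2) ?S) (c 1)"
    proof (rule near_move[OF near a])
      show "c 1 \<notin> ?S" using near_C[of 1 2] ne by (metis insertE)
    qed (use ne ed per n4 in \<open>auto simp: numeral_eq_Suc insert_commute\<close>)
    have d: "aimed E w m S0 (insert (c 1) (insert (c 2) ?S)) (c 0)"
    proof (rule near_move[OF near_insert[OF near] b])
      show "c 0 \<notin> insert (c 2) ?S" using near_C[of 0 2] ne by (metis insertE)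
    qed (use 2 ne ed per n4 in \<open>auto simp: numeral_eq_Suc insert_commute\<close>)
    show ?thesis
      by (rule finish_aimed[OF d]) (use C near_into[OF near_insert[OF near_insert[OF near]]] in auto)
  qed
qed

text \<open>Prim's algorithm goes around the cycle in both directions. At the last vertex of the cycle two
  edges end, and all other open edges have weight at least \<open>m\<close>.\<close>

lemma layout_one_tree:
  assumes triv: "\<And>j. c j \<noteq> c 0 \<Longrightarrow> trivial j"
  shows "build E w (S0 \<union> K)"
proof -
  let ?H = "component L (c 0)"
  have c0H: "c 0 \<in> ?H" by (rule component_self)
  have HK: "?H \<subseteq> K" using component_L_Br component_K by blast
  have CK: "C \<subseteq> K" using c_in_K by blast
  have grow: "build E w (S0 \<union> K)"
    if S: "build E w S" "S0 \<union> ?H \<subseteq> S" "S \<subseteq> S0 \<union> ?H \<union> C" "conn E (S - S0)" for S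
    using S
  proof (induction "card (C - S)" arbitrary: S rule: less_induct)
    case less
    note S = less.prems
    have c0S: "c 0 \<in> S" using c0H S(2) by blast
    have SK: "u \<in> K" if "u \<in> S" "u \<notin> S0" for u using that S(3) HK CK by blast
    show ?case
    proof (cases "C - S = {}")
      case True
      then show ?thesis using finish[OF S(1) _ S(4)] S(2) by blast
    next
      case False
      define Op where "Op = {e\<in>E. \<exists>x\<in>S. \<exists>y. y \<in> C - S \<and> e = {x, y}}"
      have "adjacent E (C \<inter> S) (C - C \<inter> S)" using c0S False by (intro conn_cut[OF cycle_conn']) auto
      then obtain x0 y0 where "x0 \<in> C \<inter> S" "y0 \<in> C - C \<inter> S" "{x0, y0} \<in> E" by (rule adjacentE)
      then have "{x0, y0} \<in> Op" unfolding Op_def by blast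
      moreover have "finite Op" unfolding Op_def using simple_graph_finite[OF simple] by simp
      ultimately obtain e where e: "e \<in> Op" "\<And>f. f \<in> Op \<Longrightarrow> w e \<le> w f"
        using arg_min_if_finite[of Op w] by (metis empty_iff not_le)
      then obtain x y where xy: "x \<in> S" "y \<in> C - S" "{x, y} \<in> E" "e = {x, y}" unfolding Op_def by blast
      have nS0: "u \<in> S0 \<longleftrightarrow> v \<in> S0" if "{u, v} \<in> E" for u v using sealedD[OF S0(2) that] .
      have CS: "{u, v} \<notin> Br" if v: "v \<in> C - S" for u v
      proof
        assume u: "{u, v} \<in> Br"
        obtain j where j: "v = c j" using v by blast
        have "c j \<noteq> c 0" using v c0S j by auto
        then have "trivial j" by (rule triv)
        moreover have "{c j, u} \<in> Br" using u j by (simp add: insert_commute)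
        ultimately show False unfolding trivial_def by blast
      qed
      have outer: "m \<le> w {u, v}" if uv: "u \<in> S" "v \<notin> S" "{u, v} \<in> E" "v \<notin> C" for u v
      proof -
        have "v \<notin> S0" using uv(2) S(2) by blast
        then have u: "u \<notin> S0" using nS0[OF uv(3)] by blast
        have Br: "{u, v} \<in> Br"
        proof (rule ccontr)
          assume "{u, v} \<notin> Br"
          then have "nonbridge E u v" using uv(3) by (simp add: bridges_iff)
          then obtain i where "{u, v} = {c i, c (Suc i)}" using nonbridge_cycle SK[OF uv(1) u] by blast
          then have "v \<in> {c i, c (Suc i)}" by auto
          then show False using uv(4) by blast
        qed
        have "u \<in> ?H"
        proof (rule ccontr)
          assume uH: "u \<notin> ?H"
          then obtain j where j: "u = c j" using uv(1) u S(3) by blast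
          then have "c j \<noteq> c 0" using uH c0H by metis
          then have "trivial j" by (rule triv)
          then show False using Br unfolding j trivial_def by blast
        qed
        moreover have "v \<notin> ?H" using uv(2) S(2) by blast
        ultimately have "{u, v} \<notin> L" using component_step[of u L "c 0" v] by blast
        then show ?thesis using Br unfolding L_def by auto
      qed
      have build: "build E w (insert y S)"
      proof (rule build.insert[OF S(1)])
        show "y \<notin> S" using xy(2) by blast
        fix u u' v' assume *: "u \<in> S" "{u, y} \<in> E" "u' \<in> S" "v' \<notin> S" "v' \<noteq> y" "{u', v'} \<in> E"
        show "w {u, y} \<le> w {u', v'}"
        proof (cases "v' \<in> C")
          case False
          obtain j where "y = c j" using xy(2) by blast
          then have "w {u, y} \<le> m" using nonbridge_le[of u j] *(2) CS[OF xy(2)] by simp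
          then show ?thesis using outer[OF *(3,4,6) False] by linarith
        next
          case True
          then have Op: "{u', v'} \<in> Op" using * unfolding Op_def by blast
          \<comment> \<open>If two edges ended at \<open>y\<close> while another cycle edge
            \<open>{u', v'}\<close> is open, then \<open>{x, y}\<close> would be on a cycle even
            after removing \<open>{u', v'}\<close>, against \<open>unique\<close>.\<close>
          have "u = x"
          proof (rule ccontr)
            assume "u \<noteq> x"
            let ?E = "E - {{u', v'}}"
            have y: "y \<noteq> u'" "y \<noteq> v'" using * xy(2) by auto
            have S0': "x \<notin> S0" "u \<notin> S0" "u' \<notin> S0"
              using nS0[OF xy(3)] nS0[OF *(2)] nS0[OF *(6)] xy(2) *(4) S(2) by blast+
            have "conn (?E - {{x, y}}) (S - S0)" using *(4) xy(2) by (intro conn_within[OF S(4)]) auto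
            moreover have "{u, y} \<in> ?E - {{x, y}}" using *(2) y \<open>u \<noteq> x\<close> by (auto simp: doubleton_eq_iff)
            ultimately have "conn (?E - {{x, y}}) (insert y (S - S0))"
              using *(1) S0'(2) by (intro conn_insert[of _ _ u]) auto
            then have "nonbridge ?E x y"
              unfolding nonbridge_def using xy(1,3) y S0'(1) by (auto simp: doubleton_eq_iff)
            moreover have "nonbridge E u' v'" using CS[of v' u'] True *(4,6) by (simp add: bridges_iff)
            ultimately show False using unique[OF SK[OF *(3) S0'(3)] SK[OF xy(1) S0'(1)]] by blast
          qed
          then show ?thesis using e(2)[OF Op] xy(4) by simp
        qed
      qed
      have yS0: "y \<notin> S0" using xy(2) CK S0(3) by blast
      have xS0: "x \<notin> S0" using nS0[OF xy(3)] yS0 by blast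
      have S'0: "insert y S - S0 = insert y (S - S0)" using yS0 by auto
      show ?thesis
      proof (rule less.hyps[OF _ build])
        have "C \<subseteq> K" "finite K" using CK finK .
        then have "finite (C - S)" by (meson finite_Diff finite_subset)
        then show "card (C - insert y S) < card (C - S)" using xy(2) by (intro psubset_card_mono) auto
        show "conn E (insert y S - S0)"
          unfolding S'0 using xy xS0 by (intro conn_insert[OF S(4), of x]) auto
      qed (use S(2,3) xy(2) in auto)
    qed
  qed
  have close: "w {x, c 0} \<le> m" if "x \<in> S0 \<union> (?H - {c 0})" "{x, c 0} \<in> E" for x
    using near_into[OF near_start that(1)] nonbridge_le[OF that(2)] by blast
  have "insert (c 0) (S0 \<union> (?H - {c 0})) = S0 \<union> ?H" using c0H by blast
  then show ?thesis
    using grow[OF aimed_close(1)[OF hang_start close]] aimed_close(3)[OF hang_start close] by auto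
qed

text \<open>A deep tree restricts the other cycle vertices. For length 3, \<open>F5\<close> leaves
  one of them trivial; for length 4, \<open>F8\<close> makes both neighbours trivial; from length 5
  on, every other vertex is trivial, since one of the two arcs always has three edges.\<close>

lemma layout:
  assumes top: "m \<le> w {c (n - 1), c 0}"
  shows "build E w (S0 \<union> K)"
proof (cases "\<exists>i. deep i")
  case False
  then show ?thesis using layout_shallow top by blast
next
  case True
  then obtain i where i: "deep i" by blast
  consider "n = 3" | "n = 4" | "n \<ge> 5" using n by linarith
  then show ?thesis
  proof cases
    case 1
    interpret r: unicyclic G w K S0 "\<lambda>k. c (k + i)" n m by (rule rotate)
    have "trivial (1 + i) \<or> trivial (2 + i)"
      using r.no_F5[OF 1] i trivial_rotate[of i] deep_rotate[of i 0] by auto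
    then have "trivial ((1 + i) mod 3) \<or> trivial ((2 + i) mod 3)"
      using trivial_cong[OF c_mod[of "1 + i"]] trivial_cong[OF c_mod[of "2 + i"]] 1 by simp
    moreover have "k mod 3 = 0 \<or> k mod 3 = 1 \<or> k mod 3 = 2" for k :: nat by linarith
    ultimately have "trivial 0 \<or> trivial 1 \<or> trivial 2" by metis
    then show ?thesis by (rule layout_3[OF 1 top])
  next
    case 2
    have "trivial (i + 1)" "trivial (i + 3)" using no_F8[OF i, of 1] no_F8[OF i, of 3] 2 by auto
    then have t: "trivial ((i + 1) mod 4)" "trivial ((i + 3) mod 4)"
      using trivial_cong[OF c_mod[of "i + 1"]] trivial_cong[OF c_mod[of "i + 3"]] 2 by simp_all
    have "(i + 1) mod 4 = 0 \<and> (i + 3) mod 4 = 2 \<or> (i + 1) mod 4 = 2 \<and> (i + 3) mod 4 = 0 \<or>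
      (i + 1) mod 4 = 1 \<and> (i + 3) mod 4 = 3 \<or> (i + 1) mod 4 = 3 \<and> (i + 3) mod 4 = 1" by presburger
    then have "trivial 0 \<and> trivial 2 \<or> trivial 1 \<and> trivial 3" using t by metis
    then show ?thesis by (rule layout_4[OF 2 top])
  next
    case 3
    have triv: "trivial j" if "c j \<noteq> c i" for j
    proof -
      have "c j \<in> c ` {i..<i + n}" using c_arc[of i] by blast
      then obtain k where k: "c j = c k" "i \<le> k" "k < i + n" by auto
      then have "k \<noteq> i" using that by auto
      then have "trivial (i + (k - i))" using no_F8[OF i, of "k - i"] k 3 by fastforce
      then show ?thesis using trivial_cong[OF k(1)] k(2) by simp
    qed
    interpret r: unicyclic G w K S0 "\<lambda>k. c (k + i)" n m by (rule rotate)
    show ?thesis using r.layout_one_tree trivial_rotate[of i] triv by simp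
  qed
qed

end

section \<open>Layouts of components\<close>

text \<open>For a small component given as a list, the queue condition becomes a finite comparison
  of weights: \<open>i\<close> is the vertex being placed, and \<open>l\<close> the later end of an
  edge still open.\<close>

lemma build_component_list:
  assumes S0: "build E w S0" "sealed E S0" and K: "K \<inter> S0 = {}" "sealed E K"
    and xs: "distinct xs" "set xs = K"
    and le: "\<forall>l<length xs. \<forall>i<l. \<forall>j<i. \<forall>k<i.
      {xs ! j, xs ! i} \<in> E \<longrightarrow> {xs ! k, xs ! l} \<in> E \<longrightarrow> w {xs ! j, xs ! i} \<le> w {xs ! k, xs ! l}"
  shows "build E w (S0 \<union> K)"
proof -
  have "build E w (S0 \<union> set (take i xs))" if "i \<le> length xs" for i
    using that
  proof (induction i)
    case 0
    then show ?case using S0 by simp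
  next
    case (Suc i)
    then have i: "i < length xs" by simp
    let ?T = "S0 \<union> set (take i xs)"
    have x: "xs ! i \<in> K" "xs ! i \<notin> S0" using i xs(2) K(1) by auto
    have in_take: "\<exists>j<i. u = xs ! j" if u: "u \<in> ?T" "u \<notin> S0" for u
      using u i by (auto simp: in_set_conv_nth)
    have "build E w (insert (xs ! i) ?T)"
    proof (rule build.insert)
      show "build E w ?T" using Suc by simp
      show "xs ! i \<notin> ?T"
        using x(2) i xs(1) by (auto simp: in_set_conv_nth nth_eq_iff_index_eq)
      fix u u' v' assume *: "u \<in> ?T" "{u, xs ! i} \<in> E" "u' \<in> ?T" "v' \<notin> ?T" "v' \<noteq> xs ! i" "{u', v'} \<in> E"
      have "u \<notin> S0" "u' \<notin> S0" using sealedD[OF S0(2) *(2)] sealedD[OF S0(2) *(6)] x(2) *(4) by blast+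
      then obtain j k where jk: "j < i" "u = xs ! j" "k < i" "u' = xs ! k" using in_take *(1,3) by blast
      have "u' \<in> K" using jk i xs(2) by auto
      then have "v' \<in> K" using sealedD[OF K(2) *(6)] by blast
      then obtain l where l: "l < length xs" "v' = xs ! l" using xs(2) by (auto simp: in_set_conv_nth)
      have "\<not> l < i" using *(4) l i by (auto simp: in_set_conv_nth)
      then have "i < l" using *(5) l by (cases "l = i") auto
      then show "w {u, xs ! i} \<le> w {u', v'}" using le l(1) *(2,6) jk l(2) by blast
    qed
    then show ?case using i by (simp add: take_Suc_conv_app_nth)
  qed
  from this[of "length xs"] show ?thesis using xs(2) by simp
qed

lemma diamond_build:
  assumes S0: "build E w S0" "sealed E S0" and K: "K \<inter> S0 = {}" "sealed E K"
    and k: "K = {A, B, C, D}" "distinct [A, B, C, D]"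
    and e: "{e\<in>E. e \<subseteq> K} = {{A, B}, {B, C}, {C, D}, {D, A}, {A, C}}"
  shows "build E w (S0 \<union> K)"
proof (rule ccontr)
  assume no: "\<not> ?thesis"
  have E: "{x, y} \<in> E \<longleftrightarrow> {x, y} \<in> {{A, B}, {B, C}, {C, D}, {D, A}, {A, C}}" if "x \<in> K" "y \<in> K" for x y
    unfolding e[symmetric] using that by simp
  have mem: "{A, B} \<in> E" "{A, C} \<in> E" "{A, D} \<in> E" "{B, A} \<in> E" "{B, C} \<in> E" "{B, D} \<notin> E" "{C, A} \<in> E" "{C, B} \<in> E" "{C, D} \<in> E" "{D, A} \<in> E" "{D, B} \<notin> E" "{D, C} \<in> E"
    using k by (auto simp: E doubleton_eq_iff)
  \<comment> \<open>Each fact below refutes the exact conditions under which one explicit order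
    works. The ten orders together cover every way the five weights can compare.\<close>
  note list = no[THEN notE, OF build_component_list[OF S0 K]]
  have "\<not> (w {A, B} \<le> w {B, C} \<and> w {D, A} \<le> w {B, C} \<and> w {D, A} \<le> w {A, C})"
    by (rule notI, rule list[of "[B, A, D, C]"]) (use k(2) in \<open>auto simp: k(1) All_less_Suc mem insert_commute\<close>)
  moreover have "\<not> (w {B, C} \<le> w {A, B} \<and> w {C, D} \<le> w {A, B} \<and> w {C, D} \<le> w {A, C})"
    by (rule notI, rule list[of "[B, C, D, A]"]) (use k(2) in \<open>auto simp: k(1) All_less_Suc mem insert_commute\<close>)
  moreover have "\<not> (w {A, B} \<le> w {B, C} \<and> w {B, C} \<le> w {D, A} \<and> w {A, C} \<le> w {D, A})"
    by (rule notI, rule list[of "[B, A, C, D]"]) (use k(2) in \<open>auto simp: k(1) All_less_Suc mem insert_commute\<close>)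
  moreover have "\<not> (w {A, B} \<le> w {C, D} \<and> w {B, C} \<le> w {A, B} \<and> w {A, C} \<le> w {C, D})"
    by (rule notI, rule list[of "[B, C, A, D]"]) (use k(2) in \<open>auto simp: k(1) All_less_Suc mem insert_commute\<close>)
  moreover have "\<not> (w {C, D} \<le> w {A, B} \<and> w {D, A} \<le> w {C, D} \<and> w {A, C} \<le> w {A, B})"
    by (rule notI, rule list[of "[D, A, C, B]"]) (use k(2) in \<open>auto simp: k(1) All_less_Suc mem insert_commute\<close>)
  moreover have "\<not> (w {C, D} \<le> w {D, A} \<and> w {D, A} \<le> w {B, C} \<and> w {A, C} \<le> w {B, C})"
    by (rule notI, rule list[of "[D, C, A, B]"]) (use k(2) in \<open>auto simp: k(1) All_less_Suc mem insert_commute\<close>)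
  moreover have "\<not> (w {A, B} \<le> w {C, D} \<and> w {A, B} \<le> w {A, C} \<and> w {D, A} \<le> w {C, D})"
    by (rule notI, rule list[of "[D, A, B, C]"]) (use k(2) in \<open>auto simp: k(1) All_less_Suc mem insert_commute\<close>)
  moreover have "\<not> (w {B, C} \<le> w {D, A} \<and> w {B, C} \<le> w {A, C} \<and> w {C, D} \<le> w {D, A})"
    by (rule notI, rule list[of "[D, C, B, A]"]) (use k(2) in \<open>auto simp: k(1) All_less_Suc mem insert_commute\<close>)
  moreover have "\<not> (w {A, B} \<le> w {B, C} \<and> w {A, B} \<le> w {C, D} \<and> w {D, A} \<le> w {B, C} \<and> w {D, A} \<le> w {C, D})"
    by (rule notI, rule list[of "[B, D, A, C]"]) (use k(2) in \<open>auto simp: k(1) All_less_Suc mem insert_commute\<close>)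
  moreover have "\<not> (w {B, C} \<le> w {A, B} \<and> w {B, C} \<le> w {D, A} \<and> w {C, D} \<le> w {A, B} \<and> w {C, D} \<le> w {D, A})"
    by (rule notI, rule list[of "[B, D, C, A]"]) (use k(2) in \<open>auto simp: k(1) All_less_Suc mem insert_commute\<close>)
  ultimately show False by smt
qed

lemma theta_build:
  assumes S0: "build E w S0" "sealed E S0" and K: "K \<inter> S0 = {}" "sealed E K"
    and k: "K = {P, Q, X, Y, Z}" "distinct [P, Q, X, Y, Z]"
    and e: "{e\<in>E. e \<subseteq> K} = {{P, X}, {P, Y}, {P, Z}, {Q, X}, {Q, Y}, {Q, Z}}"
  shows "build E w (S0 \<union> K)"
proof (rule ccontr)
  assume no: "\<not> ?thesis"
  have E: "{x, y} \<in> E \<longleftrightarrow> {x, y} \<in> {{P, X}, {P, Y}, {P, Z}, {Q, X}, {Q, Y}, {Q, Z}}" if "x \<in> K" "y \<in> K" for x y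
    unfolding e[symmetric] using that by simp
  have mem: "{P, Q} \<notin> E" "{P, X} \<in> E" "{P, Y} \<in> E" "{P, Z} \<in> E" "{Q, P} \<notin> E" "{Q, X} \<in> E" "{Q, Y} \<in> E" "{Q, Z} \<in> E" "{X, P} \<in> E" "{X, Q} \<in> E" "{X, Y} \<notin> E" "{X, Z} \<notin> E" "{Y, P} \<in> E" "{Y, Q} \<in> E" "{Y, X} \<notin> E" "{Y, Z} \<notin> E" "{Z, P} \<in> E" "{Z, Q} \<in> E" "{Z, X} \<notin> E" "{Z, Y} \<notin> E"
    using k by (auto simp: E doubleton_eq_iff)
  \<comment> \<open>The same with eighteen orders: six place two middle vertices, then a hub, the
    third middle vertex and the other hub; twelve alternate between middle vertices and
    hubs.\<close>
  note list = no[THEN notE, OF build_component_list[OF S0 K]]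
  have "\<not> (w {P, X} \<le> w {Q, X} \<and> w {P, X} \<le> w {Q, Y} \<and> w {P, Y} \<le> w {Q, X} \<and> w {P, Y} \<le> w {Q, Y} \<and> w {P, Z} \<le> w {Q, X} \<and> w {P, Z} \<le> w {Q, Y})"
    by (rule notI, rule list[of "[X, Y, P, Z, Q]"]) (use k(2) in \<open>auto simp: k(1) All_less_Suc mem insert_commute\<close>)
  moreover have "\<not> (w {Q, X} \<le> w {P, X} \<and> w {Q, X} \<le> w {P, Y} \<and> w {Q, Y} \<le> w {P, X} \<and> w {Q, Y} \<le> w {P, Y} \<and> w {Q, Z} \<le> w {P, X} \<and> w {Q, Z} \<le> w {P, Y})"
    by (rule notI, rule list[of "[X, Y, Q, Z, P]"]) (use k(2) in \<open>auto simp: k(1) All_less_Suc mem insert_commute\<close>)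
  moreover have "\<not> (w {P, X} \<le> w {Q, X} \<and> w {P, Y} \<le> w {P, Z} \<and> w {P, Y} \<le> w {Q, X} \<and> w {Q, X} \<le> w {P, Z} \<and> w {Q, Y} \<le> w {P, Z})"
    by (rule notI, rule list[of "[X, P, Y, Q, Z]"]) (use k(2) in \<open>auto simp: k(1) All_less_Suc mem insert_commute\<close>)
  moreover have "\<not> (w {P, X} \<le> w {Q, X} \<and> w {P, Z} \<le> w {P, Y} \<and> w {P, Z} \<le> w {Q, X} \<and> w {Q, X} \<le> w {P, Y} \<and> w {Q, Z} \<le> w {P, Y})"
    by (rule notI, rule list[of "[X, P, Z, Q, Y]"]) (use k(2) in \<open>auto simp: k(1) All_less_Suc mem insert_commute\<close>)
  moreover have "\<not> (w {P, X} \<le> w {Q, Z} \<and> w {P, Y} \<le> w {Q, Z} \<and> w {Q, X} \<le> w {P, X} \<and> w {Q, Y} \<le> w {P, X} \<and> w {Q, Y} \<le> w {Q, Z})"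
    by (rule notI, rule list[of "[X, Q, Y, P, Z]"]) (use k(2) in \<open>auto simp: k(1) All_less_Suc mem insert_commute\<close>)
  moreover have "\<not> (w {P, X} \<le> w {Q, Y} \<and> w {P, Z} \<le> w {Q, Y} \<and> w {Q, X} \<le> w {P, X} \<and> w {Q, Z} \<le> w {P, X} \<and> w {Q, Z} \<le> w {Q, Y})"
    by (rule notI, rule list[of "[X, Q, Z, P, Y]"]) (use k(2) in \<open>auto simp: k(1) All_less_Suc mem insert_commute\<close>)
  moreover have "\<not> (w {P, Y} \<le> w {Q, Y} \<and> w {P, Z} \<le> w {P, X} \<and> w {P, Z} \<le> w {Q, Y} \<and> w {Q, Y} \<le> w {P, X} \<and> w {Q, Z} \<le> w {P, X})"
    by (rule notI, rule list[of "[Y, P, Z, Q, X]"]) (use k(2) in \<open>auto simp: k(1) All_less_Suc mem insert_commute\<close>)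
  moreover have "\<not> (w {P, Y} \<le> w {Q, X} \<and> w {P, Z} \<le> w {Q, X} \<and> w {Q, Y} \<le> w {P, Y} \<and> w {Q, Z} \<le> w {P, Y} \<and> w {Q, Z} \<le> w {Q, X})"
    by (rule notI, rule list[of "[Y, Q, Z, P, X]"]) (use k(2) in \<open>auto simp: k(1) All_less_Suc mem insert_commute\<close>)
  moreover have "\<not> (w {P, X} \<le> w {Q, X} \<and> w {P, X} \<le> w {Q, Z} \<and> w {P, Y} \<le> w {Q, X} \<and> w {P, Y} \<le> w {Q, Z} \<and> w {P, Z} \<le> w {Q, X} \<and> w {P, Z} \<le> w {Q, Z})"
    by (rule notI, rule list[of "[X, Z, P, Y, Q]"]) (use k(2) in \<open>auto simp: k(1) All_less_Suc mem insert_commute\<close>)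
  moreover have "\<not> (w {Q, X} \<le> w {P, X} \<and> w {Q, X} \<le> w {P, Z} \<and> w {Q, Y} \<le> w {P, X} \<and> w {Q, Y} \<le> w {P, Z} \<and> w {Q, Z} \<le> w {P, X} \<and> w {Q, Z} \<le> w {P, Z})"
    by (rule notI, rule list[of "[X, Z, Q, Y, P]"]) (use k(2) in \<open>auto simp: k(1) All_less_Suc mem insert_commute\<close>)
  moreover have "\<not> (w {P, X} \<le> w {Q, Y} \<and> w {P, X} \<le> w {Q, Z} \<and> w {P, Y} \<le> w {Q, Y} \<and> w {P, Y} \<le> w {Q, Z} \<and> w {P, Z} \<le> w {Q, Y} \<and> w {P, Z} \<le> w {Q, Z})"
    by (rule notI, rule list[of "[Y, Z, P, X, Q]"]) (use k(2) in \<open>auto simp: k(1) All_less_Suc mem insert_commute\<close>)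
  moreover have "\<not> (w {Q, X} \<le> w {P, Y} \<and> w {Q, X} \<le> w {P, Z} \<and> w {Q, Y} \<le> w {P, Y} \<and> w {Q, Y} \<le> w {P, Z} \<and> w {Q, Z} \<le> w {P, Y} \<and> w {Q, Z} \<le> w {P, Z})"
    by (rule notI, rule list[of "[Y, Z, Q, X, P]"]) (use k(2) in \<open>auto simp: k(1) All_less_Suc mem insert_commute\<close>)
  moreover have "\<not> (w {P, X} \<le> w {P, Z} \<and> w {P, X} \<le> w {Q, Y} \<and> w {P, Y} \<le> w {Q, Y} \<and> w {Q, X} \<le> w {P, Z} \<and> w {Q, Y} \<le> w {P, Z})"
    by (rule notI, rule list[of "[Y, P, X, Q, Z]"]) (use k(2) in \<open>auto simp: k(1) All_less_Suc mem insert_commute\<close>)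
  moreover have "\<not> (w {P, X} \<le> w {Q, Z} \<and> w {P, Y} \<le> w {Q, Z} \<and> w {Q, X} \<le> w {P, Y} \<and> w {Q, X} \<le> w {Q, Z} \<and> w {Q, Y} \<le> w {P, Y})"
    by (rule notI, rule list[of "[Y, Q, X, P, Z]"]) (use k(2) in \<open>auto simp: k(1) All_less_Suc mem insert_commute\<close>)
  moreover have "\<not> (w {P, X} \<le> w {P, Y} \<and> w {P, X} \<le> w {Q, Z} \<and> w {P, Z} \<le> w {Q, Z} \<and> w {Q, X} \<le> w {P, Y} \<and> w {Q, Z} \<le> w {P, Y})"
    by (rule notI, rule list[of "[Z, P, X, Q, Y]"]) (use k(2) in \<open>auto simp: k(1) All_less_Suc mem insert_commute\<close>)
  moreover have "\<not> (w {P, Y} \<le> w {P, X} \<and> w {P, Y} \<le> w {Q, Z} \<and> w {P, Z} \<le> w {Q, Z} \<and> w {Q, Y} \<le> w {P, X} \<and> w {Q, Z} \<le> w {P, X})"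
    by (rule notI, rule list[of "[Z, P, Y, Q, X]"]) (use k(2) in \<open>auto simp: k(1) All_less_Suc mem insert_commute\<close>)
  moreover have "\<not> (w {P, X} \<le> w {Q, Y} \<and> w {P, Z} \<le> w {Q, Y} \<and> w {Q, X} \<le> w {P, Z} \<and> w {Q, X} \<le> w {Q, Y} \<and> w {Q, Z} \<le> w {P, Z})"
    by (rule notI, rule list[of "[Z, Q, X, P, Y]"]) (use k(2) in \<open>auto simp: k(1) All_less_Suc mem insert_commute\<close>)
  moreover have "\<not> (w {P, Y} \<le> w {Q, X} \<and> w {P, Z} \<le> w {Q, X} \<and> w {Q, Y} \<le> w {P, Z} \<and> w {Q, Y} \<le> w {Q, X} \<and> w {Q, Z} \<le> w {P, Z})"
    by (rule notI, rule list[of "[Z, Q, Y, P, X]"]) (use k(2) in \<open>auto simp: k(1) All_less_Suc mem insert_commute\<close>)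
  ultimately show False by smt
qed

section \<open>Assembling the components\<close>

lemma sealed_superset:
  assumes "sealed E K" "conn E X" "x \<in> X" "x \<in> K"
  shows "X \<subseteq> K"
proof -
  have "X \<subseteq> component E x" using component_superset[OF assms(2,3)] .
  also have "\<dots> \<subseteq> K" using assms(4) sealedD[OF assms(1)] by (intro component_subset) blast+
  finally show ?thesis .
qed

lemma nonbridge_conn:
  assumes K: "conn E K" "sealed E K" and nb: "nonbridge E x y" "x \<in> K"
  shows "conn (E - {{x, y}}) K"
proof -
  obtain X where X: "conn (E - {{x, y}}) X" "x \<in> X" "y \<in> X" using nb(1) unfolding nonbridge_def by blast
  have "conn E X" using conn_mono[OF X(1)] by blast
  then have XK: "X \<subseteq> K" using sealed_superset[OF K(2)] X(2) nb(2) by blast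
  have "conn (E - {{x, y}}) (K \<union> X)"
    by (rule conn_replace[OF K(1) X(1)]) (use X nb(2) in auto)
  then show ?thesis using XK by (simp add: Un_absorb2)
qed

lemma build_tree:
  assumes E: "finite E" and S0: "build E w S0" "sealed E S0"
    and K: "conn E K" "finite K" "K \<inter> S0 = {}" "sealed E K"
    and nb: "\<And>x y. x \<in> K \<Longrightarrow> \<not> nonbridge E x y"
  shows "build E w (S0 \<union> K)"
proof -
  obtain r where r: "r \<in> K" using conn_ne[OF K(1)] by blast
  then have rS0: "r \<notin> S0" using K(3) by blast
  have "build E w (insert r S0)"
    by (rule build.insert[OF S0(1) rS0]) (use sealedD[OF S0(2)] rS0 in blast)
  moreover have "insert r S0 - S0 = {r}" using rS0 by auto
  ultimately show ?thesis
    using build_prim[OF E S0(2) K, of w "insert r S0"] r nb by auto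
qed

text \<open>A simple path between \<open>u\<close> and \<open>v\<close> that avoids their edge has
  at least three vertices and is closed by this edge. The edge then joins \<open>c (n - 1)\<close>
  and \<open>c 0\<close>, where \<open>layout\<close> expects the heaviest one.\<close>

lemma path_cycle:
  assumes card: "\<And>e. e \<in> E \<Longrightarrow> card e = 2" and nb: "nonbridge E u v"
  obtains c :: "nat \<Rightarrow> 'a" and n where "3 \<le> n" "\<And>i. c (i + n) = c i" "inj_on c {..<n}"
    "\<And>i. {c i, c (Suc i)} \<in> E" "c 0 = u" "c (n - 1) = v"
proof -
  obtain X where X: "{u, v} \<in> E" "conn (E - {{u, v}}) X" "u \<in> X" "v \<in> X" using nb unfolding nonbridge_def by blast
  obtain xs where xs: "xs \<noteq> []" "distinct xs" "hd xs = u" "last xs = v"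
    "successively (\<lambda>a b. {a, b} \<in> E - {{u, v}}) xs"
    using conn_path[OF X(2-4)] by metis
  define n where "n = length xs"
  define c where "c i = xs ! (i mod n)" for i
  have uv: "u \<noteq> v" using card[OF X(1)] by auto
  have n3: "3 \<le> n"
  proof (rule ccontr)
    assume "\<not> 3 \<le> n"
    moreover have "n \<noteq> 0" using xs(1) unfolding n_def by simp
    ultimately have "n = 1 \<or> n = 2" by linarith
    then show False
    proof
      assume "n = 1"
      then obtain x where "xs = [x]" unfolding n_def by (auto simp: length_Suc_conv)
      then show False using xs(3,4) uv by simp
    next
      assume "n = 2"
      then obtain x y where "xs = [x, y]" unfolding n_def by (auto simp: length_Suc_conv numeral_2_eq_2)
      then show False using xs(3-5) by auto
    qed
  qed
  have c0: "c 0 = u" and cn: "c (n - 1) = v"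
    using xs(1,3,4) n3 unfolding c_def n_def by (simp_all add: hd_conv_nth last_conv_nth)
  show ?thesis
  proof
    show "3 \<le> n" "c 0 = u" "c (n - 1) = v" by (fact n3 c0 cn)+
    show "c (i + n) = c i" for i unfolding c_def by simp
    show "inj_on c {..<n}" using xs(2) unfolding c_def n_def by (auto simp: inj_on_def nth_eq_iff_index_eq)
    fix i
    show "{c i, c (Suc i)} \<in> E"
    proof (cases "Suc (i mod n) = n")
      case True
      then have "i mod n = n - 1" "Suc i mod n = 0" by (simp_all add: mod_Suc)
      moreover have "(n - 1) mod n = n - 1" using n3 by simp
      ultimately have "c i = v" "c (Suc i) = u" using cn c0 unfolding c_def by simp_all
      then show ?thesis using X(1) by (simp add: insert_commute)
    next
      case False
      moreover have "i mod n < n" using n3 by simp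
      ultimately have "Suc (i mod n) < n" "Suc i mod n = Suc (i mod n)" by (simp_all add: mod_Suc)
      then show ?thesis using xs(5) unfolding c_def n_def successively_conv_nth by auto
    qed
  qed
qed

lemma build_component:
  assumes G: "minor_free G" and S0: "build (edges G) w S0" "sealed (edges G) S0"
    and K: "conn (edges G) K" "K \<subseteq> verts G" "sealed (edges G) K" "K \<inter> S0 = {}"
  shows "build (edges G) w (S0 \<union> K)"
proof -
  let ?E = "edges G"
  note simple = minor_freeD(1)[OF G]
  note fin = simple_graph_finite[OF simple]
  have fK: "finite K" using K(2) fin(1) finite_subset by blast
  have card: "card e = 2" if "e \<in> ?E" for e using simple that unfolding simple_graph_def by blast
  consider "\<forall>x\<in>K. \<forall>y. \<not> nonbridge ?E x y"
    | x y u v where "x \<in> K" "u \<in> K" "nonbridge ?E x y" "nonbridge (?E - {{x, y}}) u v"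
    | x0 y0 where "x0 \<in> K" "nonbridge ?E x0 y0"
      "\<And>x y u v. x \<in> K \<Longrightarrow> u \<in> K \<Longrightarrow> nonbridge ?E x y \<Longrightarrow> \<not> nonbridge (?E - {{x, y}}) u v"
    by metis
  then show ?thesis
  proof cases
    case 1
    then show ?thesis using build_tree[OF fin(2) S0 K(1) fK K(4,3)] by blast
  next
    case (2 x y u v)
    have xy: "{x, y} \<in> ?E" and uv: "{u, v} \<in> ?E" "{u, v} \<noteq> {x, y}"
      using 2(3,4) unfolding nonbridge_def by auto
    have yK: "y \<in> K" using sealedD[OF K(3) xy] 2(1) by blast
    obtain X where X: "conn (?E - {{x, y}} - {{u, v}}) X" "u \<in> X" "v \<in> X"
      using 2(4) unfolding nonbridge_def by blast
    have "conn ?E X" using conn_mono[OF X(1)] by blast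
    then have XK: "X \<subseteq> K" using sealed_superset[OF K(3) _ X(2) 2(2)] by blast
    obtain a b c d where "diamond G a b c d" "a \<union> b \<union> c \<union> d \<subseteq> K"
      using two_cycles_diamond[OF G K(2) xy 2(1) yK nonbridge_conn[OF K(1,3) 2(3,1)] uv X XK] by blast
    from diamond_classify[OF G K(1,2) this] show ?thesis
    proof (elim disjE exE conjE)
      fix A B C D assume "K = {A, B, C, D}" "distinct [A, B, C, D]"
        "{e\<in>?E. e \<subseteq> K} = {{A, B}, {B, C}, {C, D}, {D, A}, {A, C}}"
      then show ?thesis by (rule diamond_build[OF S0 K(4,3)])
    next
      fix P Q X Y Z assume "K = {P, Q, X, Y, Z}" "distinct [P, Q, X, Y, Z]"
        "{e\<in>?E. e \<subseteq> K} = {{P, X}, {P, Y}, {P, Z}, {Q, X}, {Q, Y}, {Q, Z}}"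
      then show ?thesis by (rule theta_build[OF S0 K(4,3)])
    qed
  next
    case (3 x0 y0)
    \<comment> \<open>The edges of the cycle, described before the cycle itself is at hand; the
      heaviest of them becomes its closing edge.\<close>
    define N where "N = {e\<in>?E. \<exists>x\<in>K. \<exists>y. e = {x, y} \<and> nonbridge ?E x y}"
    have "{x0, y0} \<in> N" using 3(1,2) unfolding N_def nonbridge_def by blast
    moreover have finN: "finite N" unfolding N_def using fin(2) by simp
    ultimately obtain e where e: "e \<in> N" "\<And>f. f \<in> N \<Longrightarrow> w f \<le> w e"
      using arg_min_if_finite[of N "\<lambda>f. - w f"] by (metis empty_iff not_le neg_less_iff_less)
    then obtain u v where uv: "u \<in> K" "e = {u, v}" "nonbridge ?E u v" unfolding N_def by blast
    obtain c :: "nat \<Rightarrow> 'a" and n where c: "3 \<le> n" "\<And>i. c (i + n) = c i" "inj_on c {..<n}"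
      "\<And>i. {c i, c (Suc i)} \<in> ?E" "c 0 = u" "c (n - 1) = v"
      using path_cycle[OF card uv(3)] by metis
    have c0: "c 0 \<in> K" using c(5) uv(1) by simp
    \<comment> \<open>The maximum over all edges is a provisional \<open>m\<close>. This instance
      only shows that the edges of \<open>c\<close> are nonbridges within \<open>K\<close>, hence in
      \<open>N\<close>, which then yields the sharp bound \<open>w e\<close>.\<close>
    interpret pre: unicyclic G w K S0 c n "Max (w ` ?E)"
    proof
      show "w {c i, c (Suc i)} \<le> Max (w ` ?E)" for i using fin(2) c(4) by simp
    qed (rule G K S0 c(1-4) c0 3(3); assumption)+
    interpret unicyclic G w K S0 c n "w e"
    proof
      fix i
      have "{c i, c (Suc i)} \<in> N" unfolding N_def using pre.c_nonbridge pre.c_in_K c(4) by blast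
      then show "w {c i, c (Suc i)} \<le> w e" by (rule e(2))
    qed (rule G K S0 c(1-4) c0 3(3); assumption)+
    have "w e \<le> w {c (n - 1), c 0}" unfolding c(5,6) uv(2) by (simp add: insert_commute)
    then show ?thesis by (rule layout)
  qed
qed

text \<open>Components are placed one after another; as \<open>S0\<close> is sealed, no edge is open
  between them.\<close>

lemma minor_free_build:
  assumes G: "minor_free G" and S0: "build (edges G) w S0" "sealed (edges G) S0" "S0 \<subseteq> verts G"
  shows "build (edges G) w (verts G)"
  using S0
proof (induction "card (verts G - S0)" arbitrary: S0 rule: less_induct)
  case less
  let ?E = "edges G" and ?V = "verts G"
  note simple = minor_freeD(1)[OF G]
  show ?case
  proof (cases "?V - S0 = {}")
    case True
    then have "S0 = ?V" using less.prems(3) by blast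
    then show ?thesis using less.prems(1) by simp
  next
    case False
    then obtain x where x: "x \<in> ?V" "x \<notin> S0" by blast
    let ?K = "component ?E x"
    have xK: "x \<in> ?K" by (rule component_self)
    have EV: "z \<in> ?V" if "{y, z} \<in> ?E" for y z using simple that unfolding simple_graph_def by auto
    have KV: "?K \<subseteq> ?V" using x(1) EV by (intro component_subset)
    have "?K \<subseteq> - S0" using x(2) sealedD[OF less.prems(2)] by (intro component_subset) auto
    then have KS0: "?K \<inter> S0 = {}" by blast
    have Ks: "sealed ?E ?K" unfolding sealed_def using component_step[of _ ?E x] by blast
    show ?thesis
    proof (rule less.hyps)
      show "build ?E w (S0 \<union> ?K)" by (rule build_component[OF G less.prems(1,2) component_conn KV Ks KS0])
      show "sealed ?E (S0 \<union> ?K)" by (rule sealed_Un[OF less.prems(2) Ks])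
      show "S0 \<union> ?K \<subseteq> ?V" using less.prems(3) KV by blast
      show "card (?V - (S0 \<union> ?K)) < card (?V - S0)"
        using x xK simple_graph_finite[OF simple] by (intro psubset_card_mono) auto
    qed
  qed
qed

lemma forbidden_simple:
  assumes "F \<in> {F1, F2, F3, F4, F5, F6, F7, F8}"
  shows "simple_graph F"
  using assms
  by (elim insertE; simp add: simple_graph_def F1_def F2_def F3_def F4_def F5_def F6_def F7_def F8_def)

theorem theorem4p14:
  fixes G :: "'a graph"
  assumes "simple_graph G"
    and "edges G \<noteq> {}"
  shows "pqn G = 1 \<longleftrightarrow> (\<forall>F \<in> {F1, F2, F3, F4, F5, F6, F7, F8}. \<not> has_minor G F)"
proof -
  have minors: "(\<forall>F \<in> {F1, F2, F3, F4, F5, F6, F7, F8}. \<not> has_minor G F) \<longleftrightarrow> minor_free G"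
    unfolding minor_free_def using assms(1) has_minor_iff_model[OF assms(1) forbidden_simple] by blast
  show ?thesis
    unfolding pqn_eq_1_iff[OF assms] minors
  proof
    assume "\<forall>w. \<exists>r. layout1 G w r"
    then show "minor_free G" unfolding minor_free_def using assms(1) no_layout_of_minor[OF assms(1)] by blast
  next
    assume G: "minor_free G"
    show "\<forall>w. \<exists>r. layout1 G w r"
    proof
      fix w
      have "build (edges G) w (verts G)"
        by (rule minor_free_build[OF G build.empty]) (simp_all add: sealed_def)
      then show "\<exists>r. layout1 G w r" by (rule build_layout1)
    qed
  qed
qed

end
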